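(* Let $N\ge 2$ be an integer and $0\le\beta<N$. Let $\sigma=(\sigma_1,\dots,\sigma_n)$ be distributed according to the Gibbs measure $P_{n,\beta}$ and set $W_n=\sqrt{\frac{N-\beta}{n}}\sum_{i=1}^n\sigma_i\in\mathbb{R}^N$. Then $$\sup_{g:\,L(g)\le 1,\,M(g)\le 1}\big|\mathbb{E}g(W_n)-\mathbb{E}g(Z)\big|\le\frac{c_\beta}{\sqrt n},$$ where $c_\beta$ is a constant depending only on $\beta$ (for the fixed $N$), $Z$ is a standard Gaussian random vector in $\mathbb{R}^N$, and the supremum is over functions $g:\mathbb{R}^N\to\mathbb{R}$ with Lipschitz constant $L(g)\le1$ and $M(g)\le 1$, $M(g)$ being the supremum over $\mathbb{R}^N$ of the operator norm of the Hessian of $g$.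
   Context: Mean-field $O(N)$ model: $\Omega_n=(\mathbb{S}^{N-1})^n$ with product $P_n$ of the uniform probability measure on $\mathbb{S}^{N-1}$; the Gibbs measure $P_{n,\beta}$ has density proportional to $\exp\left(\frac{\beta}{2n}\sum_{i,j=1}^n\langle\sigma_i,\sigma_j\rangle\right)$ with respect to $P_n$. *)

theory Defs
  imports "HOL-Analysis.Analysis"
begin

text \<open>Uniform probability measure on the unit sphere S^{N-1} of R^N (N = CARD('d)),
  realised as the cone measure: push-forward of the normalised Lebesgue measure on the
  unit ball under x \<mapsto> x / |x|. This is the rotation-invariant (normalised surface) measure.\<close>
definition sphere_unif :: "(real ^ 'd) measure" where
  "sphere_unif = distr (uniform_measure lborel (ball 0 1)) borel (\<lambda>x. x /\<^sub>R norm x)"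

definition Pn :: "nat \<Rightarrow> (nat \<Rightarrow> real ^ 'd) measure" where
  "Pn n = PiM {..<n} (\<lambda>_. sphere_unif)"

definition gibbs_weight :: "real \<Rightarrow> nat \<Rightarrow> (nat \<Rightarrow> real ^ 'd) \<Rightarrow> real" where
  "gibbs_weight \<beta> n \<sigma> = exp (\<beta> / (2 * real n) * (\<Sum>i<n. \<Sum>j<n. \<sigma> i \<bullet> \<sigma> j))"

definition gibbs :: "real \<Rightarrow> nat \<Rightarrow> (nat \<Rightarrow> real ^ 'd::finite) measure" where
  "gibbs \<beta> n = density (Pn n)
     (\<lambda>\<sigma>. ennreal (gibbs_weight \<beta> n \<sigma> / (\<integral>\<tau>. gibbs_weight \<beta> n \<tau> \<partial>(Pn n :: (nat \<Rightarrow> real ^ 'd) measure))))"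

definition Wn :: "real \<Rightarrow> nat \<Rightarrow> (nat \<Rightarrow> real ^ 'd) \<Rightarrow> real ^ 'd" where
  "Wn \<beta> n \<sigma> = sqrt ((real CARD('d) - \<beta>) / real n) *\<^sub>R (\<Sum>i<n. \<sigma> i)"

definition std_gauss :: "(real ^ 'd) measure" where
  "std_gauss = density lborel
     (\<lambda>x. ennreal ((2 * pi) powr (- real CARD('d) / 2) * exp (- (norm x)\<^sup>2 / 2)))"

definition test_fun :: "(real ^ 'd \<Rightarrow> real) \<Rightarrow> bool" where
  "test_fun g \<longleftrightarrow> lipschitz_on 1 UNIV g \<and>
     (\<exists>G :: real ^ 'd \<Rightarrow> real ^ 'd.
        (\<forall>x. (g has_derivative (\<lambda>h. G x \<bullet> h)) (at x)) \<and>
        (\<forall>x. \<exists>H. (G has_derivative H) (at x) \<and> onorm H \<le> 1))"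

end

theory Submission
  imports Defs "HOL-Probability.Probability"
begin

text \<open>
  Write \<open>S\<close> for the sum of the spins, \<open>C\<close> for their empirical covariance matrix and \<open>D = C - I / N\<close>.
  Rotation invariance of the uniform measure on the sphere yields, for a vector field \<open>G\<close> with
  derivative \<open>H\<close>, the Stein-type identity
  \<open>E[W \<bullet> G (q W + y)] = q E[tr H] + error\<close>, in which the error is an average of terms linear in \<open>D\<close>
  with coefficients of order \<open>1 + |W|\<close>. Since \<open>g\<close> has a bounded gradient \<open>G\<close> and a bounded Hessian,
  differentiating \<open>E[g (sin t W + cos t Z)]\<close> in \<open>t\<close> and integrating by parts in both \<open>W\<close> and
  \<open>Z\<close> leaves only this error, so that no third derivatives and no solution of Stein's equation
  are needed. The error is of order \<open>n\<^sup>-\<^sup>1\<^sup>/\<^sup>2\<close>: a spin is sub-Gaussian with variance proxy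
  \<open>1 / N\<close>, so \<open>exp (a |S|\<^sup>2 / 2n)\<close> has bounded mean under the product measure for every
  \<open>a < N\<close>, while Hoeffding's lemma bounds the exponential moments of \<open>\<surd>n D\<close>; a Young-type
  inequality combines the two.
\<close>

section \<open>Differentiation under the integral and invariance of Lebesgue measure\<close>

text \<open>The scale of \<open>W\<close> comes from solving the integration by parts for its left
  side. Summed over the spins it reads \<open>(N - 1) E[S . G] = (1 - 1/N) (n a E[tr H] + \<beta>
  E[S . G]) - error\<close>, because differentiating the Gibbs weight reproduces
  \<open>S . G\<close>. Moving that term over leaves \<open>(N - 1) (N - \<beta>) / N\<close> on the
  left, and the factor \<open>sqrt ((N - \<beta>) / n)\<close> is the one that makes the trace
  coefficient exactly \<open>q\<close>. The obstacle is that the fluctuation bounds hold under the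
  product measure, while the Gibbs density is not bounded uniformly in \<open>n\<close>. The gap
  between \<open>\<beta>\<close> and \<open>N\<close> leaves room for a slightly larger exponent
  that absorbs squares. The Hessian is bounded but not assumed continuous: differentiation under the
  integral therefore rests on Lipschitz domination, and measurability of the Hessian entries on
  difference quotients.\<close>

text \<open>Along every null sequence of increments the difference quotients are dominated by
  \<open>K\<close>, so dominated convergence applies; \<open>\<Phi>'\<close> is measurable as their
  pointwise limit. Only a Lipschitz bound anchored at \<open>t0\<close> enters, which suits
  functions with bounded but possibly discontinuous derivative.\<close>

lemma dominated_derivative:
  fixes \<Phi> :: "real \<Rightarrow> 'a \<Rightarrow> real"
  assumes int: "\<And>t. integrable M (\<Phi> t)"
    and deriv: "\<And>\<omega>. \<omega> \<in> space M \<Longrightarrow> ((\<lambda>t. \<Phi> t \<omega>) has_real_derivative \<Phi>' \<omega>) (at t0)"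
    and lip: "AE \<omega> in M. \<forall>t. \<bar>t - t0\<bar> \<le> 1 \<longrightarrow> \<bar>\<Phi> t \<omega> - \<Phi> t0 \<omega>\<bar> \<le> K \<omega> * \<bar>t - t0\<bar>"
    and K: "integrable M K"
  shows dominated_derivative_integrable: "integrable M \<Phi>'"
    and dominated_derivative_has_derivative:
      "((\<lambda>t. \<integral>\<omega>. \<Phi> t \<omega> \<partial>M) has_real_derivative (\<integral>\<omega>. \<Phi>' \<omega> \<partial>M)) (at t0)"
proof -
  have *: "integrable M \<Phi>' \<and> (\<lambda>i. ((\<integral>\<omega>. \<Phi> (t0 + h i) \<omega> \<partial>M) - (\<integral>\<omega>. \<Phi> t0 \<omega> \<partial>M)) / h i) \<longlonglongrightarrow> (\<integral>\<omega>. \<Phi>' \<omega> \<partial>M)"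
    if h0: "\<And>i. h i \<noteq> 0" and h: "h \<longlonglongrightarrow> 0" and h1: "\<And>i. \<bar>h i\<bar> \<le> 1" for h :: "nat \<Rightarrow> real"
  proof -
    define q where "q i \<omega> = (\<Phi> (t0 + h i) \<omega> - \<Phi> t0 \<omega>) / h i" for i \<omega>
    have q_int: "integrable M (q i)" for i
      unfolding q_def using int by auto
    have lim: "(\<lambda>i. q i \<omega>) \<longlonglongrightarrow> \<Phi>' \<omega>" if "\<omega> \<in> space M" for \<omega>
    proof -
      have "((\<lambda>u. (\<Phi> (t0 + u) \<omega> - \<Phi> t0 \<omega>) / u) \<longlongrightarrow> \<Phi>' \<omega>) (at 0)"
        using deriv[OF that] by (simp add: DERIV_def)
      moreover have "filterlim h (at 0) sequentially"
        using h h0 by (auto simp: filterlim_at)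
      ultimately show ?thesis
        unfolding q_def by (rule filterlim_compose)
    qed
    have meas: "\<Phi>' \<in> borel_measurable M"
      by (rule borel_measurable_LIMSEQ_real[where u = q]) (use lim q_int in auto)
    have bd: "AE \<omega> in M. norm (q i \<omega>) \<le> K \<omega>" for i
      using lip
    proof eventually_elim
      case (elim \<omega>)
      then have "\<bar>\<Phi> (t0 + h i) \<omega> - \<Phi> t0 \<omega>\<bar> \<le> K \<omega> * \<bar>h i\<bar>"
        using h1[of i] by (auto dest: spec[of _ "t0 + h i"])
      then show ?case
        using h0[of i] by (simp add: q_def abs_divide field_simps)
    qed
    have "integrable M \<Phi>'"
      by (rule integrable_dominated_convergence[where s = q and w = K])
        (use meas q_int K lim bd in \<open>auto intro: AE_I2\<close>)
    moreover have "(\<lambda>i. \<integral>\<omega>. q i \<omega> \<partial>M) \<longlonglongrightarrow> (\<integral>\<omega>. \<Phi>' \<omega> \<partial>M)"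
      by (rule integral_dominated_convergence[where w = K])
        (use meas q_int K lim bd in \<open>auto intro: AE_I2\<close>)
    ultimately show ?thesis
      using int by (simp add: q_def)
  qed
  have "(\<lambda>i. 1 / real (Suc i)) \<longlonglongrightarrow> 0"
    by real_asymp
  then show "integrable M \<Phi>'"
    using *[of "\<lambda>i. 1 / real (Suc i)"] by auto
  show "((\<lambda>t. \<integral>\<omega>. \<Phi> t \<omega> \<partial>M) has_real_derivative (\<integral>\<omega>. \<Phi>' \<omega> \<partial>M)) (at t0)"
    unfolding DERIV_def
  proof (rule LIMSEQ_SEQ_conv[THEN iffD1])
    show "\<forall>S. (\<forall>n. S n \<noteq> 0) \<and> S \<longlonglongrightarrow> 0 \<longrightarrow> (\<lambda>i. ((\<integral>\<omega>. \<Phi> (t0 + S i) \<omega> \<partial>M) - (\<integral>\<omega>. \<Phi> t0 \<omega> \<partial>M)) / S i) \<longlonglongrightarrow> (\<integral>\<omega>. \<Phi>' \<omega> \<partial>M)"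
    proof (intro allI impI, elim conjE)
      fix S :: "nat \<Rightarrow> real" assume S: "\<forall>n. S n \<noteq> 0" "S \<longlonglongrightarrow> 0"
      \<comment> \<open>The claim \<open>*\<close> wants all increments to be at most 1, so an
        initial segment is cut off here and restored by \<open>LIMSEQ_offset\<close>.\<close>
      have "\<forall>\<^sub>F i in sequentially. \<bar>S i\<bar> < 1"
        using tendstoD[OF S(2), of 1] by simp
      then obtain m where m: "\<And>i. i \<ge> m \<Longrightarrow> \<bar>S i\<bar> < 1"
        by (auto simp: eventually_sequentially)
      have "(\<lambda>i. ((\<integral>\<omega>. \<Phi> (t0 + S (i + m)) \<omega> \<partial>M) - (\<integral>\<omega>. \<Phi> t0 \<omega> \<partial>M)) / S (i + m)) \<longlonglongrightarrow> (\<integral>\<omega>. \<Phi>' \<omega> \<partial>M)"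
        using *[of "\<lambda>i. S (i + m)"] S m by (auto simp: less_imp_le intro: LIMSEQ_ignore_initial_segment)
      then show "(\<lambda>i. ((\<integral>\<omega>. \<Phi> (t0 + S i) \<omega> \<partial>M) - (\<integral>\<omega>. \<Phi> t0 \<omega> \<partial>M)) / S i) \<longlonglongrightarrow> (\<integral>\<omega>. \<Phi>' \<omega> \<partial>M)"
        by (rule LIMSEQ_offset)
    qed
  qed
qed

lemma ball_emeasure_pos_finite:
  "emeasure lborel (ball (0::'a::euclidean_space) 1) \<noteq> 0"
  "emeasure lborel (ball (0::'a::euclidean_space) 1) \<noteq> \<infinity>"
  using emeasure_lborel_ball_finite[of "0::'a" 1] less_imp_neq[OF unit_ball_vol_pos[of "real DIM('a)"]]
  by (auto simp: emeasure_ball)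

text \<open>Swapping the integrals in \<open>\<integral>\<integral> f (R x) h (y - R x) dx dy\<close>, with \<open>h\<close> the indicator of the
  unit ball, compares the two sides (uniqueness of Haar measure).\<close>
lemma nn_integral_lborel_orthogonal:
  fixes R :: "'a::euclidean_space \<Rightarrow> 'a" and f :: "'a \<Rightarrow> ennreal"
  assumes R: "orthogonal_transformation R" and [measurable]: "f \<in> borel_measurable borel"
  shows "(\<integral>\<^sup>+x. f (R x) \<partial>lborel) = (\<integral>\<^sup>+x. f x \<partial>lborel)"
proof -
  have lin: "linear R"
    using R by (rule orthogonal_transformation_linear)
  have [measurable]: "R \<in> borel_measurable borel"
    using lin by (intro borel_measurable_continuous_onI linear_continuous_on linear_linear[THEN iffD2] )
  define h :: "'a \<Rightarrow> ennreal" where "h = indicator (ball 0 1)"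
  have [measurable]: "h \<in> borel_measurable borel"
    unfolding h_def by (intro borel_measurable_indicator) simp
  have shift: "(\<integral>\<^sup>+x. k (x + c) \<partial>lborel) = (\<integral>\<^sup>+x. k x \<partial>lborel)"
    if [measurable]: "k \<in> borel_measurable borel" for k :: "'a \<Rightarrow> ennreal" and c
    by (subst (2) lborel_distr_plus[of c, symmetric], subst nn_integral_distr) (auto simp: add.commute)
  have hR: "h (- R x) = h x" for x
    using R by (auto simp: h_def indicator_def orthogonal_transformation_norm)
  define b where "b = emeasure lborel (ball (0::'a) 1)"
  have hb: "(\<integral>\<^sup>+x. h x \<partial>lborel) = b"
    by (simp add: h_def b_def)
  have "b * (\<integral>\<^sup>+x. f (R x) \<partial>lborel) = (\<integral>\<^sup>+x. f (R x) * b \<partial>lborel)"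
    by (simp add: nn_integral_cmult mult.commute)
  also have "\<dots> = (\<integral>\<^sup>+x. \<integral>\<^sup>+y. f (R x) * h (y - R x) \<partial>lborel \<partial>lborel)"
  proof (rule nn_integral_cong)
    fix x
    show "f (R x) * b = (\<integral>\<^sup>+y. f (R x) * h (y - R x) \<partial>lborel)"
      using shift[of h "- R x"] by (simp add: nn_integral_cmult hb)
  qed
  also have "\<dots> = (\<integral>\<^sup>+y. \<integral>\<^sup>+x. f (R x) * h (y - R x) \<partial>lborel \<partial>lborel)"
    by (rule lborel_pair.Fubini') measurable
  also have "\<dots> = (\<integral>\<^sup>+y. \<integral>\<^sup>+x. f (R x + y) * h x \<partial>lborel \<partial>lborel)"
  proof (rule nn_integral_cong)
    fix y
    \<comment> \<open>Shifting \<open>x\<close> by a preimage of \<open>y\<close> moves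
      \<open>y\<close> into the argument of \<open>f\<close> and leaves \<open>h (- R x)\<close>,
      which is \<open>h x\<close> because the ball is symmetric and \<open>R\<close> preserves
      norms.\<close>
    obtain c where c: "R c = y"
      using orthogonal_transformation_surj[OF R] by (metis surjD)
    have "(\<integral>\<^sup>+x. f (R x) * h (y - R x) \<partial>lborel) = (\<integral>\<^sup>+x. f (R (x + c)) * h (y - R (x + c)) \<partial>lborel)"
      by (rule shift[symmetric]) measurable
    then show "(\<integral>\<^sup>+x. f (R x) * h (y - R x) \<partial>lborel) = (\<integral>\<^sup>+x. f (R x + y) * h x \<partial>lborel)"
      by (simp add: linear_add[OF lin] c hR)
  qed
  also have "\<dots> = (\<integral>\<^sup>+x. \<integral>\<^sup>+y. f (R x + y) * h x \<partial>lborel \<partial>lborel)"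
    by (rule lborel_pair.Fubini') measurable
  also have "\<dots> = (\<integral>\<^sup>+x. (\<integral>\<^sup>+y. f y \<partial>lborel) * h x \<partial>lborel)"
  proof (rule nn_integral_cong)
    fix x
    show "(\<integral>\<^sup>+y. f (R x + y) * h x \<partial>lborel) = (\<integral>\<^sup>+y. f y \<partial>lborel) * h x"
      using shift[of f "R x"] by (simp add: nn_integral_multc add.commute)
  qed
  also have "\<dots> = b * (\<integral>\<^sup>+y. f y \<partial>lborel)"
    by (simp add: nn_integral_multc hb mult.commute)
  finally have eq: "b * (\<integral>\<^sup>+x. f (R x) \<partial>lborel) = b * (\<integral>\<^sup>+y. f y \<partial>lborel)" .
  have "b \<noteq> \<infinity>" "b \<noteq> 0"
    unfolding b_def by (rule ball_emeasure_pos_finite)+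
  then show ?thesis
    using eq by (auto simp: ennreal_mult_cancel_left)
qed

section \<open>The uniform measure on the sphere\<close>

text \<open>The derivative may be discontinuous, but each directional derivative is a pointwise
  limit of continuous difference quotients. This is what makes integrals of Hessian entries
  meaningful.\<close>

lemma borel_measurable_has_derivative:
  fixes B :: "'a::euclidean_space \<Rightarrow> real"
  assumes B: "\<And>x. (B has_derivative B' x) (at x)"
  shows "(\<lambda>x. B' x v) \<in> borel_measurable borel"
proof (rule borel_measurable_LIMSEQ_real)
  have "continuous_on UNIV B"
    using B by (meson continuous_at_imp_continuous_on has_derivative_continuous)
  then have [measurable]: "B \<in> borel_measurable borel"
    by (rule borel_measurable_continuous_onI)
  define r where "r i = 1 / real (Suc i)" for i
  show "(\<lambda>x. (B (x + r i *\<^sub>R v) - B x) / r i) \<in> borel_measurable borel" for i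
    by measurable
  fix x
  have lin: "linear (B' x)"
    using B has_derivative_linear by blast
  have "((\<lambda>t. B (x + t *\<^sub>R v)) has_derivative (\<lambda>t. B' x (t *\<^sub>R v))) (at 0)"
    by (rule has_derivative_compose[of "\<lambda>t. x + t *\<^sub>R v" "\<lambda>t. t *\<^sub>R v" 0 UNIV B, simplified])
      (auto intro!: derivative_eq_intros B)
  then have "((\<lambda>t. B (x + t *\<^sub>R v)) has_real_derivative B' x v) (at 0)"
    by (simp add: has_field_derivative_def linear_scale[OF lin] mult_commute_abs)
  then have "((\<lambda>t. (B (x + t *\<^sub>R v) - B x) / t) \<longlongrightarrow> B' x v) (at 0)"
    by (simp add: DERIV_def)
  moreover have "r \<longlonglongrightarrow> 0"
    unfolding r_def by real_asymp
  then have "filterlim r (at 0) sequentially"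
    by (auto simp: filterlim_at r_def)
  ultimately show "(\<lambda>i. (B (x + r i *\<^sub>R v) - B x) / r i) \<longlonglongrightarrow> B' x v"
    by (rule filterlim_compose)
qed

lemma sets_sphere_unif [simp, measurable_cong]: "sets sphere_unif = sets borel"
  by (simp add: sphere_unif_def)

lemma space_sphere_unif [simp]: "space sphere_unif = UNIV"
  by (simp add: sphere_unif_def)

lemma prob_space_sphere_unif: "prob_space (sphere_unif :: (real ^ 'd) measure)"
  unfolding sphere_unif_def
  by (intro prob_space.prob_space_distr prob_space_uniform_measure ball_emeasure_pos_finite)
    (auto cong: measurable_cong_sets)

interpretation sphere: prob_space sphere_unif
  by (rule prob_space_sphere_unif)

lemma AE_sphere_unif_norm: "AE x in (sphere_unif :: (real ^ 'd) measure). norm x = 1"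
proof -
  \<comment> \<open>The origin is the exceptional point: there the normalisation divides by zero and
    returns 0 instead of a unit vector.\<close>
  have "AE x in lborel. x \<noteq> (0 :: real ^ 'd)"
    by (rule AE_lborel_singleton)
  then have "AE x in uniform_measure lborel (ball (0 :: real ^ 'd) 1). norm (x /\<^sub>R norm x) = 1"
    by (intro AE_uniform_measureI) auto
  then show ?thesis
    unfolding sphere_unif_def by (subst AE_distr_iff) (auto cong: measurable_cong_sets)
qed

text \<open>Normalisation commutes with \<open>R\<close>, and the unit ball and Lebesgue measure are
  both invariant under \<open>R\<close>, so the cone-measure formula is unchanged.\<close>

lemma distr_sphere_unif_orthogonal:
  fixes R :: "real ^ 'd \<Rightarrow> real ^ 'd"
  assumes R: "orthogonal_transformation R"
  shows "distr sphere_unif borel R = sphere_unif"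
proof (rule measure_eqI)
  have lin: "linear R"
    using R by (rule orthogonal_transformation_linear)
  have Rm [measurable]: "R \<in> borel_measurable borel"
    using lin by (intro borel_measurable_continuous_onI linear_continuous_on linear_linear[THEN iffD2])
  fix A assume "A \<in> sets (distr sphere_unif borel R)"
  then have [measurable]: "A \<in> sets borel"
    by simp
  define p where "p x = x /\<^sub>R norm x" for x :: "real ^ 'd"
  have [measurable]: "p \<in> borel_measurable borel"
    unfolding p_def by measurable
  have pR: "p (R x) = R (p x)" for x
    using R by (simp add: p_def linear_scale[OF lin] orthogonal_transformation_norm)
  have [measurable]: "ball (0 :: real ^ 'd) 1 \<in> sets borel"
    by simp
  have S: "emeasure sphere_unif C = (\<integral>\<^sup>+x. indicator (ball 0 1) x * indicator C (p x) \<partial>lborel) / emeasure lborel (ball (0::real^'d) 1)"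
    if [measurable]: "C \<in> sets borel" for C
  proof -
    have "emeasure sphere_unif C = emeasure (uniform_measure lborel (ball (0 :: real ^ 'd) 1)) (p -` C)"
      unfolding sphere_unif_def p_def by (subst emeasure_distr) (auto cong: measurable_cong_sets)
    also have "\<dots> = emeasure lborel (ball 0 1 \<inter> p -` C) / emeasure lborel (ball (0 :: real ^ 'd) 1)"
      using measurable_sets[of p borel borel C] by (subst emeasure_uniform_measure) auto
    also have "emeasure lborel (ball 0 1 \<inter> p -` C) = (\<integral>\<^sup>+x. indicator (ball 0 1 \<inter> p -` C) x \<partial>lborel)"
      using measurable_sets[of p borel borel C] by (subst nn_integral_indicator) auto
    also have "\<dots> = (\<integral>\<^sup>+x. indicator (ball 0 1) x * indicator C (p x) \<partial>lborel)"
      by (intro nn_integral_cong) (auto simp: indicator_def)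
    finally show ?thesis .
  qed
  have "emeasure (distr sphere_unif borel R) A = emeasure sphere_unif (R -` A)"
    by (subst emeasure_distr) auto
  also have "\<dots> = (\<integral>\<^sup>+x. indicator (ball 0 1) x * indicator A (R (p x)) \<partial>lborel) / emeasure lborel (ball (0::real^'d) 1)"
    using measurable_sets[OF Rm, of A] by (subst S) (auto simp: indicator_def)
  also have "(\<integral>\<^sup>+x. indicator (ball 0 1) x * indicator A (R (p x)) \<partial>lborel)
      = (\<integral>\<^sup>+x. indicator (ball 0 1) (R x) * indicator A (p (R x)) \<partial>lborel)"
    using R by (intro nn_integral_cong) (auto simp: indicator_def pR orthogonal_transformation_norm)
  also have "\<dots> = (\<integral>\<^sup>+x. indicator (ball 0 1) x * indicator A (p x) \<partial>lborel)"
    by (intro nn_integral_lborel_orthogonal R) measurable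
  finally show "emeasure (distr sphere_unif borel R) A = emeasure sphere_unif A"
    by (simp add: S)
qed simp

lemma continuous_bounded_on_sphere:
  fixes \<Phi> :: "real ^ 'd \<Rightarrow> real"
  assumes "continuous_on UNIV \<Phi>"
  obtains K where "\<And>x. norm x = 1 \<Longrightarrow> \<bar>\<Phi> x\<bar> \<le> K"
proof -
  have "compact (\<Phi> ` sphere 0 1)"
    by (intro compact_continuous_image continuous_on_subset[OF assms]) auto
  then obtain K where "\<forall>y\<in>\<Phi> ` sphere 0 1. norm y \<le> K"
    using compact_imp_bounded bounded_iff by blast
  then show ?thesis
    by (intro that[of K]) auto
qed

lemma integrable_sphere_unif_continuous:
  fixes \<Phi> :: "real ^ 'd \<Rightarrow> real"
  assumes "continuous_on UNIV \<Phi>"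
  shows "integrable sphere_unif \<Phi>"
proof -
  obtain K where K: "\<And>x. norm x = 1 \<Longrightarrow> norm (\<Phi> x) \<le> K"
    using continuous_bounded_on_sphere[OF assms] by auto
  show ?thesis
  proof (rule sphere.integrable_const_bound[where B = K])
    show "AE x in sphere_unif. norm (\<Phi> x) \<le> K"
      using AE_sphere_unif_norm by eventually_elim (rule K)
    show "\<Phi> \<in> borel_measurable sphere_unif"
      using borel_measurable_continuous_onI[OF assms] by simp
  qed
qed

section \<open>Rotations and integration by parts on the sphere\<close>

text \<open>The rotation by the angle \<open>t\<close> in the plane of \<open>e\<close> and
  \<open>f\<close>, written as the identity plus a correction in that plane, so that it fixes the
  orthogonal complement and its \<open>t\<close>-derivative can be read off.\<close>

definition plane_rotation :: "'a::euclidean_space \<Rightarrow> 'a \<Rightarrow> real \<Rightarrow> 'a \<Rightarrow> 'a" where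
  "plane_rotation e f t x = x + ((cos t - 1) * (x \<bullet> e) - sin t * (x \<bullet> f)) *\<^sub>R e
     + ((cos t - 1) * (x \<bullet> f) + sin t * (x \<bullet> e)) *\<^sub>R f"

lemma plane_rotation_0 [simp]: "plane_rotation e f 0 x = x"
  by (simp add: plane_rotation_def)

context
  fixes e f :: "'a::euclidean_space"
  assumes ef: "e \<in> Basis" "f \<in> Basis" "e \<noteq> f"
begin

lemma plane_rotation_inner:
  "plane_rotation e f t x \<bullet> e = cos t * (x \<bullet> e) - sin t * (x \<bullet> f)"
  "plane_rotation e f t x \<bullet> f = cos t * (x \<bullet> f) + sin t * (x \<bullet> e)"
  using ef by (auto simp: plane_rotation_def inner_add_left inner_Basis algebra_simps)

lemma orthogonal_plane_rotation: "orthogonal_transformation (plane_rotation e f t)"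
  unfolding orthogonal_transformation
proof (intro conjI allI)
  show "linear (plane_rotation e f t)"
    by (rule linearI) (auto simp: plane_rotation_def inner_add_left algebra_simps)
  fix x
  define u v where "u = x \<bullet> e" and "v = x \<bullet> f"
  define c s where "c = cos t" and "s = sin t"
  have cs: "c\<^sup>2 + s\<^sup>2 = 1"
    by (simp add: c_def s_def)
  have "plane_rotation e f t x \<bullet> plane_rotation e f t x
      = x \<bullet> x + 2 * ((c - 1) * u - s * v) * u + 2 * ((c - 1) * v + s * u) * v
        + ((c - 1) * u - s * v)\<^sup>2 + ((c - 1) * v + s * u)\<^sup>2"
    unfolding plane_rotation_def using ef
    by (simp add: inner_add_left inner_add_right inner_Basis u_def v_def c_def s_def inner_commute power2_eq_square algebra_simps)
  also have "\<dots> = x \<bullet> x + (c\<^sup>2 + s\<^sup>2 - 1) * (u\<^sup>2 + v\<^sup>2)"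
    by (simp add: power2_eq_square algebra_simps)
  finally show "norm (plane_rotation e f t x) = norm x"
    by (simp add: cs norm_eq_sqrt_inner)
qed

lemma plane_rotation_has_vector_derivative:
  "((\<lambda>t. plane_rotation e f t x) has_vector_derivative
     ((plane_rotation e f t x \<bullet> e) *\<^sub>R f - (plane_rotation e f t x \<bullet> f) *\<^sub>R e)) (at t)"
  unfolding plane_rotation_inner
  unfolding plane_rotation_def has_vector_derivative_def
  by (auto intro!: derivative_eq_intros ext simp: algebra_simps)

end

text \<open>By invariance the integral of \<open>\<Phi>\<close> after rotation by \<open>t\<close>
  is constant in \<open>t\<close>; its derivative at 0 is the integral of \<open>\<Phi>'\<close>
  along the generator of the rotation. These rotation fields take the place of a divergence theorem
  on the sphere.\<close>

lemma sphere_unif_rotation_ibp: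
  fixes \<Phi> :: "real ^ 'd \<Rightarrow> real"
  assumes ef: "e \<in> Basis" "f \<in> Basis" "e \<noteq> f"
    and deriv: "\<And>x. (\<Phi> has_derivative \<Phi>' x) (at x)"
    and bound: "\<And>x. norm x = 1 \<Longrightarrow> \<bar>\<Phi>' x ((x \<bullet> e) *\<^sub>R f - (x \<bullet> f) *\<^sub>R e)\<bar> \<le> K"
  shows "integrable sphere_unif (\<lambda>x. \<Phi>' x ((x \<bullet> e) *\<^sub>R f - (x \<bullet> f) *\<^sub>R e))"
    and "(\<integral>x. \<Phi>' x ((x \<bullet> e) *\<^sub>R f - (x \<bullet> f) *\<^sub>R e) \<partial>sphere_unif) = 0"
proof -
  let ?R = "plane_rotation e f"
  define A where "A x = (x \<bullet> e) *\<^sub>R f - (x \<bullet> f) *\<^sub>R e" for x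
  note orth = orthogonal_plane_rotation[OF ef]
  have cont: "continuous_on UNIV \<Phi>"
    using deriv by (meson continuous_at_imp_continuous_on has_derivative_continuous)
  have Rcont: "continuous_on UNIV (?R t)" for t
    using orth[THEN orthogonal_transformation_linear] by (intro linear_continuous_on linear_linear[THEN iffD2])
  have d: "((\<lambda>t. \<Phi> (?R t x)) has_real_derivative \<Phi>' (?R t x) (A (?R t x))) (at t)" for t x
  proof -
    have lin: "linear (\<Phi>' (?R t x))"
      using deriv has_derivative_linear by blast
    have "((\<lambda>t. \<Phi> (?R t x)) has_derivative (\<lambda>h. \<Phi>' (?R t x) (h *\<^sub>R A (?R t x)))) (at t)"
      using plane_rotation_has_vector_derivative[OF ef, of x t]
      by (intro has_derivative_compose[of "\<lambda>t. ?R t x", OF _ deriv])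
        (simp add: has_vector_derivative_def A_def)
    then show ?thesis
      by (simp add: has_field_derivative_def linear_scale[OF lin] mult_commute_abs)
  qed
  have lip: "AE x in sphere_unif. \<forall>t. \<bar>t - 0\<bar> \<le> 1 \<longrightarrow> \<bar>\<Phi> (?R t x) - \<Phi> (?R 0 x)\<bar> \<le> K * \<bar>t - 0\<bar>"
    using AE_sphere_unif_norm
  proof eventually_elim
    case (elim x)
    \<comment> \<open>The orbit of \<open>x\<close> stays on the unit sphere, so the bound assumed
      there is a Lipschitz constant for all \<open>t\<close>.\<close>
    have b: "norm (\<Phi>' (?R t x) (A (?R t x))) \<le> K" for t
      using bound[of "?R t x"] orth[THEN orthogonal_transformation_norm, of t x] elim
      by (simp add: A_def)
    have "norm (\<Phi> (?R t x) - \<Phi> (?R 0 x)) \<le> K * norm (t - 0)" for t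
      by (rule field_differentiable_bound[of UNIV "\<lambda>t. \<Phi> (?R t x)" "\<lambda>t. \<Phi>' (?R t x) (A (?R t x))"])
        (use d b in auto)
    then show ?case
      by auto
  qed
  have int: "integrable sphere_unif (\<lambda>x. \<Phi> (?R t x))" for t
    by (intro integrable_sphere_unif_continuous continuous_on_compose2[OF cont Rcont]) auto
  have d0: "((\<lambda>t. \<Phi> (?R t x)) has_real_derivative \<Phi>' x (A x)) (at 0)" for x
    using d[of x 0] by simp
  show "integrable sphere_unif (\<lambda>x. \<Phi>' x ((x \<bullet> e) *\<^sub>R f - (x \<bullet> f) *\<^sub>R e))"
    using dominated_derivative_integrable[OF int d0 lip] by (simp add: A_def)
  have "((\<lambda>t. \<integral>x. \<Phi> (?R t x) \<partial>sphere_unif) has_real_derivative (\<integral>x. \<Phi>' x (A x) \<partial>sphere_unif)) (at 0)"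
    by (rule dominated_derivative_has_derivative[OF int d0 lip]) auto
  moreover have "(\<integral>x. \<Phi> (?R t x) \<partial>sphere_unif) = (\<integral>x. \<Phi> x \<partial>sphere_unif)" for t
  proof -
    have "(\<integral>x. \<Phi> x \<partial>sphere_unif) = (\<integral>x. \<Phi> x \<partial>distr sphere_unif borel (?R t))"
      by (simp add: distr_sphere_unif_orthogonal[OF orth])
    also have "\<dots> = (\<integral>x. \<Phi> (?R t x) \<partial>sphere_unif)"
      using borel_measurable_continuous_onI[OF cont] borel_measurable_continuous_onI[OF Rcont]
      by (subst integral_distr) auto
    finally show ?thesis ..
  qed
  ultimately show "(\<integral>x. \<Phi>' x ((x \<bullet> e) *\<^sub>R f - (x \<bullet> f) *\<^sub>R e) \<partial>sphere_unif) = 0"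
    using DERIV_unique[OF _ DERIV_const] by (auto simp: A_def)
qed

text \<open>Apply the rotation identity to \<open>(x \<bullet> f) * B x\<close> for each basis
  vector \<open>f\<close> other than \<open>e\<close> and add the \<open>N - 1\<close> results. On
  the sphere the right side is the derivative of \<open>B\<close> in the direction
  \<open>e - (x \<bullet> e) x\<close>, the tangential part of \<open>e\<close>.\<close>

lemma sphere_unif_ibp:
  fixes B :: "real ^ 'd \<Rightarrow> real"
  assumes e: "e \<in> Basis"
    and deriv: "\<And>x. (B has_derivative B' x) (at x)"
    and bound: "\<And>x v. norm x = 1 \<Longrightarrow> \<bar>B' x v\<bar> \<le> K * norm v"
  shows "(real CARD('d) - 1) * (\<integral>x. (x \<bullet> e) * B x \<partial>sphere_unif)
    = (\<integral>x. B' x e - (x \<bullet> e) * B' x x \<partial>sphere_unif)"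
proof -
  have cont: "continuous_on UNIV B"
    using deriv by (meson continuous_at_imp_continuous_on has_derivative_continuous)
  have [measurable]: "B \<in> borel_measurable borel"
    by (rule borel_measurable_continuous_onI[OF cont])
  have lin: "linear (B' x)" for x
    using deriv has_derivative_linear by blast
  have [measurable]: "(\<lambda>x. B' x v) \<in> borel_measurable borel" for v
    by (rule borel_measurable_has_derivative[OF deriv])
  have B'x: "B' x x = (\<Sum>b\<in>Basis. (x \<bullet> b) * B' x b)" for x
  proof -
    have "B' x x = B' x (\<Sum>b\<in>Basis. (x \<bullet> b) *\<^sub>R b)"
      by (simp add: euclidean_representation)
    also have "\<dots> = (\<Sum>b\<in>Basis. (x \<bullet> b) * B' x b)"
      by (simp add: linear_sum[OF lin] linear_scale[OF lin])
    finally show ?thesis .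
  qed
  have [measurable]: "(\<lambda>x. B' x x) \<in> borel_measurable borel"
    unfolding B'x by measurable
  obtain C where C: "\<And>x. norm x = 1 \<Longrightarrow> \<bar>B x\<bar> \<le> C"
    using continuous_bounded_on_sphere[OF cont] by auto
  \<comment> \<open>The derivative of \<open>(x \<bullet> f) * B x\<close> along the field that
    rotates \<open>e\<close> towards \<open>f\<close>.\<close>
  define L where "L f x = (x \<bullet> e) * B x + (x \<bullet> f) * ((x \<bullet> e) * B' x f - (x \<bullet> f) * B' x e)" for f x
  have L: "integrable sphere_unif (L f) \<and> (\<integral>x. L f x \<partial>sphere_unif) = 0" if f: "f \<in> Basis" "f \<noteq> e" for f
  proof -
    define \<Phi>' where "\<Phi>' x h = (h \<bullet> f) * B x + (x \<bullet> f) * B' x h" for x h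
    have d: "((\<lambda>x. (x \<bullet> f) * B x) has_derivative \<Phi>' x) (at x)" for x
      unfolding \<Phi>'_def[abs_def]
      by (auto intro!: derivative_eq_intros deriv simp: algebra_simps)
    have eq: "\<Phi>' x ((x \<bullet> e) *\<^sub>R f - (x \<bullet> f) *\<^sub>R e) = L f x" for x
      using e f by (simp add: \<Phi>'_def L_def linear_diff[OF lin] linear_scale[OF lin] inner_Basis inner_diff_left algebra_simps)
    have "\<bar>\<Phi>' x ((x \<bullet> e) *\<^sub>R f - (x \<bullet> f) *\<^sub>R e)\<bar> \<le> C + 2 * K" if x: "norm x = 1" for x
    proof -
      have xe: "\<bar>x \<bullet> e\<bar> \<le> 1" and xf: "\<bar>x \<bullet> f\<bar> \<le> 1"
        using x e f Basis_le_norm by metis+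
      have K: "\<bar>B' x e\<bar> \<le> K" "\<bar>B' x f\<bar> \<le> K"
        using bound[OF x, of e] bound[OF x, of f] e f by (auto simp: norm_Basis)
      have m: "\<bar>a * b\<bar> \<le> c" if "\<bar>a\<bar> \<le> 1" "\<bar>b\<bar> \<le> c" for a b c :: real
        using mult_mono[OF that] by (simp add: abs_mult)
      have "\<bar>(x \<bullet> e) * B x\<bar> \<le> C"
        by (rule m[OF xe C[OF x]])
      moreover have "\<bar>(x \<bullet> e) * B' x f\<bar> \<le> K" "\<bar>(x \<bullet> f) * B' x e\<bar> \<le> K"
        by (rule m[OF xe K(2)], rule m[OF xf K(1)])
      then have "\<bar>(x \<bullet> e) * B' x f - (x \<bullet> f) * B' x e\<bar> \<le> 2 * K"
        by linarith
      then have "\<bar>(x \<bullet> f) * ((x \<bullet> e) * B' x f - (x \<bullet> f) * B' x e)\<bar> \<le> 2 * K"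
        by (rule m[OF xf])
      ultimately show ?thesis
        unfolding eq L_def by linarith
    qed
    from sphere_unif_rotation_ibp[OF e f(1) f(2)[symmetric] d this] show ?thesis
      unfolding eq by auto
  qed
  have sum: "(\<Sum>f\<in>Basis - {e}. L f x) = (real CARD('d) - 1) * ((x \<bullet> e) * B x) - (B' x e - (x \<bullet> e) * B' x x)"
    if x: "norm x = 1" for x
  proof -
    \<comment> \<open>\<open>L e x\<close> collapses to \<open>(x \<bullet> e) * B x\<close>, which
      turns the factor \<open>N\<close> of the full sum into \<open>N - 1\<close>.\<close>
    have "(\<Sum>f\<in>Basis - {e}. L f x) = (\<Sum>f\<in>Basis. L f x) - L e x"
      using e by (simp add: sum_diff1)
    also have "(\<Sum>f\<in>Basis. L f x) = real CARD('d) * ((x \<bullet> e) * B x) + (x \<bullet> e) * B' x x - (\<Sum>f\<in>Basis. (x \<bullet> f)\<^sup>2) * B' x e"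
      by (simp add: L_def sum.distrib B'x sum_subtractf sum_distrib_left sum_distrib_right algebra_simps power2_eq_square)
    also have "(\<Sum>f\<in>Basis. (x \<bullet> f)\<^sup>2) = 1"
      using x euclidean_inner[of x x] by (simp add: power2_eq_square norm_eq_sqrt_inner)
    finally show ?thesis
      by (simp add: L_def algebra_simps)
  qed
  have [measurable]: "L f \<in> borel_measurable borel" for f
    unfolding L_def by measurable
  have intB: "integrable sphere_unif (\<lambda>x. (x \<bullet> e) * B x)"
    by (intro integrable_sphere_unif_continuous continuous_intros cont)
  have intL: "integrable sphere_unif (\<lambda>x. \<Sum>f\<in>Basis - {e}. L f x)"
    using L by auto
  have "(\<integral>x. B' x e - (x \<bullet> e) * B' x x \<partial>sphere_unif)
      = (\<integral>x. (real CARD('d) - 1) * ((x \<bullet> e) * B x) - (\<Sum>f\<in>Basis - {e}. L f x) \<partial>sphere_unif)"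
    using AE_sphere_unif_norm by (intro integral_cong_AE) (auto simp: sum)
  also have "\<dots> = (real CARD('d) - 1) * (\<integral>x. (x \<bullet> e) * B x \<partial>sphere_unif) - (\<Sum>f\<in>Basis - {e}. \<integral>x. L f x \<partial>sphere_unif)"
    using intB intL L by (subst Bochner_Integration.integral_diff) auto
  also have "(\<Sum>f\<in>Basis - {e}. \<integral>x. L f x \<partial>sphere_unif) = 0"
    using L by (intro sum.neutral) auto
  finally show ?thesis
    by simp
qed

lemma measure_sphere_unif_UNIV [simp]: "measure (sphere_unif :: (real ^ 'd) measure) UNIV = 1"
  using sphere.prob_space by simp

text \<open>For \<open>B x = x \<bullet> f\<close> the integration by parts reads
  \<open>(N - 1) m = e \<bullet> f - m\<close> in the moment \<open>m\<close>.\<close>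

lemma sphere_unif_second_moment:
  fixes e f :: "real ^ 'd"
  assumes "e \<in> Basis" "f \<in> Basis"
  shows "(\<integral>x. (x \<bullet> e) * (x \<bullet> f) \<partial>sphere_unif) = (e \<bullet> f) / real CARD('d)"
proof -
  have d: "((\<lambda>x. x \<bullet> f) has_derivative (\<lambda>h. h \<bullet> f)) (at x)" for x
    by (auto intro!: derivative_eq_intros)
  have "\<bar>v \<bullet> f\<bar> \<le> 1 * norm v" for v
    using Basis_le_norm[OF assms(2)] by simp
  from sphere_unif_ibp[OF assms(1) d this]
  have "(real CARD('d) - 1) * (\<integral>x. (x \<bullet> e) * (x \<bullet> f) \<partial>sphere_unif)
      = (\<integral>x. (e \<bullet> f) - (x \<bullet> e) * (x \<bullet> f) \<partial>sphere_unif)"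
    by simp
  also have "\<dots> = (e \<bullet> f) - (\<integral>x. (x \<bullet> e) * (x \<bullet> f) \<partial>sphere_unif)"
    by (subst Bochner_Integration.integral_diff)
      (auto intro!: integrable_sphere_unif_continuous continuous_intros simp: sphere.prob_space)
  finally show ?thesis
    by (simp add: field_simps)
qed

lemma sphere_unif_square_moment:
  fixes v :: "real ^ 'd"
  shows "(\<integral>x. (x \<bullet> v)\<^sup>2 \<partial>sphere_unif) = (norm v)\<^sup>2 / real CARD('d)"
proof -
  have exp: "(x \<bullet> v)\<^sup>2 = (\<Sum>e\<in>Basis. \<Sum>f\<in>Basis. (v \<bullet> e) * (v \<bullet> f) * ((x \<bullet> e) * (x \<bullet> f)))" for x
    by (subst euclidean_inner) (simp add: power2_eq_square sum_product mult_ac)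
  have "(\<integral>x. (x \<bullet> v)\<^sup>2 \<partial>sphere_unif)
      = (\<Sum>e\<in>Basis. \<Sum>f\<in>Basis. (v \<bullet> e) * (v \<bullet> f) * (\<integral>x. (x \<bullet> e) * (x \<bullet> f) \<partial>sphere_unif))"
    unfolding exp
    by (subst Bochner_Integration.integral_sum, (intro integrable_sphere_unif_continuous continuous_intros)[1],
        intro sum.cong refl, subst Bochner_Integration.integral_sum)
      (auto intro!: integrable_sphere_unif_continuous continuous_intros)
  also have "\<dots> = (\<Sum>e\<in>Basis. \<Sum>f\<in>Basis. if f = e then (v \<bullet> e) * (v \<bullet> e) / real CARD('d) else 0)"
    by (intro sum.cong refl) (auto simp: sphere_unif_second_moment inner_Basis)
  also have "\<dots> = (\<Sum>e\<in>Basis. (v \<bullet> e) * (v \<bullet> e)) / real CARD('d)"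
    by (simp add: sum_divide_distrib)
  also have "(\<Sum>e\<in>Basis. (v \<bullet> e) * (v \<bullet> e)) = (norm v)\<^sup>2"
    by (simp add: euclidean_inner[of v v, symmetric] power2_norm_eq_inner)
  finally show ?thesis .
qed

text \<open>Contract the coordinate identities for \<open>B x = \<phi> (x \<bullet> v)\<close> with
  the coefficients \<open>v \<bullet> e\<close>. On the sphere
  \<open>|v|^2 - (x \<bullet> v)^2\<close> is the squared length of the tangential part of
  \<open>v\<close>.\<close>

lemma sphere_unif_ibp_linear:
  fixes \<phi> :: "real \<Rightarrow> real" and v :: "real ^ 'd"
  assumes d: "\<And>s. (\<phi> has_real_derivative \<phi>' s) (at s)" and cont: "continuous_on UNIV \<phi>'"
  shows "(real CARD('d) - 1) * (\<integral>x. (x \<bullet> v) * \<phi> (x \<bullet> v) \<partial>sphere_unif)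
    = (\<integral>x. ((norm v)\<^sup>2 - (x \<bullet> v)\<^sup>2) * \<phi>' (x \<bullet> v) \<partial>sphere_unif)"
proof -
  define B' where "B' x h = \<phi>' (x \<bullet> v) * (h \<bullet> v)" for x h
  have B: "((\<lambda>x. \<phi> (x \<bullet> v)) has_derivative B' x) (at x)" for x
    unfolding B'_def
    by (rule has_derivative_compose[of "\<lambda>x. x \<bullet> v" "\<lambda>h. h \<bullet> v" x UNIV \<phi>, simplified])
      (use d in \<open>auto intro!: derivative_eq_intros simp: has_field_derivative_def\<close>)
  have contB': "continuous_on UNIV (\<lambda>x. \<phi>' (x \<bullet> v))"
    by (rule continuous_on_compose2[OF cont]) (auto intro!: continuous_intros)
  have cont\<phi>: "continuous_on UNIV (\<lambda>x. \<phi> (x \<bullet> v))"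
    using B by (meson continuous_at_imp_continuous_on has_derivative_continuous)
  obtain K where K: "\<And>x. norm x = 1 \<Longrightarrow> \<bar>\<phi>' (x \<bullet> v)\<bar> \<le> K"
    using continuous_bounded_on_sphere[OF contB'] by auto
  have bound: "\<bar>B' x h\<bar> \<le> (K * norm v) * norm h" if "norm x = 1" for x h
    using mult_mono[OF K[OF that] Cauchy_Schwarz_ineq2[of h v]] K[OF that]
    by (simp add: B'_def abs_mult mult_ac)
  have split: "(x \<bullet> v) * c = (\<Sum>e\<in>Basis. (v \<bullet> e) * ((x \<bullet> e) * c))" for x c
    by (subst euclidean_inner) (simp add: sum_distrib_left sum_distrib_right mult_ac)
  have "(real CARD('d) - 1) * (\<integral>x. (x \<bullet> v) * \<phi> (x \<bullet> v) \<partial>sphere_unif)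
      = (\<Sum>e\<in>Basis. (v \<bullet> e) * ((real CARD('d) - 1) * (\<integral>x. (x \<bullet> e) * \<phi> (x \<bullet> v) \<partial>sphere_unif)))"
    unfolding split[of _ "\<phi> _"]
    by (subst Bochner_Integration.integral_sum)
      (auto intro!: integrable_sphere_unif_continuous continuous_intros cont\<phi> simp: sum_distrib_left mult.left_commute[of "v \<bullet> _" "real _ - 1"])
  also have "\<dots> = (\<Sum>e\<in>Basis. (v \<bullet> e) * (\<integral>x. B' x e - (x \<bullet> e) * B' x x \<partial>sphere_unif))"
    by (intro sum.cong refl arg_cong2[where f = "(*)"] sphere_unif_ibp[OF _ B bound])
  also have "\<dots> = (\<integral>x. (\<Sum>e\<in>Basis. (v \<bullet> e) * (B' x e - (x \<bullet> e) * B' x x)) \<partial>sphere_unif)"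
    unfolding B'_def
    by (subst Bochner_Integration.integral_sum)
      (auto intro!: integrable_sphere_unif_continuous continuous_intros contB')
  also have "\<dots> = (\<integral>x. ((norm v)\<^sup>2 - (x \<bullet> v)\<^sup>2) * \<phi>' (x \<bullet> v) \<partial>sphere_unif)"
  proof (intro Bochner_Integration.integral_cong refl)
    fix x
    have "(\<Sum>e\<in>Basis. (v \<bullet> e) * (B' x e - (x \<bullet> e) * B' x x))
        = \<phi>' (x \<bullet> v) * (\<Sum>e\<in>Basis. (v \<bullet> e) * (v \<bullet> e)) - (\<Sum>e\<in>Basis. (x \<bullet> e) * (v \<bullet> e)) * B' x x"
      by (simp add: B'_def sum_subtractf sum_distrib_left sum_distrib_right inner_commute algebra_simps)
    also have "\<dots> = ((norm v)\<^sup>2 - (x \<bullet> v)\<^sup>2) * \<phi>' (x \<bullet> v)"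
      by (simp add: euclidean_inner[of v v, symmetric] euclidean_inner[of x v, symmetric] B'_def
          power2_norm_eq_inner) (simp add: power2_eq_square algebra_simps)
    finally show "(\<Sum>e\<in>Basis. (v \<bullet> e) * (B' x e - (x \<bullet> e) * B' x x)) = ((norm v)\<^sup>2 - (x \<bullet> v)\<^sup>2) * \<phi>' (x \<bullet> v)" .
  qed
  finally show ?thesis .
qed

section \<open>The sub-Gaussian bound for a single spin\<close>

text \<open>Both factors are nondecreasing in \<open>|u|\<close> and vanish at
  \<open>|u| = q\<close>, so their signs agree. This is the pointwise form of the positive
  correlation between the square and \<open>cosh\<close>.\<close>

lemma cosh_diff_mult_nonneg:
  fixes u q r :: real
  assumes "q \<ge> 0" "r \<ge> 0"
  shows "0 \<le> (u\<^sup>2 - q\<^sup>2) * (cosh (r * u) - cosh (r * q))"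
proof (cases "\<bar>u\<bar> \<le> q")
  case True
  then have "u\<^sup>2 \<le> q\<^sup>2"
    by (metis abs_le_square_iff abs_of_nonneg assms(1))
  moreover have "cosh (r * \<bar>u\<bar>) \<le> cosh (r * q)"
    using True assms by (subst cosh_real_nonneg_le_iff) (auto intro: mult_left_mono)
  ultimately show ?thesis
    using assms by (intro mult_nonpos_nonpos) (auto simp: abs_if split: if_splits)
next
  case False
  then have "q\<^sup>2 \<le> u\<^sup>2"
    by (metis abs_le_square_iff abs_of_nonneg assms(1) linear)
  moreover have "cosh (r * q) \<le> cosh (r * \<bar>u\<bar>)"
    using False assms by (subst cosh_real_nonneg_le_iff) (auto intro: mult_left_mono)
  ultimately show ?thesis
    using assms by (intro mult_nonneg_nonneg) (auto simp: abs_if split: if_splits)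
qed

text \<open>With \<open>m r\<close> the integral of \<open>cosh (r \<langle>x, v\<rangle>)\<close>, integration by parts gives
  \<open>(N - 1) m' = r (m - m'')\<close>, and \<open>m'' \<ge> m / N\<close> because \<open>\<langle>x, v\<rangle>\<^sup>2\<close> and
  \<open>cosh (r \<langle>x, v\<rangle>)\<close> are positively correlated.\<close>
lemma sphere_unif_cosh_le:
  fixes v :: "real ^ 'd"
  assumes N: "CARD('d) \<ge> 2" and v: "norm v = 1" and r: "r \<ge> 0"
  shows "(\<integral>x. cosh (r * (x \<bullet> v)) \<partial>sphere_unif) \<le> exp (r\<^sup>2 / (2 * real CARD('d)))"
proof -
  define N where "N = real CARD('d)"
  have N2: "N \<ge> 2"
    using N by (simp add: N_def)
  define m where "m s = (\<integral>x. cosh (s * (x \<bullet> v)) \<partial>sphere_unif)" for s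
  have int: "integrable sphere_unif (\<lambda>x. cosh (s * (x \<bullet> v)))" for s
    by (intro integrable_sphere_unif_continuous continuous_intros)
  have m': "(m has_real_derivative (\<integral>x. (x \<bullet> v) * sinh (s * (x \<bullet> v)) \<partial>sphere_unif)) (at s)" for s
    unfolding m_def
  proof (rule dominated_derivative_has_derivative[where K = "\<lambda>_. cosh (\<bar>s\<bar> + 1)"])
    show "AE x in sphere_unif. \<forall>t. \<bar>t - s\<bar> \<le> 1 \<longrightarrow>
        \<bar>cosh (t * (x \<bullet> v)) - cosh (s * (x \<bullet> v))\<bar> \<le> cosh (\<bar>s\<bar> + 1) * \<bar>t - s\<bar>"
      using AE_sphere_unif_norm
    proof (eventually_elim, intro allI impI)
      fix x :: "real ^ 'd" and t :: real assume x: "norm x = 1" and t: "\<bar>t - s\<bar> \<le> 1"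
      have u: "\<bar>x \<bullet> v\<bar> \<le> 1"
        using Cauchy_Schwarz_ineq2[of x v] x v by simp
      \<comment> \<open>For parameters within 1 of \<open>s\<close> and a unit vector
        \<open>x\<close> the argument is at most \<open>|s| + 1\<close> in absolute value, and
        \<open>|sinh|\<close> is below \<open>cosh\<close>.\<close>
      have "norm (cosh (t * (x \<bullet> v)) - cosh (s * (x \<bullet> v))) \<le> cosh (\<bar>s\<bar> + 1) * norm (t - s)"
      proof (rule field_differentiable_bound[of "cball s 1" "\<lambda>t. cosh (t * (x \<bullet> v))" "\<lambda>t. (x \<bullet> v) * sinh (t * (x \<bullet> v))"])
        fix z assume z: "z \<in> cball s 1"
        show "((\<lambda>t. cosh (t * (x \<bullet> v))) has_field_derivative (x \<bullet> v) * sinh (z * (x \<bullet> v))) (at z within cball s 1)"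
          by (auto intro!: derivative_eq_intros)
        have "\<bar>z\<bar> \<le> \<bar>s\<bar> + 1"
          using z by (auto simp: dist_real_def)
        then have "\<bar>z\<bar> * \<bar>x \<bullet> v\<bar> \<le> (\<bar>s\<bar> + 1) * 1"
          using u by (intro mult_mono) auto
        then have c: "cosh \<bar>z * (x \<bullet> v)\<bar> \<le> cosh (\<bar>s\<bar> + 1)"
          by (subst cosh_real_nonneg_le_iff) (auto simp: abs_mult)
        have "\<bar>sinh (z * (x \<bullet> v))\<bar> \<le> cosh \<bar>z * (x \<bullet> v)\<bar>"
          using sinh_less_cosh_real[of "\<bar>z * (x \<bullet> v)\<bar>"] sinh_real_abs[of "z * (x \<bullet> v)"]
          by (simp del: cosh_real_abs sinh_real_abs)
        with c have "\<bar>sinh (z * (x \<bullet> v))\<bar> \<le> cosh (\<bar>s\<bar> + 1)"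
          by linarith
        then have "\<bar>x \<bullet> v\<bar> * \<bar>sinh (z * (x \<bullet> v))\<bar> \<le> 1 * cosh (\<bar>s\<bar> + 1)"
          using u by (intro mult_mono) auto
        then show "norm ((x \<bullet> v) * sinh (z * (x \<bullet> v))) \<le> cosh (\<bar>s\<bar> + 1)"
          by (simp add: abs_mult)
      qed (use t in \<open>auto simp: dist_real_def abs_minus_commute\<close>)
      then show "\<bar>cosh (t * (x \<bullet> v)) - cosh (s * (x \<bullet> v))\<bar> \<le> cosh (\<bar>s\<bar> + 1) * \<bar>t - s\<bar>"
        by simp
    qed
  qed (use int in \<open>auto intro!: derivative_eq_intros\<close>)
  have m'_le: "(\<integral>x. (x \<bullet> v) * sinh (s * (x \<bullet> v)) \<partial>sphere_unif) \<le> s / N * m s" if s: "s \<ge> 0" for s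
  proof -
    \<comment> \<open>Chosen so that \<open>q^2\<close> is the mean of
      \<open>(x \<bullet> v)^2\<close>; the term with the constant factor
      \<open>cosh (s * q)\<close> then integrates to zero.\<close>
    define q where "q = 1 / sqrt N"
    have q: "q \<ge> 0" "q\<^sup>2 = 1 / N"
      using N2 by (auto simp: q_def power_divide)
    have int2: "integrable sphere_unif (\<lambda>x. (x \<bullet> v)\<^sup>2 * cosh (s * (x \<bullet> v)))"
      "integrable sphere_unif (\<lambda>x. (x \<bullet> v)\<^sup>2)"
      by (intro integrable_sphere_unif_continuous continuous_intros)+
    define M2 where "M2 = (\<integral>x. (x \<bullet> v)\<^sup>2 * cosh (s * (x \<bullet> v)) \<partial>sphere_unif)"
    have "0 \<le> (\<integral>x. ((x \<bullet> v)\<^sup>2 - q\<^sup>2) * (cosh (s * (x \<bullet> v)) - cosh (s * q)) \<partial>sphere_unif)"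
      by (intro integral_nonneg_AE AE_I2 cosh_diff_mult_nonneg q s)
    also have "\<dots> = (\<integral>x. (x \<bullet> v)\<^sup>2 * cosh (s * (x \<bullet> v)) - q\<^sup>2 * cosh (s * (x \<bullet> v)) - cosh (s * q) * ((x \<bullet> v)\<^sup>2 - q\<^sup>2) \<partial>sphere_unif)"
      by (simp add: algebra_simps)
    also have "\<dots> = M2 - q\<^sup>2 * m s - cosh (s * q) * ((\<integral>x. (x \<bullet> v)\<^sup>2 \<partial>sphere_unif) - q\<^sup>2)"
      using int2 int unfolding M2_def m_def
      by (simp add: sphere.prob_space)
    also have "\<dots> = M2 - m s / N"
      using v by (simp add: sphere_unif_square_moment q N_def)
    finally have M2: "m s / N \<le> M2"
      by simp
    have "(N - 1) * (\<integral>x. (x \<bullet> v) * sinh (s * (x \<bullet> v)) \<partial>sphere_unif)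
        = (\<integral>x. ((norm v)\<^sup>2 - (x \<bullet> v)\<^sup>2) * (s * cosh (s * (x \<bullet> v))) \<partial>sphere_unif)"
      unfolding N_def
      by (rule sphere_unif_ibp_linear[of "\<lambda>u. sinh (s * u)" "\<lambda>u. s * cosh (s * u)"])
        (auto intro!: derivative_eq_intros continuous_intros)
    also have "\<dots> = (\<integral>x. s * cosh (s * (x \<bullet> v)) - s * ((x \<bullet> v)\<^sup>2 * cosh (s * (x \<bullet> v))) \<partial>sphere_unif)"
      using v by (simp add: algebra_simps)
    also have "\<dots> = s * (m s - M2)"
      using int int2 by (simp add: m_def M2_def algebra_simps)
    also have "\<dots> \<le> s * (m s - m s / N)"
      using M2 s by (intro mult_left_mono) auto
    also have "\<dots> = (N - 1) * (s / N * m s)"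
      using N2 by (simp add: field_simps)
    finally show ?thesis
      by (rule mult_left_le_imp_le) (use N2 in simp)
  qed
  \<comment> \<open>Gronwall argument: \<open>m' \<le> (s / N) m\<close> says that \<open>m\<close>
    divided by the claimed bound is nonincreasing, and this quotient starts at 1.\<close>
  define k where "k s = m s * exp (- (s\<^sup>2 / (2 * N)))" for s
  have "k r \<le> k 0"
  proof (rule DERIV_nonpos_imp_nonincreasing[OF r])
    fix s assume s: "0 \<le> s" "s \<le> r"
    show "\<exists>y. (k has_real_derivative y) (at s) \<and> y \<le> 0"
    proof (intro exI conjI)
      let ?m' = "\<integral>x. (x \<bullet> v) * sinh (s * (x \<bullet> v)) \<partial>sphere_unif"
      show "(k has_real_derivative (?m' - s / N * m s) * exp (- (s\<^sup>2 / (2 * N)))) (at s)"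
        unfolding k_def using N2
        by (auto intro!: derivative_eq_intros m' simp: field_simps)
      show "(?m' - s / N * m s) * exp (- (s\<^sup>2 / (2 * N))) \<le> 0"
        using m'_le[OF s(1)] by (intro mult_nonpos_nonneg) auto
    qed
  qed
  moreover have "k 0 = 1"
    by (simp add: k_def m_def sphere.prob_space)
  ultimately have "m r * exp (- (r\<^sup>2 / (2 * N))) \<le> 1"
    by (simp add: k_def)
  then show ?thesis
    by (simp add: m_def N_def exp_minus field_simps)
qed

text \<open>Invariance under reflection at the origin replaces \<open>exp\<close> by
  \<open>cosh\<close>; scaling then reduces to a unit direction with
  \<open>r = norm v\<close>.\<close>

lemma sphere_unif_subgaussian:
  fixes v :: "real ^ 'd"
  assumes N: "CARD('d) \<ge> 2"
  shows "(\<integral>x. exp (x \<bullet> v) \<partial>sphere_unif) \<le> exp ((norm v)\<^sup>2 / (2 * real CARD('d)))"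
proof (cases "v = 0")
  case True
  then show ?thesis
    by (simp add: sphere.prob_space)
next
  case False
  define w where "w = v /\<^sub>R norm v"
  have w: "norm w = 1" "v = norm v *\<^sub>R w"
    using False by (auto simp: w_def)
  have xv: "x \<bullet> v = norm v * (x \<bullet> w)" for x
    by (subst w(2)) simp
  have int: "integrable sphere_unif (\<lambda>x. exp (x \<bullet> v))" "integrable sphere_unif (\<lambda>x. exp (- (x \<bullet> v)))"
    by (intro integrable_sphere_unif_continuous continuous_intros)+
  have "(\<integral>x. exp (x \<bullet> v) \<partial>sphere_unif) = (\<integral>x. exp (x \<bullet> v) \<partial>distr sphere_unif borel uminus)"
    by (subst distr_sphere_unif_orthogonal) (auto simp: orthogonal_transformation intro: linearI)
  also have "\<dots> = (\<integral>x. exp (- (x \<bullet> v)) \<partial>sphere_unif)"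
    by (subst integral_distr) auto
  finally have "(\<integral>x. exp (x \<bullet> v) \<partial>sphere_unif) = (\<integral>x. (exp (x \<bullet> v) + exp (- (x \<bullet> v))) / 2 \<partial>sphere_unif)"
    using int by simp
  also have "\<dots> = (\<integral>x. cosh (norm v * (x \<bullet> w)) \<partial>sphere_unif)"
    by (simp add: cosh_field_def flip: xv)
  also have "\<dots> \<le> exp ((norm v)\<^sup>2 / (2 * real CARD('d)))"
    by (rule sphere_unif_cosh_le[OF N w(1)]) simp
  finally show ?thesis .
qed

section \<open>The standard Gaussian measure\<close>

text \<open>The integrand and Lebesgue measure factor over the coordinates; each factor is a
  multiple of the normal density of variance \<open>1 / c\<close>.\<close>

lemma nn_integral_lborel_exp_norm_square:
  assumes c: "c > 0"
  shows "(\<integral>\<^sup>+x. ennreal (exp (- c * (norm x)\<^sup>2 / 2)) \<partial>(lborel :: 'a::euclidean_space measure))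
    = ennreal ((2 * pi / c) powr (real DIM('a) / 2))"
proof -
  define q where "q = sqrt (2 * pi / c)"
  have q: "q > 0"
    using c by (simp add: q_def)
  have one: "(\<integral>\<^sup>+x. ennreal (exp (- c * x\<^sup>2 / 2)) \<partial>lborel) = ennreal q"
  proof -
    define \<sigma> where "\<sigma> = 1 / sqrt c"
    have \<sigma>: "\<sigma> > 0" "\<sigma>\<^sup>2 = 1 / c"
      using c by (auto simp: \<sigma>_def power_divide)
    have "exp (- c * x\<^sup>2 / 2) = q * normal_density 0 \<sigma> x" for x
      using c q by (simp add: normal_density_def \<sigma> q_def)
    then have "(\<integral>\<^sup>+x. ennreal (exp (- c * x\<^sup>2 / 2)) \<partial>lborel) = (\<integral>\<^sup>+x. ennreal q * ennreal (normal_density 0 \<sigma> x) \<partial>lborel)"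
      using q by (simp add: ennreal_mult normal_density_nonneg)
    also have "\<dots> = ennreal q * ennreal (\<integral>x. normal_density 0 \<sigma> x \<partial>lborel)"
      using \<sigma> by (simp add: nn_integral_cmult nn_integral_eq_integral normal_density_nonneg)
    finally show ?thesis
      using \<sigma> by simp
  qed
  have "exp (- c * (norm x)\<^sup>2 / 2) = (\<Prod>b\<in>Basis. exp (- c * (x \<bullet> b)\<^sup>2 / 2))" for x :: 'a
  proof -
    have "(norm x)\<^sup>2 = (\<Sum>b\<in>Basis. (x \<bullet> b)\<^sup>2)"
      by (subst power2_norm_eq_inner, subst euclidean_inner) (simp add: power2_eq_square)
    then show ?thesis
      by (simp add: exp_sum[symmetric] sum_distrib_left sum_divide_distrib sum_negf)
  qed
  then have "(\<integral>\<^sup>+x. ennreal (exp (- c * (norm x)\<^sup>2 / 2)) \<partial>(lborel :: 'a measure))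
      = (\<integral>\<^sup>+x. (\<Prod>b\<in>Basis. ennreal (exp (- c * (x \<bullet> b)\<^sup>2 / 2))) \<partial>(lborel :: 'a measure))"
    by (simp add: prod_ennreal)
  also have "\<dots> = (\<Prod>b\<in>(Basis :: 'a set). ennreal q)"
    by (subst nn_integral_lborel_prod) (use one in auto)
  also have "\<dots> = ennreal (q ^ DIM('a))"
    using q by (simp add: ennreal_power)
  also have "q ^ DIM('a) = (2 * pi / c) powr (real DIM('a) / 2)"
    using c q by (simp add: q_def powr_realpow[symmetric] powr_half_sqrt[symmetric] powr_powr)
  finally show ?thesis .
qed

definition gauss_density :: "real ^ 'd \<Rightarrow> real" where
  "gauss_density x = (2 * pi) powr (- real CARD('d) / 2) * exp (- (norm x)\<^sup>2 / 2)"

lemma gauss_density_nonneg: "0 \<le> gauss_density x"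
  by (simp add: gauss_density_def)

lemma borel_measurable_gauss_density [measurable]: "gauss_density \<in> borel_measurable borel"
  unfolding gauss_density_def by measurable

lemma std_gauss_eq: "std_gauss = density lborel (\<lambda>x. ennreal (gauss_density x))"
  by (simp add: std_gauss_def gauss_density_def)

lemma sets_std_gauss [simp, measurable_cong]: "sets std_gauss = sets borel"
  by (simp add: std_gauss_eq)

lemma space_std_gauss [simp]: "space std_gauss = UNIV"
  by (simp add: std_gauss_eq)

text \<open>The tilt lowers the precision from 1 to \<open>1 - c\<close>. The case
  \<open>c = 0\<close> gives total mass 1, and positive \<open>c\<close> closes the
  Hubbard--Stratonovich estimate.\<close>

lemma nn_integral_std_gauss_exp_norm_square:
  assumes c: "c < 1"
  shows "(\<integral>\<^sup>+z. ennreal (exp (c * (norm z)\<^sup>2 / 2)) \<partial>(std_gauss :: (real ^ 'd) measure))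
    = ennreal ((1 - c) powr (- real CARD('d) / 2))"
proof -
  have "(\<integral>\<^sup>+z. ennreal (exp (c * (norm z)\<^sup>2 / 2)) \<partial>(std_gauss :: (real ^ 'd) measure))
      = (\<integral>\<^sup>+z. ennreal ((2 * pi) powr (- real CARD('d) / 2)) * ennreal (exp (- (1 - c) * (norm z)\<^sup>2 / 2)) \<partial>(lborel :: (real ^ 'd) measure))"
    unfolding std_gauss_eq
    by (subst nn_integral_density)
      (auto simp: gauss_density_def ennreal_mult[symmetric] exp_add[symmetric] field_simps intro!: nn_integral_cong)
  also have "\<dots> = ennreal ((2 * pi) powr (- real CARD('d) / 2) * (2 * pi / (1 - c)) powr (real CARD('d) / 2))"
    using nn_integral_lborel_exp_norm_square[of "1 - c", where 'a = "real ^ 'd"] c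
    by (simp add: nn_integral_cmult ennreal_mult)
  also have "(2 * pi) powr (- real CARD('d) / 2) * (2 * pi / (1 - c)) powr (real CARD('d) / 2) = (1 - c) powr (- real CARD('d) / 2)"
    using c by (simp add: powr_divide powr_minus field_simps)
  finally show ?thesis .
qed

lemma prob_space_std_gauss: "prob_space (std_gauss :: (real ^ 'd) measure)"
  by (rule prob_spaceI) (use nn_integral_std_gauss_exp_norm_square[of 0, where 'd = 'd] in simp)

interpretation gauss: prob_space std_gauss
  by (rule prob_space_std_gauss)

lemma measure_std_gauss_UNIV [simp]: "measure (std_gauss :: (real ^ 'd) measure) UNIV = 1"
  using gauss.prob_space by simp

section \<open>Translations and Gaussian integration by parts\<close>

lemma gauss_density_shift:
  "gauss_density (z - t) = gauss_density z * exp (z \<bullet> t - (norm t)\<^sup>2 / 2)"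
  by (simp add: gauss_density_def exp_add[symmetric] power2_norm_eq_inner inner_diff_left inner_diff_right
      inner_commute field_simps)

text \<open>Cameron--Martin formula: the translation is moved from \<open>F\<close> onto the
  density, where it can be differentiated explicitly.\<close>

lemma integral_std_gauss_shift:
  fixes F :: "real ^ 'd \<Rightarrow> real"
  assumes [measurable]: "F \<in> borel_measurable borel"
  shows "(\<integral>z. F (z + t) \<partial>std_gauss) = (\<integral>z. F z * exp (z \<bullet> t - (norm t)\<^sup>2 / 2) \<partial>std_gauss)"
proof -
  have "(\<integral>z. F z * exp (z \<bullet> t - (norm t)\<^sup>2 / 2) \<partial>std_gauss) = (\<integral>z. gauss_density (z - t) * F z \<partial>lborel)"
    unfolding std_gauss_eq gauss_density_shift
    by (subst integral_density) (auto simp: gauss_density_nonneg mult_ac)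
  also have "\<dots> = (\<integral>z. gauss_density (z - t) * F z \<partial>distr lborel borel ((+) t))"
    by (simp add: lborel_distr_plus)
  also have "\<dots> = (\<integral>z. gauss_density z * F (z + t) \<partial>lborel)"
    by (subst integral_distr) (auto simp: add.commute)
  also have "\<dots> = (\<integral>z. F (z + t) \<partial>std_gauss)"
    unfolding std_gauss_eq by (subst integral_density) (auto simp: gauss_density_nonneg)
  finally show ?thesis ..
qed

lemma nn_integral_std_gauss_exp:
  fixes t :: "real ^ 'd"
  shows "(\<integral>\<^sup>+z. ennreal (exp (z \<bullet> t)) \<partial>std_gauss) = ennreal (exp ((norm t)\<^sup>2 / 2))"
proof -
  have "(\<integral>\<^sup>+z. ennreal (exp (z \<bullet> t)) \<partial>std_gauss)
      = (\<integral>\<^sup>+z. ennreal (exp ((norm t)\<^sup>2 / 2)) * ennreal (gauss_density (z - t)) \<partial>lborel)"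
    unfolding std_gauss_eq gauss_density_shift
    by (subst nn_integral_density)
      (auto simp: ennreal_mult[symmetric] gauss_density_nonneg exp_diff intro!: nn_integral_cong)
  also have "\<dots> = ennreal (exp ((norm t)\<^sup>2 / 2)) * (\<integral>\<^sup>+z. ennreal (gauss_density (z - t)) \<partial>lborel)"
    by (rule nn_integral_cmult) measurable
  also have "(\<integral>\<^sup>+z. ennreal (gauss_density (z - t)) \<partial>lborel) = (\<integral>\<^sup>+z. ennreal (gauss_density (z - t)) \<partial>distr lborel borel ((+) t))"
    by (simp add: lborel_distr_plus)
  also have "\<dots> = (\<integral>\<^sup>+z. ennreal (gauss_density (z :: real ^ 'd)) \<partial>lborel)"
    by (subst nn_integral_distr) auto
  also have "\<dots> = emeasure (std_gauss :: (real ^ 'd) measure) (space std_gauss)"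
    by (simp add: std_gauss_eq emeasure_density)
  finally show ?thesis
    by (simp add: gauss.emeasure_space_1 del: space_std_gauss)
qed

lemma integrable_std_gauss_exp: "integrable std_gauss (\<lambda>z. exp (z \<bullet> t))"
  by (rule integrableI_nonneg) (auto simp: nn_integral_std_gauss_exp)

lemma exp_abs_le: "exp \<bar>u\<bar> \<le> exp u + exp (- u)" for u :: real
  by (auto simp: abs_if)

lemma integrable_std_gauss_norm: "integrable (std_gauss :: (real ^ 'd) measure) norm"
proof (rule Bochner_Integration.integrable_bound)
  show "integrable (std_gauss :: (real ^ 'd) measure) (\<lambda>z. \<Sum>b\<in>Basis. exp (z \<bullet> b) + exp (z \<bullet> (- b)))"
    by (intro Bochner_Integration.integrable_sum Bochner_Integration.integrable_add integrable_std_gauss_exp)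
  have le: "norm z \<le> (\<Sum>b\<in>Basis. exp (z \<bullet> b) + exp (z \<bullet> (- b)))" for z :: "real ^ 'd"
  proof -
    have "\<bar>z \<bullet> b\<bar> \<le> exp (z \<bullet> b) + exp (z \<bullet> (- b))" for b
      using exp_ge_add_one_self[of "\<bar>z \<bullet> b\<bar>"] exp_abs_le[of "z \<bullet> b"]
      unfolding inner_minus_right by linarith
    then show ?thesis
      by (intro order_trans[OF norm_le_l1] sum_mono)
  qed
  show "AE z in (std_gauss :: (real ^ 'd) measure). norm (norm z) \<le> norm (\<Sum>b\<in>Basis. exp (z \<bullet> b) + exp (z \<bullet> (- b)))"
    unfolding real_norm_def abs_norm_cancel by (intro AE_I2 order_trans[OF le abs_ge_self])
qed measurable

text \<open>Differentiate the Cameron--Martin formula at shift 0 in the direction \<open>v\<close>.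
  Where \<open>F\<close> moves, the Lipschitz bound dominates and \<open>F'\<close> appears; where
  the density moves, the bound on \<open>F\<close> dominates and the factor
  \<open>z \<bullet> v\<close> appears.\<close>

lemma std_gauss_ibp:
  fixes F :: "real ^ 'd \<Rightarrow> real"
  assumes deriv: "\<And>x. (F has_derivative F' x) (at x)"
    and lip: "\<And>x y. \<bar>F x - F y\<bar> \<le> L * norm (x - y)"
    and bound: "\<And>x. \<bar>F x\<bar> \<le> C"
    and v: "norm v = 1"
  shows "(\<integral>z. F z * (z \<bullet> v) \<partial>std_gauss) = (\<integral>z. F' z v \<partial>std_gauss)"
proof -
  have "continuous_on UNIV F"
    using deriv by (meson continuous_at_imp_continuous_on has_derivative_continuous)
  then have [measurable]: "F \<in> borel_measurable borel"
    by (rule borel_measurable_continuous_onI)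
  have C0: "C \<ge> 0"
    using bound[of 0] by linarith
  have "((\<lambda>t. \<integral>z. F (z + t *\<^sub>R v) \<partial>std_gauss) has_real_derivative (\<integral>z. F' z v \<partial>std_gauss)) (at 0)"
  proof (rule dominated_derivative_has_derivative[where K = "\<lambda>_. L"])
    show "integrable std_gauss (\<lambda>z. F (z + t *\<^sub>R v))" for t
      by (rule gauss.integrable_const_bound[where B = C]) (use bound in auto)
    fix z
    have lin: "linear (F' z)"
      using deriv has_derivative_linear by blast
    have "((\<lambda>t. F (z + t *\<^sub>R v)) has_derivative (\<lambda>t. F' z (t *\<^sub>R v))) (at 0)"
      by (rule has_derivative_compose[of "\<lambda>t. z + t *\<^sub>R v" "\<lambda>t. t *\<^sub>R v" 0 UNIV F, simplified])
        (auto intro!: derivative_eq_intros deriv)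
    then show "((\<lambda>t. F (z + t *\<^sub>R v)) has_real_derivative F' z v) (at 0)"
      by (simp add: has_field_derivative_def linear_scale[OF lin] mult_commute_abs)
  next
    show "AE z in std_gauss. \<forall>t. \<bar>t - 0\<bar> \<le> 1 \<longrightarrow> \<bar>F (z + t *\<^sub>R v) - F (z + 0 *\<^sub>R v)\<bar> \<le> L * \<bar>t - 0\<bar>"
    proof (intro AE_I2 allI impI)
      fix z t show "\<bar>F (z + t *\<^sub>R v) - F (z + 0 *\<^sub>R v)\<bar> \<le> L * \<bar>t - 0\<bar>"
        using lip[of "z + t *\<^sub>R v" z] v by simp
    qed
  qed simp
  moreover have "((\<lambda>t. \<integral>z. F z * exp (t * (z \<bullet> v) - t\<^sup>2 / 2) \<partial>std_gauss) has_real_derivative (\<integral>z. F z * (z \<bullet> v) \<partial>std_gauss)) (at 0)"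
  \<comment> \<open>With \<open>u = z \<bullet> v\<close> and \<open>|s| \<le> 1\<close> the
    derivative \<open>(u - s) * exp (s * u - s^2 / 2)\<close> is at most
    \<open>exp |u| * exp |u|\<close> in absolute value; splitting \<open>exp |2 u|\<close> by sign
    gives the directions \<open>2 v\<close> and \<open>-2 v\<close>.\<close>
  proof (rule dominated_derivative_has_derivative[where K = "\<lambda>z. C * (exp (z \<bullet> (2 *\<^sub>R v)) + exp (z \<bullet> ((-2) *\<^sub>R v)))"])
    show "integrable std_gauss (\<lambda>z. F z * exp (t * (z \<bullet> v) - t\<^sup>2 / 2))" for t
    proof (rule Bochner_Integration.integrable_bound)
      show "integrable std_gauss (\<lambda>z. C * exp (z \<bullet> (t *\<^sub>R v)))"
        by (intro integrable_mult_right integrable_std_gauss_exp)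
      have "\<bar>F z\<bar> * exp (t * (z \<bullet> v) - t\<^sup>2 / 2) \<le> C * exp (z \<bullet> (t *\<^sub>R v))" for z
        using bound[of z] by (intro mult_mono) auto
      then show "AE z in std_gauss. norm (F z * exp (t * (z \<bullet> v) - t\<^sup>2 / 2)) \<le> norm (C * exp (z \<bullet> (t *\<^sub>R v)))"
        using C0 by (auto simp: abs_mult)
    qed measurable
    show "((\<lambda>t. F z * exp (t * (z \<bullet> v) - t\<^sup>2 / 2)) has_real_derivative F z * (z \<bullet> v)) (at 0)" for z
      by (auto intro!: derivative_eq_intros)
    show "integrable std_gauss (\<lambda>z. C * (exp (z \<bullet> (2 *\<^sub>R v)) + exp (z \<bullet> ((-2) *\<^sub>R v))))"
      using integrable_std_gauss_exp by (intro integrable_mult_right Bochner_Integration.integrable_add)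
    show "AE z in std_gauss. \<forall>t. \<bar>t - 0\<bar> \<le> 1 \<longrightarrow>
        \<bar>F z * exp (t * (z \<bullet> v) - t\<^sup>2 / 2) - F z * exp (0 * (z \<bullet> v) - 0\<^sup>2 / 2)\<bar>
          \<le> C * (exp (z \<bullet> (2 *\<^sub>R v)) + exp (z \<bullet> ((-2) *\<^sub>R v))) * \<bar>t - 0\<bar>"
    proof (intro AE_I2 allI impI)
      fix z and t :: real assume t: "\<bar>t - 0\<bar> \<le> 1"
      define u where "u = z \<bullet> v"
      have "norm (exp (t * u - t\<^sup>2 / 2) - exp (0 * u - 0\<^sup>2 / 2)) \<le> exp \<bar>2 * u\<bar> * norm (t - 0)"
      proof (rule field_differentiable_bound[of "cball 0 1" "\<lambda>t. exp (t * u - t\<^sup>2 / 2)" "\<lambda>t. (u - t) * exp (t * u - t\<^sup>2 / 2)"])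
        fix s :: real assume "s \<in> cball 0 1"
        then have s: "\<bar>s\<bar> \<le> 1"
          by (simp add: dist_real_def)
        show "((\<lambda>t. exp (t * u - t\<^sup>2 / 2)) has_field_derivative (u - s) * exp (s * u - s\<^sup>2 / 2)) (at s within cball 0 1)"
          by (auto intro!: derivative_eq_intros)
        have "\<bar>s\<bar> * \<bar>u\<bar> \<le> 1 * \<bar>u\<bar>"
          using s by (intro mult_right_mono) auto
        then have "s * u - s\<^sup>2 / 2 \<le> \<bar>u\<bar>"
          using abs_ge_self[of "s * u"] zero_le_power2[of s] unfolding abs_mult by linarith
        moreover have "\<bar>u - s\<bar> \<le> exp \<bar>u\<bar>"
          using s exp_ge_add_one_self[of "\<bar>u\<bar>"] by linarith
        ultimately have "\<bar>u - s\<bar> * exp (s * u - s\<^sup>2 / 2) \<le> exp \<bar>u\<bar> * exp \<bar>u\<bar>"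
          by (intro mult_mono) auto
        then show "norm ((u - s) * exp (s * u - s\<^sup>2 / 2)) \<le> exp \<bar>2 * u\<bar>"
          by (simp add: abs_mult exp_add[symmetric])
      qed (use t in auto)
      moreover have "exp \<bar>2 * u\<bar> \<le> exp (z \<bullet> (2 *\<^sub>R v)) + exp (z \<bullet> ((-2) *\<^sub>R v))"
        using exp_abs_le[of "2 * u"] by (simp add: u_def)
      ultimately have "\<bar>exp (t * u - t\<^sup>2 / 2) - exp (0 * u - 0\<^sup>2 / 2)\<bar> \<le> (exp (z \<bullet> (2 *\<^sub>R v)) + exp (z \<bullet> ((-2) *\<^sub>R v))) * \<bar>t - 0\<bar>"
        unfolding real_norm_def by (rule order_trans[OF _ mult_right_mono]) simp
      then have "\<bar>F z\<bar> * \<bar>exp (t * u - t\<^sup>2 / 2) - exp (0 * u - 0\<^sup>2 / 2)\<bar> \<le> C * ((exp (z \<bullet> (2 *\<^sub>R v)) + exp (z \<bullet> ((-2) *\<^sub>R v))) * \<bar>t - 0\<bar>)"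
        using bound[of z] C0 by (intro mult_mono) auto
      then show "\<bar>F z * exp (t * (z \<bullet> v) - t\<^sup>2 / 2) - F z * exp (0 * (z \<bullet> v) - 0\<^sup>2 / 2)\<bar>
          \<le> C * (exp (z \<bullet> (2 *\<^sub>R v)) + exp (z \<bullet> ((-2) *\<^sub>R v))) * \<bar>t - 0\<bar>"
        by (simp add: u_def abs_mult[symmetric] right_diff_distrib mult.assoc del: abs_mult)
    qed
  qed
  moreover have "(\<integral>z. F (z + t *\<^sub>R v) \<partial>std_gauss) = (\<integral>z. F z * exp (t * (z \<bullet> v) - t\<^sup>2 / 2) \<partial>std_gauss)" for t
    using integral_std_gauss_shift[of F "t *\<^sub>R v"] v by simp
  ultimately show ?thesis
    by (simp add: DERIV_unique)
qed

section \<open>Moment bounds for the spin system\<close>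

interpretation spins: product_sigma_finite "\<lambda>_::nat. sphere_unif"
  by unfold_locales

lemma sets_Pn [simp, measurable_cong]: "sets (Pn n) = sets (PiM {..<n} (\<lambda>_. borel))"
  unfolding Pn_def by (intro sets_PiM_cong) auto

lemma prob_space_Pn: "prob_space (Pn n)"
  unfolding Pn_def by (intro prob_space_PiM prob_space_sphere_unif)

lemma AE_Pn_norm: "AE \<sigma> in (Pn n :: (nat \<Rightarrow> real ^ 'd) measure). \<forall>i<n. norm (\<sigma> i) = 1"
proof -
  have "AE \<sigma> in (Pn n :: (nat \<Rightarrow> real ^ 'd) measure). \<forall>i\<in>{..<n}. norm (\<sigma> i) = 1"
    unfolding Pn_def
    by (intro AE_finite_allI AE_PiM_component prob_space_sphere_unif AE_sphere_unif_norm) auto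
  then show ?thesis
    by (rule eventually_mono) auto
qed

text \<open>Unit configurations carry full measure, so a bound on these is enough. Since only
  integrability for fixed \<open>n\<close> is at stake, \<open>K\<close> may grow with
  \<open>n\<close>.\<close>

lemma integrable_Pn:
  fixes h :: "(nat \<Rightarrow> real ^ 'd) \<Rightarrow> real"
  assumes "h \<in> borel_measurable (Pn n)" "\<And>\<sigma>. (\<And>i. i < n \<Longrightarrow> norm (\<sigma> i) = 1) \<Longrightarrow> \<bar>h \<sigma>\<bar> \<le> K"
  shows "integrable (Pn n) h"
proof -
  interpret prob_space "Pn n :: (nat \<Rightarrow> real ^ 'd) measure"
    by (rule prob_space_Pn)
  have "AE \<sigma> in Pn n. norm (h \<sigma>) \<le> K"
    using AE_Pn_norm by (rule eventually_mono) (simp add: assms(2))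
  then show ?thesis
    using assms(1) by (rule integrable_const_bound)
qed

definition spin_sum :: "nat \<Rightarrow> (nat \<Rightarrow> real ^ 'd) \<Rightarrow> real ^ 'd" where
  "spin_sum n \<sigma> = (\<Sum>i<n. \<sigma> i)"

lemma borel_measurable_spin_sum [measurable]: "spin_sum n \<in> borel_measurable (Pn n)"
  unfolding spin_sum_def by measurable

lemma norm_spin_sum_le:
  assumes "\<And>i. i < n \<Longrightarrow> norm (\<sigma> i) = 1"
  shows "norm (spin_sum n \<sigma>) \<le> real n"
  unfolding spin_sum_def using norm_sum[of \<sigma> "{..<n}"] assms by simp

lemma gibbs_weight_eq: "gibbs_weight \<beta> n \<sigma> = exp (\<beta> * ((norm (spin_sum n \<sigma>))\<^sup>2 / (2 * real n)))"
proof -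
  have "(norm (spin_sum n \<sigma>))\<^sup>2 = (\<Sum>i<n. \<Sum>j<n. \<sigma> i \<bullet> \<sigma> j)"
    unfolding spin_sum_def power2_norm_eq_inner inner_sum_left by (simp add: inner_sum_right)
  then show ?thesis
    by (simp add: gibbs_weight_def)
qed

text \<open>The matrix entries of \<open>\<surd>n (C - I / N)\<close>, where \<open>C\<close> is the empirical covariance of the spins.\<close>
definition cov_fluct :: "real ^ 'd \<Rightarrow> real ^ 'd \<Rightarrow> nat \<Rightarrow> (nat \<Rightarrow> real ^ 'd) \<Rightarrow> real" where
  "cov_fluct e f n \<sigma> = (\<Sum>i<n. (\<sigma> i \<bullet> e) * (\<sigma> i \<bullet> f) - (e \<bullet> f) / real CARD('d)) / sqrt (real n)"

lemma borel_measurable_cov_fluct [measurable]: "cov_fluct e f n \<in> borel_measurable (Pn n)"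
  unfolding cov_fluct_def by measurable

lemma abs_inner_Basis_le: "e \<in> Basis \<Longrightarrow> f \<in> Basis \<Longrightarrow> norm x = 1 \<Longrightarrow> \<bar>(x \<bullet> e) * (x \<bullet> f)\<bar> \<le> 1"
  using mult_mono[OF Basis_le_norm[of e x] Basis_le_norm[of f x]] by (simp add: abs_mult)

text \<open>A crude bound growing with \<open>n\<close>, for integrability only; the second moment
  bounded in \<open>n\<close> comes from the exponential moments.\<close>

lemma abs_cov_fluct_le:
  fixes \<sigma> :: "nat \<Rightarrow> real ^ 'd"
  assumes ef: "e \<in> Basis" "f \<in> Basis" and \<sigma>: "\<And>i. i < n \<Longrightarrow> norm (\<sigma> i) = 1"
  shows "\<bar>cov_fluct e f n \<sigma>\<bar> \<le> 2 * real n"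
proof -
  have "\<bar>e \<bullet> f / real CARD('d)\<bar> \<le> 1"
    using ef by (auto simp: inner_Basis)
  then have "\<bar>(\<sigma> i \<bullet> e) * (\<sigma> i \<bullet> f) - (e \<bullet> f) / real CARD('d)\<bar> \<le> 2" if "i < n" for i
    using abs_inner_Basis_le[OF ef \<sigma>[OF that]] by linarith
  then have "\<bar>\<Sum>i<n. (\<sigma> i \<bullet> e) * (\<sigma> i \<bullet> f) - (e \<bullet> f) / real CARD('d)\<bar> \<le> (\<Sum>i<n. 2)"
    by (intro order_trans[OF sum_abs] sum_mono) auto
  then have *: "\<bar>\<Sum>i<n. (\<sigma> i \<bullet> e) * (\<sigma> i \<bullet> f) - (e \<bullet> f) / real CARD('d)\<bar> \<le> 2 * real n"
    by simp
  show ?thesis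
  proof (cases "n = 0")
    case False
    then have "sqrt (real n) \<ge> 1"
      by simp
    with * have "\<bar>\<Sum>i<n. (\<sigma> i \<bullet> e) * (\<sigma> i \<bullet> f) - (e \<bullet> f) / real CARD('d)\<bar> \<le> 2 * real n * sqrt (real n)"
      by (intro order_trans[OF *]) (simp add: mult_left_le)
    with False show ?thesis
      by (simp add: cov_fluct_def abs_divide divide_le_eq)
  qed (simp add: cov_fluct_def)
qed

text \<open>Independence factorises the exponential over the spins, and each factor is
  sub-Gaussian.\<close>

lemma nn_integral_Pn_exp_spin_sum:
  fixes v :: "real ^ 'd"
  assumes N: "CARD('d) \<ge> 2"
  shows "(\<integral>\<^sup>+\<sigma>. ennreal (exp (spin_sum n \<sigma> \<bullet> v)) \<partial>Pn n) \<le> ennreal (exp (real n * (norm v)\<^sup>2 / (2 * real CARD('d))))"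
proof -
  have "(\<integral>\<^sup>+\<sigma>. ennreal (exp (spin_sum n \<sigma> \<bullet> v)) \<partial>Pn n)
      = (\<integral>\<^sup>+\<sigma>. (\<Prod>i<n. ennreal (exp (\<sigma> i \<bullet> v))) \<partial>PiM {..<n} (\<lambda>_. sphere_unif))"
    unfolding Pn_def by (simp add: spin_sum_def inner_sum_left exp_sum prod_ennreal)
  also have "\<dots> = (\<Prod>i<n. \<integral>\<^sup>+x. ennreal (exp (x \<bullet> v)) \<partial>sphere_unif)"
    by (rule spins.product_nn_integral_prod) auto
  also have "\<dots> \<le> (\<Prod>i<n. ennreal (exp ((norm v)\<^sup>2 / (2 * real CARD('d)))))"
  proof (intro prod_mono_ennreal)
    have "(\<integral>\<^sup>+x. ennreal (exp (x \<bullet> v)) \<partial>sphere_unif) = ennreal (\<integral>x. exp (x \<bullet> v) \<partial>sphere_unif)"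
      by (intro nn_integral_eq_integral integrable_sphere_unif_continuous continuous_intros) auto
    then show "(\<integral>\<^sup>+x. ennreal (exp (x \<bullet> v)) \<partial>sphere_unif) \<le> ennreal (exp ((norm v)\<^sup>2 / (2 * real CARD('d))))"
      using sphere_unif_subgaussian[OF N, of v] by (simp add: ennreal_leI)
  qed
  also have "\<dots> = ennreal (exp (real n * (norm v)\<^sup>2 / (2 * real CARD('d))))"
    by (simp add: ennreal_power exp_of_nat_mult[symmetric])
  finally show ?thesis .
qed

text \<open>Hubbard--Stratonovich: \<open>exp (a |S|\<^sup>2 / 2n)\<close> is a Gaussian average of exponentials
  of linear functionals of \<open>S\<close>.\<close>
lemma nn_integral_Pn_exp_square:
  assumes N: "CARD('d::finite) \<ge> 2" and a: "0 \<le> a" "a < real CARD('d)" and n: "n \<ge> 1"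
  shows "(\<integral>\<^sup>+\<sigma>. ennreal (exp (a * ((norm (spin_sum n \<sigma>))\<^sup>2 / (2 * real n)))) \<partial>(Pn n :: (nat \<Rightarrow> real ^ 'd) measure))
    \<le> ennreal ((1 - a / real CARD('d)) powr (- real CARD('d) / 2))"
proof -
  \<comment> \<open>Makes \<open>|c S|^2 / 2\<close> equal to \<open>a |S|^2 / (2 n)\<close>. After
    the swap of integrals the sub-Gaussian bound leaves the exponent
    \<open>(a / N) |z|^2 / 2\<close>, which the Gaussian integrates because
    \<open>a < N\<close>.\<close>
  define c where "c = sqrt (a / real n)"
  have c2: "c\<^sup>2 = a / real n"
    using a n by (simp add: c_def)
  interpret Pn: prob_space "Pn n :: (nat \<Rightarrow> real ^ 'd) measure"
    by (rule prob_space_Pn)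
  interpret pair_sigma_finite "Pn n :: (nat \<Rightarrow> real ^ 'd) measure" "std_gauss :: (real ^ 'd) measure"
    by unfold_locales
  have "(\<integral>\<^sup>+\<sigma>. ennreal (exp (a * ((norm (spin_sum n \<sigma>))\<^sup>2 / (2 * real n)))) \<partial>(Pn n :: (nat \<Rightarrow> real ^ 'd) measure))
      = (\<integral>\<^sup>+\<sigma>. \<integral>\<^sup>+z. ennreal (exp (z \<bullet> (c *\<^sub>R spin_sum n \<sigma>))) \<partial>std_gauss \<partial>(Pn n :: (nat \<Rightarrow> real ^ 'd) measure))"
    unfolding nn_integral_std_gauss_exp by (simp add: power_mult_distrib c2 mult.commute)
  also have "\<dots> = (\<integral>\<^sup>+z. \<integral>\<^sup>+\<sigma>. ennreal (exp (z \<bullet> (c *\<^sub>R spin_sum n \<sigma>))) \<partial>Pn n \<partial>(std_gauss :: (real ^ 'd) measure))"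
    by (rule Fubini'[symmetric]) measurable
  also have "\<dots> \<le> (\<integral>\<^sup>+z. ennreal (exp (a / real CARD('d) * (norm z)\<^sup>2 / 2)) \<partial>(std_gauss :: (real ^ 'd) measure))"
  proof (rule nn_integral_mono)
    fix z :: "real ^ 'd"
    have "(\<integral>\<^sup>+\<sigma>. ennreal (exp (z \<bullet> (c *\<^sub>R spin_sum n \<sigma>))) \<partial>Pn n) = (\<integral>\<^sup>+\<sigma>. ennreal (exp (spin_sum n \<sigma> \<bullet> (c *\<^sub>R z))) \<partial>Pn n)"
      by (simp add: inner_commute)
    also have "\<dots> \<le> ennreal (exp (real n * (norm (c *\<^sub>R z))\<^sup>2 / (2 * real CARD('d))))"
      by (rule nn_integral_Pn_exp_spin_sum[OF N])
    also have "real n * (norm (c *\<^sub>R z))\<^sup>2 / (2 * real CARD('d)) = a / real CARD('d) * (norm z)\<^sup>2 / 2"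
      using n by (simp add: power_mult_distrib c2)
    finally show "(\<integral>\<^sup>+\<sigma>. ennreal (exp (z \<bullet> (c *\<^sub>R spin_sum n \<sigma>))) \<partial>Pn n) \<le> ennreal (exp (a / real CARD('d) * (norm z)\<^sup>2 / 2))" .
  qed
  also have "\<dots> = ennreal ((1 - a / real CARD('d)) powr (- real CARD('d) / 2))"
    using a by (intro nn_integral_std_gauss_exp_norm_square) simp
  finally show ?thesis .
qed

text \<open>Each product of coordinates lies in an interval of length 2, so Hoeffding's lemma with
  parameter \<open>l = 1 / sqrt n\<close> costs the exponent \<open>l^2 * 4 / 8 = 1 / (2 n)\<close>
  per spin, and there are \<open>n\<close> independent spins. The parameter has to be positive; the
  sign \<open>s\<close> supplies both tails.\<close>

lemma nn_integral_Pn_exp_cov_fluct: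
  assumes ef: "e \<in> Basis" "f \<in> (Basis :: (real ^ 'd) set)" and s: "s \<in> {-1, 1}" and n: "n \<ge> 1"
  shows "(\<integral>\<^sup>+\<sigma>. ennreal (exp (s * cov_fluct e f n \<sigma>)) \<partial>Pn n) \<le> ennreal (exp (1 / 2))"
proof -
  define l where "l = 1 / sqrt (real n)"
  have l: "l > 0" "l\<^sup>2 = 1 / real n"
    using n by (auto simp: l_def power_divide)
  define \<mu> where "\<mu> = e \<bullet> f / real CARD('d)"
  define \<psi> where "\<psi> x = s * ((x \<bullet> e) * (x \<bullet> f))" for x
  have \<psi>m: "sphere.expectation \<psi> = s * \<mu>"
    unfolding \<psi>_def \<mu>_def using sphere_unif_second_moment[OF ef] by simp
  interpret h: interval_bounded_random_variable sphere_unif \<psi> "-1" 1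
  proof
    show "\<psi> \<in> borel_measurable sphere_unif"
      unfolding \<psi>_def by measurable
    show "AE x in sphere_unif. \<psi> x \<in> {-1..1}"
      using AE_sphere_unif_norm
    proof eventually_elim
      case (elim x)
      then show ?case
        using abs_inner_Basis_le[OF ef elim] s by (auto simp: \<psi>_def abs_le_iff)
    qed
  qed
  have H: "(\<integral>\<^sup>+x. ennreal (exp (l * (\<psi> x - s * \<mu>))) \<partial>sphere_unif) \<le> ennreal (exp (1 / (2 * real n)))"
    using h.Hoeffdings_lemma_nn_integral[OF l(1)] l(2) by (simp add: \<psi>m power2_eq_square mult.commute)
  have "(\<integral>\<^sup>+\<sigma>. ennreal (exp (s * cov_fluct e f n \<sigma>)) \<partial>Pn n)
      = (\<integral>\<^sup>+\<sigma>. (\<Prod>i<n. ennreal (exp (l * (\<psi> (\<sigma> i) - s * \<mu>)))) \<partial>PiM {..<n} (\<lambda>_. sphere_unif))"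
    unfolding Pn_def prod_ennreal[OF exp_ge_zero] exp_sum[OF finite_lessThan, symmetric]
    by (simp add: cov_fluct_def l_def \<psi>_def \<mu>_def sum_divide_distrib sum_distrib_left diff_divide_distrib algebra_simps)
  also have "\<dots> = (\<Prod>i<n. \<integral>\<^sup>+x. ennreal (exp (l * (\<psi> x - s * \<mu>))) \<partial>sphere_unif)"
    by (rule spins.product_nn_integral_prod) auto
  also have "\<dots> \<le> (\<Prod>i<n. ennreal (exp (1 / (2 * real n))))"
    using H by (intro prod_mono_ennreal) auto
  also have "\<dots> = ennreal (exp (1 / 2))"
    using n by (simp add: ennreal_power exp_of_nat_mult[symmetric])
  finally show ?thesis .
qed

section \<open>Second moments under the unnormalised Gibbs weight\<close>

lemma power_le_fact_mult_exp:
  fixes x :: real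
  assumes "x \<ge> 0"
  shows "x ^ n \<le> fact n * exp x"
proof -
  have "sum (\<lambda>k. x ^ k /\<^sub>R fact k) {n} \<le> (\<Sum>k. x ^ k /\<^sub>R fact k)"
    using assms by (intro sum_le_suminf summable_exp_generic) auto
  then have "x ^ n / fact n \<le> exp x"
    by (simp add: exp_def divide_inverse_commute)
  then show ?thesis
    by (simp add: field_simps)
qed

text \<open>If \<open>d^2 \<le> exp (\<delta> T)\<close>, the square is absorbed into the exponent.
  Otherwise \<open>exp (\<beta> T)\<close> is at most a power of \<open>d^2\<close>, so the product
  is at most a power of \<open>|d|\<close>, dominated by \<open>exp |d|\<close>.\<close>

lemma square_mult_exp_le:
  fixes \<beta> \<delta> :: real
  assumes \<delta>: "\<delta> > 0" and \<beta>: "\<beta> \<ge> 0"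
  obtains K where "K \<ge> 0" "\<And>d T. T \<ge> 0 \<Longrightarrow> d\<^sup>2 * exp (\<beta> * T) \<le> exp ((\<beta> + \<delta>) * T) + K * (exp d + exp (- d))"
proof -
  \<comment> \<open>Large enough that \<open>exp (\<beta> T)\<close> is at most the
    \<open>m\<close>-th power of \<open>exp (\<delta> T)\<close>. The factorial in \<open>K\<close>
    then belongs to the degree \<open>2 m + 2\<close> of \<open>d^2 (d^2)^m\<close>.\<close>
  obtain m :: nat where m: "\<beta> \<le> real m * \<delta>"
    using reals_Archimedean3[OF \<delta>] less_imp_le by blast
  define K :: real where "K = fact (2 * m + 2)"
  have "d\<^sup>2 * exp (\<beta> * T) \<le> exp ((\<beta> + \<delta>) * T) + K * (exp d + exp (- d))" if T: "T \<ge> 0" for d T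
  proof (cases "d\<^sup>2 \<le> exp (\<delta> * T)")
    case True
    then have "d\<^sup>2 * exp (\<beta> * T) \<le> exp (\<delta> * T) * exp (\<beta> * T)"
      by (intro mult_right_mono) auto
    also have "\<dots> = exp ((\<beta> + \<delta>) * T)"
      by (simp add: exp_add[symmetric] algebra_simps)
    finally show ?thesis
      by (simp add: K_def add_increasing2)
  next
    case False
    have "exp (\<beta> * T) \<le> exp (real m * (\<delta> * T))"
      using mult_right_mono[OF m T] by simp
    also have "\<dots> = exp (\<delta> * T) ^ m"
      by (rule exp_of_nat_mult)
    also have "\<dots> \<le> (d\<^sup>2) ^ m"
      using False by (intro power_mono) auto
    finally have "d\<^sup>2 * exp (\<beta> * T) \<le> d\<^sup>2 * (d\<^sup>2) ^ m"
      by (intro mult_left_mono) auto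
    also have "\<dots> = \<bar>d\<bar> ^ (2 * m + 2)"
      by (simp add: power_mult power_add power2_eq_square)
    also have "\<dots> \<le> K * exp \<bar>d\<bar>"
      unfolding K_def by (rule power_le_fact_mult_exp) simp
    also have "\<dots> \<le> K * (exp d + exp (- d))"
      by (intro mult_left_mono exp_abs_le) (simp add: K_def)
    finally show ?thesis
      by (simp add: add_increasing)
  qed
  then show ?thesis
    by (intro that[of K]) (auto simp: K_def)
qed

text \<open>One constant serves all \<open>n\<close>. The integrals are left unnormalised: dividing
  by a partition function that is at least 1 can only decrease them.\<close>

lemma gibbs_moment_bounds:
  assumes N: "CARD('d::finite) \<ge> 2" and \<beta>: "0 \<le> \<beta>" "\<beta> < real CARD('d)"
  obtains K where "K \<ge> 0"
    "\<And>n. n \<ge> 1 \<Longrightarrow> (\<integral>\<sigma>. gibbs_weight \<beta> n \<sigma> * ((norm (spin_sum n \<sigma>))\<^sup>2 / real n) \<partial>(Pn n :: (nat \<Rightarrow> real ^ 'd) measure)) \<le> K"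
    "\<And>n e f. n \<ge> 1 \<Longrightarrow> e \<in> Basis \<Longrightarrow> f \<in> Basis \<Longrightarrow>
      (\<integral>\<sigma>. gibbs_weight \<beta> n \<sigma> * (cov_fluct e f n \<sigma>)\<^sup>2 \<partial>(Pn n :: (nat \<Rightarrow> real ^ 'd) measure)) \<le> K"
proof -
  \<comment> \<open>The midpoint stays below \<open>N\<close>, where the exponential moment of
    \<open>|S|^2 / (2 n)\<close> is bounded, and exceeds \<open>\<beta>\<close> by a margin
    \<open>\<delta> > 0\<close> for absorbing squares.\<close>
  define a where "a = (\<beta> + real CARD('d)) / 2"
  define \<delta> where "\<delta> = a - \<beta>"
  have a: "0 \<le> a" "a < real CARD('d)" "\<delta> > 0" "\<beta> + \<delta> = a"
    using \<beta> by (auto simp: a_def \<delta>_def field_simps)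
  define A where "A = (1 - a / real CARD('d)) powr (- real CARD('d) / 2)"
  define T where "T n \<sigma> = (norm (spin_sum n \<sigma>))\<^sup>2 / (2 * real n)" for n and \<sigma> :: "nat \<Rightarrow> real ^ 'd"
  have T: "T n \<sigma> \<ge> 0" for n \<sigma>
    by (simp add: T_def)
  have [measurable]: "T n \<in> borel_measurable (Pn n)" for n
    unfolding T_def by measurable
  have w: "gibbs_weight \<beta> n \<sigma> = exp (\<beta> * T n \<sigma>)" for n \<sigma>
    by (simp add: gibbs_weight_eq T_def)
  have IT: "(\<integral>\<^sup>+\<sigma>. ennreal (exp (a * T n \<sigma>)) \<partial>Pn n) \<le> ennreal A" if "n \<ge> 1" for n
    unfolding T_def A_def by (rule nn_integral_Pn_exp_square[OF N a(1,2) that])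
  obtain K where K: "K \<ge> 0" "\<And>d T. T \<ge> 0 \<Longrightarrow> d\<^sup>2 * exp (\<beta> * T) \<le> exp ((\<beta> + \<delta>) * T) + K * (exp d + exp (- d))"
    using square_mult_exp_le[OF a(3) \<beta>(1)] by metis
  have A0: "A \<ge> 0"
    by (simp add: A_def)
  \<comment> \<open>From \<open>\<delta> T \<le> exp (\<delta> T)\<close> and
    \<open>|S|^2 / n = 2 T\<close>.\<close>
  define K1 where "K1 = 2 / \<delta> * A"
  \<comment> \<open>From \<open>square_mult_exp_le\<close>, with Hoeffding's
    \<open>exp (1 / 2)\<close> for each of the two tails.\<close>
  define K2 where "K2 = A + K * (exp (1 / 2) + exp (1 / 2))"
  have K12: "K1 \<ge> 0" "K2 \<ge> 0"
    using a A0 K by (auto simp: K1_def K2_def)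
  have 1: "(\<integral>\<sigma>. gibbs_weight \<beta> n \<sigma> * ((norm (spin_sum n \<sigma>))\<^sup>2 / real n) \<partial>(Pn n :: (nat \<Rightarrow> real ^ 'd) measure)) \<le> K1" if n: "n \<ge> 1" for n
  proof (rule integral_real_bounded[OF K12(1)])
    have "(\<integral>\<^sup>+\<sigma>. ennreal (gibbs_weight \<beta> n \<sigma> * ((norm (spin_sum n \<sigma>))\<^sup>2 / real n)) \<partial>(Pn n :: (nat \<Rightarrow> real ^ 'd) measure))
        \<le> (\<integral>\<^sup>+\<sigma>. ennreal (2 / \<delta>) * ennreal (exp (a * T n \<sigma>)) \<partial>Pn n)"
    proof (rule nn_integral_mono)
      fix \<sigma> :: "nat \<Rightarrow> real ^ 'd"
      have "\<delta> * T n \<sigma> \<le> exp (\<delta> * T n \<sigma>)"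
        using exp_ge_add_one_self[of "\<delta> * T n \<sigma>"] by linarith
      then have "T n \<sigma> \<le> exp (\<delta> * T n \<sigma>) / \<delta>"
        using a by (simp add: field_simps)
      then have "exp (\<beta> * T n \<sigma>) * (2 * T n \<sigma>) \<le> exp (\<beta> * T n \<sigma>) * (2 * (exp (\<delta> * T n \<sigma>) / \<delta>))"
        by (intro mult_left_mono) auto
      also have "\<dots> = 2 / \<delta> * exp (a * T n \<sigma>)"
        by (simp add: a(4)[symmetric] exp_add distrib_right)
      also have "2 * T n \<sigma> = (norm (spin_sum n \<sigma>))\<^sup>2 / real n"
        by (simp add: T_def)
      finally show "ennreal (gibbs_weight \<beta> n \<sigma> * ((norm (spin_sum n \<sigma>))\<^sup>2 / real n))
          \<le> ennreal (2 / \<delta>) * ennreal (exp (a * T n \<sigma>))"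
        using a by (simp add: w ennreal_mult[symmetric] ennreal_leI)
    qed
    also have "\<dots> = ennreal (2 / \<delta>) * (\<integral>\<^sup>+\<sigma>. ennreal (exp (a * T n \<sigma>)) \<partial>Pn n)"
      by (rule nn_integral_cmult) measurable
    also have "\<dots> \<le> ennreal (2 / \<delta>) * ennreal A"
      by (intro mult_left_mono IT n) auto
    also have "\<dots> = ennreal K1"
      using a A0 by (simp add: K1_def ennreal_mult[symmetric])
    finally show "(\<integral>\<^sup>+\<sigma>. ennreal (gibbs_weight \<beta> n \<sigma> * ((norm (spin_sum n \<sigma>))\<^sup>2 / real n)) \<partial>(Pn n :: (nat \<Rightarrow> real ^ 'd) measure)) \<le> ennreal K1" .
  qed
  have 2: "(\<integral>\<sigma>. gibbs_weight \<beta> n \<sigma> * (cov_fluct e f n \<sigma>)\<^sup>2 \<partial>Pn n) \<le> K2"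
    if n: "n \<ge> 1" and ef: "e \<in> Basis" "f \<in> (Basis :: (real ^ 'd) set)" for n e f
  proof (rule integral_real_bounded[OF K12(2)])
    let ?c = "cov_fluct e f n"
    have "(\<integral>\<^sup>+\<sigma>. ennreal (gibbs_weight \<beta> n \<sigma> * (?c \<sigma>)\<^sup>2) \<partial>Pn n)
        \<le> (\<integral>\<^sup>+\<sigma>. ennreal (exp (a * T n \<sigma>)) + ennreal K * (ennreal (exp (1 * ?c \<sigma>)) + ennreal (exp (-1 * ?c \<sigma>))) \<partial>Pn n)"
    proof (rule nn_integral_mono)
      fix \<sigma> :: "nat \<Rightarrow> real ^ 'd"
      have "gibbs_weight \<beta> n \<sigma> * (?c \<sigma>)\<^sup>2 \<le> exp (a * T n \<sigma>) + K * (exp (1 * ?c \<sigma>) + exp (-1 * ?c \<sigma>))"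
        using K(2)[OF T, of "?c \<sigma>" n \<sigma>] by (simp add: w a(4) mult.commute)
      then show "ennreal (gibbs_weight \<beta> n \<sigma> * (?c \<sigma>)\<^sup>2)
          \<le> ennreal (exp (a * T n \<sigma>)) + ennreal K * (ennreal (exp (1 * ?c \<sigma>)) + ennreal (exp (-1 * ?c \<sigma>)))"
        using K(1) by (simp add: ennreal_mult[symmetric] ennreal_plus[symmetric] ennreal_leI del: ennreal_plus)
    qed
    also have "\<dots> = (\<integral>\<^sup>+\<sigma>. ennreal (exp (a * T n \<sigma>)) \<partial>Pn n) + ennreal K *
        ((\<integral>\<^sup>+\<sigma>. ennreal (exp (1 * ?c \<sigma>)) \<partial>Pn n) + (\<integral>\<^sup>+\<sigma>. ennreal (exp (-1 * ?c \<sigma>)) \<partial>Pn n))"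
      by (subst nn_integral_add, measurable, subst nn_integral_cmult, measurable, subst nn_integral_add, measurable)
    also have "\<dots> \<le> ennreal A + ennreal K * (ennreal (exp (1 / 2)) + ennreal (exp (1 / 2)))"
      by (intro add_mono mult_left_mono IT n nn_integral_Pn_exp_cov_fluct ef) auto
    also have "\<dots> = ennreal K2"
      using K(1) A0 by (simp add: K2_def ennreal_mult[symmetric] ennreal_plus[symmetric] del: ennreal_plus)
    finally show "(\<integral>\<^sup>+\<sigma>. ennreal (gibbs_weight \<beta> n \<sigma> * (?c \<sigma>)\<^sup>2) \<partial>Pn n) \<le> ennreal K2" .
  qed
  show ?thesis
    by (rule that[of "max K1 K2"]) (use 1 2 K12 in \<open>auto simp: le_max_iff_disj\<close>)
qed

section \<open>Integration by parts under the Gibbs measure\<close>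

text \<open>The Gibbs weight as a function of one spin \<open>x\<close>, with \<open>r\<close> the
  sum of the others: its logarithmic derivative brings back the total sum
  \<open>r + x\<close>.\<close>

lemma has_derivative_exp_norm_square:
  fixes r :: "'a::real_inner"
  shows "((\<lambda>x. exp (b * ((norm (r + x))\<^sup>2 / 2))) has_derivative
    (\<lambda>h. exp (b * ((norm (r + x))\<^sup>2 / 2)) * (b * ((r + x) \<bullet> h)))) (at x)"
  unfolding power2_norm_eq_inner
  by (auto intro!: derivative_eq_intros simp: algebra_simps inner_commute)

text \<open>Stands for the gradient and Hessian of a test function. The operator norm is written as
  a pointwise bound, the form in which matrix entries and the trace are estimated.\<close>

locale bounded_gradient =
  fixes G :: "real ^ 'd \<Rightarrow> real ^ 'd" and H :: "real ^ 'd \<Rightarrow> real ^ 'd \<Rightarrow> real ^ 'd"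
  assumes deriv: "\<And>x. (G has_derivative H x) (at x)"
    and norm_G: "\<And>x. norm (G x) \<le> 1"
    and norm_H: "\<And>x h. norm (H x h) \<le> norm h"
begin

lemma linear_H: "linear (H x)"
  using deriv has_derivative_linear by blast

lemma continuous_G: "continuous_on UNIV G"
  using deriv by (meson continuous_at_imp_continuous_on has_derivative_continuous)

lemma borel_measurable_G [measurable]: "G \<in> borel_measurable borel"
  by (rule borel_measurable_continuous_onI[OF continuous_G])

lemma borel_measurable_H [measurable]: "(\<lambda>x. H x f \<bullet> e) \<in> borel_measurable borel"
proof -
  have "((\<lambda>x. G x \<bullet> e) has_derivative (\<lambda>h. H x h \<bullet> e)) (at x)" for x
    by (auto intro!: derivative_eq_intros deriv)
  then show ?thesis
    by (rule borel_measurable_has_derivative)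
qed

lemma lipschitz_G: "norm (G x - G y) \<le> norm (x - y)"
proof -
  have "norm (G x - G y) \<le> 1 * norm (x - y)"
  proof (rule differentiable_bound[of UNIV G H])
    show "onorm (H z) \<le> 1" for z
      using norm_H by (intro onorm_bound) auto
  qed (use deriv in \<open>auto intro: has_derivative_at_withinI\<close>)
  then show ?thesis by simp
qed

lemma abs_inner_G_le: "e \<in> Basis \<Longrightarrow> \<bar>G x \<bullet> e\<bar> \<le> 1"
  using Basis_le_norm[of e "G x"] norm_G[of x] by simp

lemma abs_inner_H_le: "e \<in> Basis \<Longrightarrow> \<bar>H x h \<bullet> e\<bar> \<le> norm h"
  using Basis_le_norm[of e "H x h"] norm_H[of x h] by simp

lemma sphere_gibbs_ibp:
  assumes e: "e \<in> Basis"
  shows "(real CARD('d) - 1) * (\<integral>x. (x \<bullet> e) * ((G (a *\<^sub>R (r + x) + y) \<bullet> e) * exp (b * ((norm (r + x))\<^sup>2 / 2))) \<partial>sphere_unif)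
   = (\<integral>x. exp (b * ((norm (r + x))\<^sup>2 / 2)) *
        ((a * (H (a *\<^sub>R (r + x) + y) e \<bullet> e) + b * ((r + x) \<bullet> e) * (G (a *\<^sub>R (r + x) + y) \<bullet> e))
       - (x \<bullet> e) * (\<Sum>f\<in>Basis. (x \<bullet> f) * (a * (H (a *\<^sub>R (r + x) + y) f \<bullet> e) + b * ((r + x) \<bullet> f) * (G (a *\<^sub>R (r + x) + y) \<bullet> e))))
      \<partial>sphere_unif)"
proof -
  define W where "W x = exp (b * ((norm (r + x))\<^sup>2 / 2))" for x
  define p where "p x = a *\<^sub>R (r + x) + y" for x
  define B where "B x = (G (p x) \<bullet> e) * W x" for x
  define B' where "B' x h = W x * (a * (H (p x) h \<bullet> e) + b * ((r + x) \<bullet> h) * (G (p x) \<bullet> e))" for x h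
  have dG: "((\<lambda>x. G (p x)) has_derivative (\<lambda>h. H (p x) (a *\<^sub>R h))) (at x)" for x
    by (rule has_derivative_compose[of p "\<lambda>h. a *\<^sub>R h" x UNIV G, simplified])
      (auto intro!: derivative_eq_intros deriv simp: p_def[abs_def])
  have dW: "(W has_derivative (\<lambda>h. W x * (b * ((r + x) \<bullet> h)))) (at x)" for x
    unfolding W_def by (rule has_derivative_exp_norm_square)
  have dB: "(B has_derivative B' x) (at x)" for x
    unfolding B_def B'_def
    by (auto intro!: derivative_eq_intros dG dW simp: linear_scale[OF linear_H] algebra_simps)
  have lin: "linear (B' x)" for x
    using dB has_derivative_linear by blast
  have contW: "continuous_on UNIV (\<lambda>x. W x * (\<bar>a\<bar> + \<bar>b\<bar> * norm (r + x)))"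
    unfolding W_def by (auto intro!: continuous_intros)
  obtain K where K: "\<And>x. norm x = 1 \<Longrightarrow> \<bar>W x * (\<bar>a\<bar> + \<bar>b\<bar> * norm (r + x))\<bar> \<le> K"
    using continuous_bounded_on_sphere[OF contW] by blast
  have bound: "\<bar>B' x h\<bar> \<le> K * norm h" if "norm x = 1" for x h
  proof -
    have "\<bar>b * ((r + x) \<bullet> h) * (G (p x) \<bullet> e)\<bar> \<le> \<bar>b\<bar> * (norm (r + x) * norm h) * 1"
      unfolding abs_mult using Cauchy_Schwarz_ineq2[of "r + x" h] abs_inner_G_le[OF e]
      by (intro mult_mono) auto
    moreover have "\<bar>a * (H (p x) h \<bullet> e)\<bar> \<le> \<bar>a\<bar> * norm h"
      unfolding abs_mult using abs_inner_H_le[OF e] by (intro mult_left_mono) auto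
    ultimately have "\<bar>a * (H (p x) h \<bullet> e) + b * ((r + x) \<bullet> h) * (G (p x) \<bullet> e)\<bar> \<le> (\<bar>a\<bar> + \<bar>b\<bar> * norm (r + x)) * norm h"
      by (simp add: algebra_simps)
    then have "\<bar>B' x h\<bar> \<le> W x * ((\<bar>a\<bar> + \<bar>b\<bar> * norm (r + x)) * norm h)"
      unfolding B'_def abs_mult by (intro mult_mono) (auto simp: W_def)
    also have "\<dots> \<le> K * norm h"
      unfolding mult.assoc[symmetric] using K[OF that] by (intro mult_right_mono) auto
    finally show ?thesis .
  qed
  have eq: "B' x e - (x \<bullet> e) * B' x x = W x * ((a * (H (p x) e \<bullet> e) + b * ((r + x) \<bullet> e) * (G (p x) \<bullet> e))
       - (x \<bullet> e) * (\<Sum>f\<in>Basis. (x \<bullet> f) * (a * (H (p x) f \<bullet> e) + b * ((r + x) \<bullet> f) * (G (p x) \<bullet> e))))" for x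
  proof -
    have "B' x x = B' x (\<Sum>f\<in>Basis. (x \<bullet> f) *\<^sub>R f)"
      by (simp add: euclidean_representation)
    also have "\<dots> = (\<Sum>f\<in>Basis. (x \<bullet> f) * B' x f)"
      by (simp add: linear_sum[OF lin] linear_scale[OF lin])
    also have "\<dots> = W x * (\<Sum>f\<in>Basis. (x \<bullet> f) * (a * (H (p x) f \<bullet> e) + b * ((r + x) \<bullet> f) * (G (p x) \<bullet> e)))"
      by (simp add: B'_def sum_distrib_left mult.left_commute)
    finally have B'x: "B' x x = W x * (\<Sum>f\<in>Basis. (x \<bullet> f) * (a * (H (p x) f \<bullet> e) + b * ((r + x) \<bullet> f) * (G (p x) \<bullet> e)))" .
    show ?thesis
      unfolding B'x unfolding B'_def by (simp only: right_diff_distrib mult.left_commute)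
  qed
  show ?thesis
    using sphere_unif_ibp[OF e dB bound] unfolding eq unfolding B_def p_def W_def .
qed

end

text \<open>Fubini in the single coordinate \<open>i\<close>: it is enough to compare the integrals
  over that spin with the others frozen.\<close>

lemma Pn_integral_eqI:
  fixes h h' :: "(nat \<Rightarrow> real ^ 'd) \<Rightarrow> real"
  assumes i: "i < n" and int: "integrable (Pn n) h" "integrable (Pn n) h'"
    and eq: "\<And>\<sigma>. (\<integral>x. h (\<sigma>(i := x)) \<partial>sphere_unif) = (\<integral>x. h' (\<sigma>(i := x)) \<partial>sphere_unif)"
  shows "(\<integral>\<sigma>. h \<sigma> \<partial>Pn n) = (\<integral>\<sigma>. h' \<sigma> \<partial>Pn n)"
proof -
  have ins: "{..<n} = insert i ({..<n} - {i})"
    using i by auto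
  have "(\<integral>\<sigma>. k \<sigma> \<partial>Pn n) = (\<integral>\<sigma>. (\<integral>x. k (\<sigma>(i := x)) \<partial>sphere_unif) \<partial>PiM ({..<n} - {i}) (\<lambda>_. sphere_unif))"
    if "integrable (Pn n) k" for k :: "(nat \<Rightarrow> real ^ 'd) \<Rightarrow> real"
    using spins.product_integral_insert[of "{..<n} - {i}" i k] that
    unfolding Pn_def ins[symmetric] by simp
  then show ?thesis
    using int eq by simp
qed

lemma gibbs_weight_pos: "gibbs_weight \<beta> n \<sigma> > 0"
  by (simp add: gibbs_weight_def)

lemma borel_measurable_gibbs_weight [measurable]: "gibbs_weight \<beta> n \<in> borel_measurable (Pn n)"
  unfolding gibbs_weight_eq by measurable

lemma gibbs_weight_le:
  assumes "0 \<le> \<beta>" "\<And>i. i < n \<Longrightarrow> norm (\<sigma> i) = 1"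
  shows "gibbs_weight \<beta> n \<sigma> \<le> exp (\<beta> * real n)"
proof (cases "n = 0")
  case False
  have "(norm (spin_sum n \<sigma>))\<^sup>2 \<le> (real n)\<^sup>2"
    using norm_spin_sum_le[OF assms(2)] by (intro power_mono) auto
  also have "\<dots> \<le> real n * (2 * real n)"
    by (simp add: power2_eq_square)
  finally have "(norm (spin_sum n \<sigma>))\<^sup>2 / (2 * real n) \<le> real n"
    using False by (simp add: divide_le_eq)
  from mult_left_mono[OF this assms(1)] show ?thesis
    by (simp only: gibbs_weight_eq exp_le_cancel_iff)
qed (simp add: gibbs_weight_eq)

context bounded_gradient
begin

text \<open>With all spins but \<open>i\<close> frozen the spin sum is \<open>r + x\<close>, which
  reduces the claim to the one-spin identity with \<open>b = \<beta> / n\<close>.\<close>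

lemma Pn_gibbs_ibp_term:
  fixes y :: "real ^ 'd"
  assumes e: "e \<in> Basis" and i: "i < n" and \<beta>: "0 \<le> \<beta>" and a: "0 \<le> a"
  defines "p \<equiv> \<lambda>\<sigma>. a *\<^sub>R spin_sum n \<sigma> + y"
  defines "k \<equiv> \<lambda>\<sigma>. gibbs_weight \<beta> n \<sigma> * ((\<sigma> i \<bullet> e) * (G (p \<sigma>) \<bullet> e))"
  defines "k' \<equiv> \<lambda>\<sigma>. gibbs_weight \<beta> n \<sigma> *
        ((a * (H (p \<sigma>) e \<bullet> e) + \<beta> / real n * (spin_sum n \<sigma> \<bullet> e) * (G (p \<sigma>) \<bullet> e))
       - (\<sigma> i \<bullet> e) * (\<Sum>f\<in>Basis. (\<sigma> i \<bullet> f) * (a * (H (p \<sigma>) f \<bullet> e) + \<beta> / real n * (spin_sum n \<sigma> \<bullet> f) * (G (p \<sigma>) \<bullet> e))))"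
  shows "integrable (Pn n) k" "integrable (Pn n) k'"
    "(real CARD('d) - 1) * (\<integral>\<sigma>. k \<sigma> \<partial>Pn n) = (\<integral>\<sigma>. k' \<sigma> \<partial>Pn n)"
proof -
  have [measurable]: "p \<in> borel_measurable (Pn n)"
    unfolding p_def by measurable
  have [measurable]: "(\<lambda>\<sigma>. \<sigma> i) \<in> borel_measurable (Pn n)"
    using i by (auto intro: measurable_component_singleton)
  have [measurable]: "(\<lambda>\<sigma>. H (p \<sigma>) f \<bullet> e') \<in> borel_measurable (Pn n)" for e' f
    by (rule measurable_compose[OF _ borel_measurable_H]) measurable
  show ik: "integrable (Pn n) k"
  proof (rule integrable_Pn)
    show "k \<in> borel_measurable (Pn n)"
      unfolding k_def by measurable
    fix \<sigma> :: "nat \<Rightarrow> real ^ 'd" assume \<sigma>: "\<And>i. i < n \<Longrightarrow> norm (\<sigma> i) = 1"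
    have "\<bar>\<sigma> i \<bullet> e\<bar> * \<bar>G (p \<sigma>) \<bullet> e\<bar> \<le> 1 * 1"
      using Basis_le_norm[OF e, of "\<sigma> i"] \<sigma>[OF i] abs_inner_G_le[OF e] by (intro mult_mono) auto
    then show "\<bar>k \<sigma>\<bar> \<le> exp (\<beta> * real n) * 1"
      unfolding k_def abs_mult using gibbs_weight_le[OF \<beta> \<sigma>] gibbs_weight_pos[of \<beta> n \<sigma>]
      by (intro mult_mono) auto
  qed
  show ik': "integrable (Pn n) k'"
  proof (rule integrable_Pn)
    show "k' \<in> borel_measurable (Pn n)"
      unfolding k'_def by measurable
    fix \<sigma> :: "nat \<Rightarrow> real ^ 'd" assume \<sigma>: "\<And>i. i < n \<Longrightarrow> norm (\<sigma> i) = 1"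
    define c where "c f = a * (H (p \<sigma>) f \<bullet> e) + \<beta> / real n * (spin_sum n \<sigma> \<bullet> f) * (G (p \<sigma>) \<bullet> e)" for f
    have c: "\<bar>c f\<bar> \<le> a + \<beta>" if f: "f \<in> Basis" for f
    proof -
      have S: "\<bar>spin_sum n \<sigma> \<bullet> f\<bar> \<le> real n"
        using Basis_le_norm[OF f, of "spin_sum n \<sigma>"] norm_spin_sum_le[of n \<sigma>, OF \<sigma>] by simp
      have "\<bar>a * (H (p \<sigma>) f \<bullet> e)\<bar> \<le> a * 1"
        unfolding abs_mult using abs_inner_H_le[OF e, of "p \<sigma>" f] a f by (intro mult_mono) auto
      moreover have "\<bar>\<beta> / real n * (spin_sum n \<sigma> \<bullet> f) * (G (p \<sigma>) \<bullet> e)\<bar> \<le> \<beta> / real n * real n * 1"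
        unfolding abs_mult using abs_inner_G_le[OF e] \<beta> S by (intro mult_mono) auto
      moreover have "\<beta> / real n * real n = \<beta>"
        using i by simp
      ultimately show ?thesis
        unfolding c_def by linarith
    qed
    have s: "\<bar>\<sigma> i \<bullet> f\<bar> \<le> 1" if "f \<in> Basis" for f
      using Basis_le_norm[OF that, of "\<sigma> i"] \<sigma>[OF i] by simp
    have "\<bar>\<Sum>f\<in>Basis. (\<sigma> i \<bullet> f) * c f\<bar> \<le> (\<Sum>f\<in>(Basis :: (real ^ 'd) set). 1 * (a + \<beta>))"
      by (intro order_trans[OF sum_abs] sum_mono, unfold abs_mult, intro mult_mono c s) auto
    then have "\<bar>\<sigma> i \<bullet> e\<bar> * \<bar>\<Sum>f\<in>Basis. (\<sigma> i \<bullet> f) * c f\<bar> \<le> 1 * (real CARD('d) * (a + \<beta>))"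
      using s[OF e] by (intro mult_mono) auto
    then have "\<bar>c e - (\<sigma> i \<bullet> e) * (\<Sum>f\<in>Basis. (\<sigma> i \<bullet> f) * c f)\<bar> \<le> (a + \<beta>) + real CARD('d) * (a + \<beta>)"
      using c[OF e] abs_triangle_ineq4[of "c e" "(\<sigma> i \<bullet> e) * (\<Sum>f\<in>Basis. (\<sigma> i \<bullet> f) * c f)"]
      unfolding abs_mult by linarith
    then have "\<bar>gibbs_weight \<beta> n \<sigma> * (c e - (\<sigma> i \<bullet> e) * (\<Sum>f\<in>Basis. (\<sigma> i \<bullet> f) * c f))\<bar>
        \<le> exp (\<beta> * real n) * ((a + \<beta>) + real CARD('d) * (a + \<beta>))"
      unfolding abs_mult[of "gibbs_weight \<beta> n \<sigma>"] using gibbs_weight_le[OF \<beta> \<sigma>] gibbs_weight_pos[of \<beta> n \<sigma>]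
      by (intro mult_mono) auto
    then show "\<bar>k' \<sigma>\<bar> \<le> exp (\<beta> * real n) * ((a + \<beta>) + real CARD('d) * (a + \<beta>))"
      by (simp add: k'_def c_def)
  qed
  have "(\<integral>\<sigma>. (real CARD('d) - 1) * k \<sigma> \<partial>Pn n) = (\<integral>\<sigma>. k' \<sigma> \<partial>Pn n)"
  proof (rule Pn_integral_eqI[OF i _ ik'])
    show "integrable (Pn n) (\<lambda>\<sigma>. (real CARD('d) - 1) * k \<sigma>)"
      using ik by simp
    fix \<sigma> :: "nat \<Rightarrow> real ^ 'd"
    define r where "r = (\<Sum>j\<in>{..<n} - {i}. \<sigma> j)"
    have S: "spin_sum n (\<sigma>(i := x)) = r + x" for x
      using i by (auto simp: spin_sum_def r_def sum.remove[of "{..<n}" i] add.commute)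
    have w: "gibbs_weight \<beta> n (\<sigma>(i := x)) = exp (\<beta> / real n * ((norm (r + x))\<^sup>2 / 2))" for x
      by (simp add: gibbs_weight_eq S mult.commute)
    have "(\<integral>x. (real CARD('d) - 1) * k (\<sigma>(i := x)) \<partial>sphere_unif)
        = (real CARD('d) - 1) * (\<integral>x. (x \<bullet> e) * ((G (a *\<^sub>R (r + x) + y) \<bullet> e) * exp (\<beta> / real n * ((norm (r + x))\<^sup>2 / 2))) \<partial>sphere_unif)"
      by (subst integral_mult_right_zero, intro arg_cong2[where f = "(*)"] refl Bochner_Integration.integral_cong)
        (simp add: k_def w S p_def mult_ac)
    also have "\<dots> = (\<integral>x. k' (\<sigma>(i := x)) \<partial>sphere_unif)"
      unfolding sphere_gibbs_ibp[OF e] k'_def w S p_def by simp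
    finally show "(\<integral>x. (real CARD('d) - 1) * k (\<sigma>(i := x)) \<partial>sphere_unif) = (\<integral>x. k' (\<sigma>(i := x)) \<partial>sphere_unif)" .
  qed
  then show "(real CARD('d) - 1) * (\<integral>\<sigma>. k \<sigma> \<partial>Pn n) = (\<integral>\<sigma>. k' \<sigma> \<partial>Pn n)"
    by simp
qed

end

section \<open>The normalised Gibbs measure\<close>

text \<open>The real value does not determine the dimension of the spins, so a type argument carries
  it.\<close>

definition partition_fun :: "real \<Rightarrow> nat \<Rightarrow> (real ^ 'd) itself \<Rightarrow> real" where
  "partition_fun \<beta> n _ = (\<integral>\<tau>. gibbs_weight \<beta> n \<tau> \<partial>(Pn n :: (nat \<Rightarrow> real ^ 'd) measure))"

lemma integrable_gibbs_weight:
  assumes "0 \<le> \<beta>"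
  shows "integrable (Pn n :: (nat \<Rightarrow> real ^ 'd) measure) (gibbs_weight \<beta> n)"
  by (rule integrable_Pn[where K = "exp (\<beta> * real n)"])
    (use gibbs_weight_le[OF assms] in \<open>auto simp: abs_of_pos gibbs_weight_pos\<close>)

text \<open>The exponent is a nonnegative multiple of \<open>|S|^2\<close>, so the weight itself is
  at least 1.\<close>

lemma partition_fun_ge_1:
  assumes "0 \<le> \<beta>"
  shows "partition_fun \<beta> n TYPE(real ^ 'd) \<ge> 1"
proof -
  interpret prob_space "Pn n :: (nat \<Rightarrow> real ^ 'd) measure"
    by (rule prob_space_Pn)
  have "1 = (\<integral>\<sigma>. (1::real) \<partial>(Pn n :: (nat \<Rightarrow> real ^ 'd) measure))"
    by (simp add: prob_space)
  also have "\<dots> \<le> partition_fun \<beta> n TYPE(real ^ 'd)"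
    unfolding partition_fun_def
    by (rule integral_mono[OF _ integrable_gibbs_weight[OF assms]]) (use assms in \<open>auto simp: gibbs_weight_eq\<close>)
  finally show ?thesis .
qed

lemma sets_gibbs [simp, measurable_cong]: "sets (gibbs \<beta> n) = sets (PiM {..<n} (\<lambda>_. borel))"
  by (simp add: gibbs_def)

lemma gibbs_eq:
  "(gibbs \<beta> n :: (nat \<Rightarrow> real ^ 'd) measure)
    = density (Pn n) (\<lambda>\<sigma>. ennreal (gibbs_weight \<beta> n \<sigma> / partition_fun \<beta> n TYPE(real ^ 'd)))"
  by (simp add: gibbs_def partition_fun_def)

lemma borel_measurable_gibbs_iff: "borel_measurable (gibbs \<beta> n) = borel_measurable (Pn n)"
  by (intro measurable_cong_sets) auto

lemma integral_gibbs:
  fixes h :: "(nat \<Rightarrow> real ^ 'd) \<Rightarrow> real"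
  assumes "0 \<le> \<beta>" "h \<in> borel_measurable (Pn n)"
  shows "(\<integral>\<sigma>. h \<sigma> \<partial>gibbs \<beta> n) = (\<integral>\<sigma>. gibbs_weight \<beta> n \<sigma> * h \<sigma> \<partial>Pn n) / partition_fun \<beta> n TYPE(real ^ 'd)"
  unfolding gibbs_eq using assms partition_fun_ge_1[OF assms(1), of n, where 'd = 'd]
  by (subst integral_density) (auto simp: less_imp_le gibbs_weight_pos)

lemma prob_space_gibbs:
  assumes "0 \<le> \<beta>"
  shows "prob_space (gibbs \<beta> n :: (nat \<Rightarrow> real ^ 'd) measure)"
proof (rule prob_spaceI)
  define Z where "Z = partition_fun \<beta> n TYPE(real ^ 'd)"
  have Z: "Z \<ge> 1"
    using partition_fun_ge_1[OF assms] by (simp add: Z_def)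
  have "emeasure (gibbs \<beta> n :: (nat \<Rightarrow> real ^ 'd) measure) (space (gibbs \<beta> n)) = (\<integral>\<^sup>+\<sigma>. ennreal (gibbs_weight \<beta> n \<sigma> / Z) \<partial>(Pn n :: (nat \<Rightarrow> real ^ 'd) measure))"
    unfolding gibbs_eq Z_def by (subst emeasure_density) (auto simp del: sets_Pn intro!: nn_integral_cong)
  also have "\<dots> = ennreal (\<integral>\<sigma>. gibbs_weight \<beta> n \<sigma> / Z \<partial>(Pn n :: (nat \<Rightarrow> real ^ 'd) measure))"
    using Z integrable_gibbs_weight[OF assms]
    by (intro nn_integral_eq_integral) (auto simp: less_imp_le gibbs_weight_pos)
  also have "(\<integral>\<sigma>. gibbs_weight \<beta> n \<sigma> / Z \<partial>(Pn n :: (nat \<Rightarrow> real ^ 'd) measure)) = 1"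
    using Z by (simp add: Z_def partition_fun_def)
  finally show "emeasure (gibbs \<beta> n :: (nat \<Rightarrow> real ^ 'd) measure) (space (gibbs \<beta> n)) = 1"
    by simp
qed

lemma AE_gibbs_norm: "AE \<sigma> in (gibbs \<beta> n :: (nat \<Rightarrow> real ^ 'd) measure). \<forall>i<n. norm (\<sigma> i) = 1"
  unfolding gibbs_eq by (subst AE_density) (simp_all add: eventually_mono[OF AE_Pn_norm])

lemma sum_inner_prod_eq_cov_fluct:
  fixes \<sigma> :: "nat \<Rightarrow> real ^ 'd"
  assumes "n \<ge> 1"
  shows "(\<Sum>i<n. (\<sigma> i \<bullet> e) * (\<sigma> i \<bullet> f)) = sqrt (real n) * cov_fluct e f n \<sigma> + real n * (e \<bullet> f) / real CARD('d)"
  using assms by (simp add: cov_fluct_def sum_subtractf)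

context bounded_gradient
begin

text \<open>Sum the one-spin identities over spins and coordinates. The isotropic part
  \<open>n / N\<close> of the sum of
  \<open>(\<sigma> i \<bullet> e) * (\<sigma> i \<bullet> f)\<close> produces the factor
  \<open>1 - 1 / N\<close>; the deviation from it is collected in \<open>E\<close>.\<close>

lemma Pn_gibbs_ibp:
  fixes y :: "real ^ 'd"
  assumes n: "n \<ge> 1" and \<beta>: "0 \<le> \<beta>" and a: "0 \<le> a"
  defines "p \<equiv> \<lambda>\<sigma>. a *\<^sub>R spin_sum n \<sigma> + y"
  defines "E \<equiv> \<lambda>\<sigma>. \<Sum>e\<in>Basis. \<Sum>f\<in>Basis. cov_fluct e f n \<sigma> *
      (sqrt (real n) * a * (H (p \<sigma>) f \<bullet> e) + \<beta> / sqrt (real n) * (spin_sum n \<sigma> \<bullet> f) * (G (p \<sigma>) \<bullet> e))"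
  shows "(real CARD('d) - 1) * (\<integral>\<sigma>. gibbs_weight \<beta> n \<sigma> * (spin_sum n \<sigma> \<bullet> G (p \<sigma>)) \<partial>Pn n)
    = (\<integral>\<sigma>. gibbs_weight \<beta> n \<sigma> *
        ((1 - 1 / real CARD('d)) * (real n * a * (\<Sum>e\<in>Basis. H (p \<sigma>) e \<bullet> e) + \<beta> * (spin_sum n \<sigma> \<bullet> G (p \<sigma>))) - E \<sigma>) \<partial>Pn n)"
proof -
  define N where "N = real CARD('d)"
  define c where "c e f \<sigma> = a * (H (p \<sigma>) f \<bullet> e) + \<beta> / real n * (spin_sum n \<sigma> \<bullet> f) * (G (p \<sigma>) \<bullet> e)" for e f \<sigma>
  define k where "k i e \<sigma> = gibbs_weight \<beta> n \<sigma> * ((\<sigma> i \<bullet> e) * (G (p \<sigma>) \<bullet> e))" for i e \<sigma>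
  define k' where "k' i e \<sigma> = gibbs_weight \<beta> n \<sigma> * (c e e \<sigma> - (\<sigma> i \<bullet> e) * (\<Sum>f\<in>Basis. (\<sigma> i \<bullet> f) * c e f \<sigma>))" for i e \<sigma>
  have kk: "integrable (Pn n) (k i e)" "integrable (Pn n) (k' i e)" "(N - 1) * (\<integral>\<sigma>. k i e \<sigma> \<partial>Pn n) = (\<integral>\<sigma>. k' i e \<sigma> \<partial>Pn n)"
    if "i < n" "e \<in> Basis" for i e
    using Pn_gibbs_ibp_term[OF that(2,1) \<beta> a, of y] unfolding k_def k'_def c_def p_def N_def by auto
  have sum_k: "(\<Sum>i<n. \<Sum>e\<in>Basis. k i e \<sigma>) = gibbs_weight \<beta> n \<sigma> * (spin_sum n \<sigma> \<bullet> G (p \<sigma>))" for \<sigma>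
    by (simp add: k_def sum_distrib_left[symmetric] euclidean_inner[symmetric] inner_sum_left spin_sum_def)
  have sum_k': "(\<Sum>i<n. \<Sum>e\<in>Basis. k' i e \<sigma>) = gibbs_weight \<beta> n \<sigma> *
      ((1 - 1 / N) * (real n * a * (\<Sum>e\<in>Basis. H (p \<sigma>) e \<bullet> e) + \<beta> * (spin_sum n \<sigma> \<bullet> G (p \<sigma>))) - E \<sigma>)" for \<sigma>
  proof -
    have bn: "real n * c e f \<sigma> = real n * a * (H (p \<sigma>) f \<bullet> e) + \<beta> * ((spin_sum n \<sigma> \<bullet> f) * (G (p \<sigma>) \<bullet> e))" for e f
      using n by (simp add: c_def field_simps)
    \<comment> \<open>Each fluctuation comes with a factor \<open>sqrt n\<close>; distributed over
      \<open>c\<close> it gives the coefficients of \<open>E\<close>, which stay of order 1 when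
      \<open>a\<close> is of order \<open>1 / sqrt n\<close> and \<open>S\<close> of order
      \<open>sqrt n\<close>.\<close>
    have sn: "sqrt (real n) * c e f \<sigma> = sqrt (real n) * a * (H (p \<sigma>) f \<bullet> e) + \<beta> / sqrt (real n) * (spin_sum n \<sigma> \<bullet> f) * (G (p \<sigma>) \<bullet> e)" for e f
    proof -
      have *: "sqrt (real n) * (\<beta> / real n) = \<beta> / sqrt (real n)"
        using n by (simp add: field_simps)
      show ?thesis
        by (simp only: c_def distrib_left mult.assoc[symmetric] *)
    qed
    have e: "(\<Sum>i<n. c e e \<sigma> - (\<sigma> i \<bullet> e) * (\<Sum>f\<in>Basis. (\<sigma> i \<bullet> f) * c e f \<sigma>))
        = (1 - 1 / N) * (real n * c e e \<sigma>) - (\<Sum>f\<in>Basis. cov_fluct e f n \<sigma> * (sqrt (real n) * c e f \<sigma>))"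
      if e: "e \<in> Basis" for e
    proof -
      have "(\<Sum>i<n. (\<sigma> i \<bullet> e) * (\<Sum>f\<in>Basis. (\<sigma> i \<bullet> f) * c e f \<sigma>)) = (\<Sum>f\<in>Basis. (\<Sum>i<n. (\<sigma> i \<bullet> e) * (\<sigma> i \<bullet> f)) * c e f \<sigma>)"
        unfolding sum_distrib_left sum_distrib_right by (subst sum.swap) (simp add: mult.assoc)
      also have "\<dots> = (\<Sum>f\<in>Basis. cov_fluct e f n \<sigma> * (sqrt (real n) * c e f \<sigma>) + (if f = e then real n * c e e \<sigma> / N else 0))"
        using e by (intro sum.cong refl, subst sum_inner_prod_eq_cov_fluct[OF n]) (auto simp: inner_Basis N_def algebra_simps)
      also have "\<dots> = (\<Sum>f\<in>Basis. cov_fluct e f n \<sigma> * (sqrt (real n) * c e f \<sigma>)) + real n * c e e \<sigma> / N"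
        using e by (simp add: sum.distrib)
      finally show ?thesis
        by (simp add: sum_subtractf algebra_simps)
    qed
    have "(\<Sum>i<n. \<Sum>e\<in>Basis. k' i e \<sigma>) = gibbs_weight \<beta> n \<sigma> *
        (\<Sum>e\<in>Basis. \<Sum>i<n. c e e \<sigma> - (\<sigma> i \<bullet> e) * (\<Sum>f\<in>Basis. (\<sigma> i \<bullet> f) * c e f \<sigma>))"
      unfolding k'_def by (subst sum.swap) (simp add: sum_distrib_left)
    also have "(\<Sum>e\<in>Basis. \<Sum>i<n. c e e \<sigma> - (\<sigma> i \<bullet> e) * (\<Sum>f\<in>Basis. (\<sigma> i \<bullet> f) * c e f \<sigma>))
        = (\<Sum>e\<in>Basis. (1 - 1 / N) * (real n * c e e \<sigma>)) - E \<sigma>"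
      unfolding E_def sn[symmetric] sum_subtractf[symmetric] by (intro sum.cong refl e)
    also have "(\<Sum>e\<in>Basis. (1 - 1 / N) * (real n * c e e \<sigma>))
        = (1 - 1 / N) * (real n * a * (\<Sum>e\<in>Basis. H (p \<sigma>) e \<bullet> e) + \<beta> * (spin_sum n \<sigma> \<bullet> G (p \<sigma>)))"
      unfolding bn by (simp add: sum_distrib_left[symmetric] sum.distrib euclidean_inner[of "spin_sum n \<sigma>" "G (p \<sigma>)"])
    finally show ?thesis .
  qed
  have "(N - 1) * (\<integral>\<sigma>. gibbs_weight \<beta> n \<sigma> * (spin_sum n \<sigma> \<bullet> G (p \<sigma>)) \<partial>Pn n)
      = (N - 1) * (\<Sum>i<n. \<Sum>e\<in>Basis. \<integral>\<sigma>. k i e \<sigma> \<partial>Pn n)"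
    unfolding sum_k[symmetric] using kk
    by (subst Bochner_Integration.integral_sum, force, intro arg_cong2[where f = "(*)"] refl sum.cong, subst Bochner_Integration.integral_sum) auto
  also have "\<dots> = (\<Sum>i<n. \<Sum>e\<in>Basis. \<integral>\<sigma>. k' i e \<sigma> \<partial>Pn n)"
    unfolding sum_distrib_left using kk by (intro sum.cong refl) auto
  also have "\<dots> = (\<integral>\<sigma>. (\<Sum>i<n. \<Sum>e\<in>Basis. k' i e \<sigma>) \<partial>Pn n)"
    using kk by (subst Bochner_Integration.integral_sum, force, intro sum.cong refl, subst Bochner_Integration.integral_sum) auto
  finally show ?thesis
    unfolding sum_k' unfolding N_def .
qed

end

lemma Wn_eq: "Wn \<beta> n \<sigma> = sqrt ((real CARD('d) - \<beta>) / real n) *\<^sub>R spin_sum n \<sigma>"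
  for \<sigma> :: "nat \<Rightarrow> real ^ 'd"
  by (simp add: Wn_def spin_sum_def)

text \<open>The constant is fixed before \<open>n\<close>, \<open>G\<close>, \<open>H\<close>,
  \<open>q\<close> and \<open>y\<close>, which gives uniformity over test functions and along the
  whole interpolation path.\<close>

lemma gibbs_stein_bound:
  assumes N: "CARD('d::finite) \<ge> 2" and \<beta>: "0 \<le> \<beta>" "\<beta> < real CARD('d)"
  obtains K where "\<And>n G H q y. n \<ge> 1 \<Longrightarrow> bounded_gradient G H \<Longrightarrow> 0 \<le> q \<Longrightarrow> q \<le> 1 \<Longrightarrow>
    \<bar>(\<integral>\<sigma>. Wn \<beta> n \<sigma> \<bullet> G (q *\<^sub>R Wn \<beta> n \<sigma> + y) \<partial>gibbs \<beta> n)
      - q * (\<integral>\<sigma>. (\<Sum>e\<in>Basis. H (q *\<^sub>R Wn \<beta> n \<sigma> + y) e \<bullet> e) \<partial>(gibbs \<beta> n :: (nat \<Rightarrow> real ^ 'd) measure))\<bar>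
    \<le> K / sqrt (real n)"
proof -
  obtain K where K: "K \<ge> 0"
    "\<And>n. n \<ge> 1 \<Longrightarrow> (\<integral>\<sigma>. gibbs_weight \<beta> n \<sigma> * ((norm (spin_sum n \<sigma>))\<^sup>2 / real n) \<partial>(Pn n :: (nat \<Rightarrow> real ^ 'd) measure)) \<le> K"
    "\<And>n e f. n \<ge> 1 \<Longrightarrow> e \<in> Basis \<Longrightarrow> f \<in> Basis \<Longrightarrow>
      (\<integral>\<sigma>. gibbs_weight \<beta> n \<sigma> * (cov_fluct e f n \<sigma>)\<^sup>2 \<partial>(Pn n :: (nat \<Rightarrow> real ^ 'd) measure)) \<le> K"
    using gibbs_moment_bounds[OF assms] by blast
  define N where "N = real CARD('d)"
  have N2: "N \<ge> 2" "N - \<beta> > 0"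
    using N \<beta> by (auto simp: N_def)
  define A where "A = sqrt (N - \<beta>)"
  have A: "A > 0" "A\<^sup>2 = N - \<beta>"
    using N2 by (auto simp: A_def)
  \<comment> \<open>Bounds the error integral in units of the partition function: \<open>N^2\<close>
    index pairs, each contributing \<open>A + (A + \<beta>) K + \<beta> K\<close>.\<close>
  define L where "L = N * (N * (A + (A + 2 * \<beta>) * K))"
  \<comment> \<open>The prefactor \<open>s N / ((N - 1) (N - \<beta>))\<close> with
    \<open>s = A / sqrt n\<close> and \<open>A^2 = N - \<beta>\<close>.\<close>
  define K' where "K' = N / ((N - 1) * A) * L"
  show ?thesis
  proof (rule that[of K'])
    fix n :: nat and G :: "real ^ 'd \<Rightarrow> real ^ 'd" and H and q :: real and y :: "real ^ 'd"
    assume n: "n \<ge> 1" and bg: "bounded_gradient G H" and q: "0 \<le> q" "q \<le> 1"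
    interpret bounded_gradient G H
      by (rule bg)
    define w where "w = (gibbs_weight \<beta> n :: (nat \<Rightarrow> real ^ 'd) \<Rightarrow> real)"
    define Z where "Z = partition_fun \<beta> n TYPE(real ^ 'd)"
    have Z: "Z \<ge> 1"
      unfolding Z_def by (rule partition_fun_ge_1[OF \<beta>(1)])
    have w0: "w \<sigma> \<ge> 0" for \<sigma>
      by (simp add: w_def less_imp_le gibbs_weight_pos)
    have [measurable]: "w \<in> borel_measurable (Pn n)"
      by (simp add: w_def)
    have wle: "\<bar>w \<sigma>\<bar> \<le> exp (\<beta> * real n)" if "\<And>i. i < n \<Longrightarrow> norm (\<sigma> i) = 1" for \<sigma>
      using gibbs_weight_le[OF \<beta>(1) that] w0[of \<sigma>] by (simp add: w_def)
    define s where "s = sqrt ((N - \<beta>) / real n)"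
    have s: "s = A / sqrt (real n)" "s \<ge> 0"
      using N2 by (auto simp: s_def A_def real_sqrt_divide)
    define a where "a = q * s"
    have a: "a \<ge> 0" "sqrt (real n) * a \<le> A"
      using q s A n by (auto simp: a_def mult_left_le_one_le)
    define p where "p \<sigma> = a *\<^sub>R spin_sum n \<sigma> + y" for \<sigma>
    have pW: "q *\<^sub>R Wn \<beta> n \<sigma> + y = p \<sigma>" for \<sigma>
      by (simp add: p_def a_def Wn_eq s_def N_def)
    have WG: "Wn \<beta> n \<sigma> \<bullet> G (q *\<^sub>R Wn \<beta> n \<sigma> + y) = s * (spin_sum n \<sigma> \<bullet> G (p \<sigma>))" for \<sigma>
      unfolding pW by (simp add: Wn_eq s_def N_def)
    have [measurable]: "p \<in> borel_measurable (Pn n)"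
      unfolding p_def by measurable
    have [measurable]: "(\<lambda>\<sigma>. H (p \<sigma>) f \<bullet> e) \<in> borel_measurable (Pn n)" for e f
      by (rule measurable_compose[OF _ borel_measurable_H]) measurable
    define E where "E \<sigma> = (\<Sum>e\<in>Basis. \<Sum>f\<in>Basis. cov_fluct e f n \<sigma> *
      (sqrt (real n) * a * (H (p \<sigma>) f \<bullet> e) + \<beta> / sqrt (real n) * (spin_sum n \<sigma> \<bullet> f) * (G (p \<sigma>) \<bullet> e)))" for \<sigma>
    define tr where "tr \<sigma> = (\<Sum>e\<in>Basis. H (p \<sigma>) e \<bullet> e)" for \<sigma>
    define S2 where "S2 \<sigma> = (norm (spin_sum n \<sigma>))\<^sup>2 / real n" for \<sigma> :: "nat \<Rightarrow> real ^ 'd"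
    define M where "M \<sigma> = (\<Sum>e\<in>Basis. \<Sum>f\<in>Basis. A * w \<sigma> + (A + \<beta>) * (w \<sigma> * (cov_fluct e f n \<sigma>)\<^sup>2)
        + \<beta> * (w \<sigma> * S2 \<sigma>))" for \<sigma>
    have iw: "integrable (Pn n) w"
      unfolding w_def by (rule integrable_gibbs_weight[OF \<beta>(1)])
    have iF: "integrable (Pn n) (\<lambda>\<sigma>. w \<sigma> * (cov_fluct e f n \<sigma>)\<^sup>2)" if "e \<in> Basis" "f \<in> Basis" for e f
    proof (rule integrable_Pn)
      fix \<sigma> :: "nat \<Rightarrow> real ^ 'd" assume \<sigma>: "\<And>i. i < n \<Longrightarrow> norm (\<sigma> i) = 1"
      have "\<bar>cov_fluct e f n \<sigma>\<bar>\<^sup>2 \<le> (2 * real n)\<^sup>2"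
        by (intro power_mono abs_cov_fluct_le that \<sigma>) auto
      then show "\<bar>w \<sigma> * (cov_fluct e f n \<sigma>)\<^sup>2\<bar> \<le> exp (\<beta> * real n) * (2 * real n)\<^sup>2"
        unfolding abs_mult by (intro mult_mono wle \<sigma>) auto
    qed measurable
    have iS: "integrable (Pn n) (\<lambda>\<sigma>. w \<sigma> * S2 \<sigma>)"
      unfolding S2_def
    proof (rule integrable_Pn)
      fix \<sigma> :: "nat \<Rightarrow> real ^ 'd" assume \<sigma>: "\<And>i. i < n \<Longrightarrow> norm (\<sigma> i) = 1"
      have "(norm (spin_sum n \<sigma>))\<^sup>2 \<le> (real n)\<^sup>2"
        by (intro power_mono norm_spin_sum_le \<sigma>) auto
      then have "\<bar>(norm (spin_sum n \<sigma>))\<^sup>2 / real n\<bar> \<le> (real n)\<^sup>2 / real n"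
        by (simp add: divide_right_mono)
      then show "\<bar>w \<sigma> * ((norm (spin_sum n \<sigma>))\<^sup>2 / real n)\<bar> \<le> exp (\<beta> * real n) * ((real n)\<^sup>2 / real n)"
        unfolding abs_mult by (intro mult_mono wle \<sigma>) auto
    qed measurable
    have iG: "integrable (Pn n) (\<lambda>\<sigma>. w \<sigma> * (spin_sum n \<sigma> \<bullet> G (p \<sigma>)))"
    proof (rule integrable_Pn)
      fix \<sigma> :: "nat \<Rightarrow> real ^ 'd" assume \<sigma>: "\<And>i. i < n \<Longrightarrow> norm (\<sigma> i) = 1"
      have "\<bar>spin_sum n \<sigma> \<bullet> G (p \<sigma>)\<bar> \<le> real n * 1"
        by (rule order_trans[OF Cauchy_Schwarz_ineq2], intro mult_mono norm_spin_sum_le \<sigma> norm_G) auto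
      then show "\<bar>w \<sigma> * (spin_sum n \<sigma> \<bullet> G (p \<sigma>))\<bar> \<le> exp (\<beta> * real n) * (real n * 1)"
        unfolding abs_mult by (intro mult_mono wle \<sigma>) auto
    qed measurable
    have iT: "integrable (Pn n) (\<lambda>\<sigma>. w \<sigma> * tr \<sigma>)"
    proof (rule integrable_Pn)
      show "(\<lambda>\<sigma>. w \<sigma> * tr \<sigma>) \<in> borel_measurable (Pn n)"
        unfolding tr_def by measurable
      fix \<sigma> :: "nat \<Rightarrow> real ^ 'd" assume \<sigma>: "\<And>i. i < n \<Longrightarrow> norm (\<sigma> i) = 1"
      have "\<bar>tr \<sigma>\<bar> \<le> (\<Sum>e\<in>(Basis :: (real ^ 'd) set). norm e)"
        unfolding tr_def by (intro order_trans[OF sum_abs] sum_mono abs_inner_H_le)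
      then show "\<bar>w \<sigma> * tr \<sigma>\<bar> \<le> exp (\<beta> * real n) * (\<Sum>e\<in>(Basis :: (real ^ 'd) set). norm e)"
        unfolding abs_mult by (intro mult_mono wle \<sigma>) auto
    qed
    have iM: "integrable (Pn n) M"
      unfolding M_def
      by (intro Bochner_Integration.integrable_sum Bochner_Integration.integrable_add integrable_mult_right iw iF iS)
    have E_le: "\<bar>w \<sigma> * E \<sigma>\<bar> \<le> M \<sigma>" for \<sigma>
    proof -
      have *: "\<bar>cov_fluct e f n \<sigma> * (sqrt (real n) * a * (H (p \<sigma>) f \<bullet> e)
            + \<beta> / sqrt (real n) * (spin_sum n \<sigma> \<bullet> f) * (G (p \<sigma>) \<bullet> e))\<bar>
          \<le> A + (A + \<beta>) * (cov_fluct e f n \<sigma>)\<^sup>2 + \<beta> * ((norm (spin_sum n \<sigma>))\<^sup>2 / real n)"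
        if ef: "e \<in> Basis" "f \<in> Basis" for e f
      proof -
        define d where "d = \<bar>cov_fluct e f n \<sigma>\<bar>"
        define u where "u = norm (spin_sum n \<sigma>) / sqrt (real n)"
        have u2: "u\<^sup>2 = (norm (spin_sum n \<sigma>))\<^sup>2 / real n"
          by (simp add: u_def power_divide)
        have "\<bar>sqrt (real n) * a * (H (p \<sigma>) f \<bullet> e)\<bar> \<le> A * 1"
          unfolding abs_mult[of "sqrt (real n) * a"] using a A abs_inner_H_le[OF ef(1), of "p \<sigma>" f] ef
          by (intro mult_mono) auto
        moreover have "\<bar>\<beta> / sqrt (real n) * (spin_sum n \<sigma> \<bullet> f) * (G (p \<sigma>) \<bullet> e)\<bar>
            \<le> \<beta> / sqrt (real n) * norm (spin_sum n \<sigma>) * 1"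
          unfolding abs_mult using \<beta> abs_inner_G_le[OF ef(1)] Basis_le_norm[OF ef(2)] by (intro mult_mono) auto
        moreover have "\<beta> / sqrt (real n) * norm (spin_sum n \<sigma>) * 1 = \<beta> * u"
          by (simp add: u_def)
        ultimately have "\<bar>sqrt (real n) * a * (H (p \<sigma>) f \<bullet> e) + \<beta> / sqrt (real n) * (spin_sum n \<sigma> \<bullet> f) * (G (p \<sigma>) \<bullet> e)\<bar> \<le> A + \<beta> * u"
          by linarith
        then have "\<bar>cov_fluct e f n \<sigma> * (sqrt (real n) * a * (H (p \<sigma>) f \<bullet> e)
            + \<beta> / sqrt (real n) * (spin_sum n \<sigma> \<bullet> f) * (G (p \<sigma>) \<bullet> e))\<bar> \<le> d * (A + \<beta> * u)"
          unfolding abs_mult[of "cov_fluct e f n \<sigma>"] d_def by (intro mult_left_mono) auto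
        also have "\<dots> = A * d + \<beta> * (d * u)"
          by (simp add: algebra_simps)
        \<comment> \<open>Decouples the covariance fluctuation from the spin sum, so that the two
          second moments of \<open>gibbs_moment_bounds\<close> suffice.\<close>
        also have "\<dots> \<le> A * (1 + d\<^sup>2) + \<beta> * (d\<^sup>2 + u\<^sup>2)"
        proof (intro add_mono mult_left_mono)
          have "0 \<le> (d - 1)\<^sup>2" "0 \<le> d"
            by (auto simp: d_def)
          then show "d \<le> 1 + d\<^sup>2"
            by (simp add: power2_eq_square algebra_simps)
          have "0 \<le> (d - u)\<^sup>2" "0 \<le> d * u"
            by (auto simp: d_def u_def)
          then show "d * u \<le> d\<^sup>2 + u\<^sup>2"
            by (simp add: power2_eq_square algebra_simps)
        qed (use A \<beta> in auto)
        also have "\<dots> = A + (A + \<beta>) * (cov_fluct e f n \<sigma>)\<^sup>2 + \<beta> * ((norm (spin_sum n \<sigma>))\<^sup>2 / real n)"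
          unfolding u2 d_def by (simp add: algebra_simps)
        finally show ?thesis .
      qed
      have "\<bar>w \<sigma> * E \<sigma>\<bar> = w \<sigma> * \<bar>E \<sigma>\<bar>"
        using w0[of \<sigma>] by (simp add: abs_mult)
      also have "\<dots> \<le> w \<sigma> * (\<Sum>e\<in>Basis. \<Sum>f\<in>Basis. A + (A + \<beta>) * (cov_fluct e f n \<sigma>)\<^sup>2 + \<beta> * ((norm (spin_sum n \<sigma>))\<^sup>2 / real n))"
        unfolding E_def by (intro mult_left_mono order_trans[OF sum_abs] sum_mono * w0)
      also have "\<dots> = M \<sigma>"
        unfolding M_def S2_def[symmetric] sum_distrib_left by (intro sum.cong refl) (simp add: algebra_simps)
      finally show ?thesis .
    qed
    have iE: "integrable (Pn n) (\<lambda>\<sigma>. w \<sigma> * E \<sigma>)"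
    proof (rule Bochner_Integration.integrable_bound[OF iM])
      show "(\<lambda>\<sigma>. w \<sigma> * E \<sigma>) \<in> borel_measurable (Pn n)"
        unfolding E_def by measurable
      show "AE \<sigma> in Pn n. norm (w \<sigma> * E \<sigma>) \<le> norm (M \<sigma>)"
        unfolding real_norm_def by (intro AE_I2 order_trans[OF E_le abs_ge_self])
    qed
    define IG IT IE where "IG = (\<integral>\<sigma>. w \<sigma> * (spin_sum n \<sigma> \<bullet> G (p \<sigma>)) \<partial>Pn n)"
      and "IT = (\<integral>\<sigma>. w \<sigma> * tr \<sigma> \<partial>Pn n)" and "IE = (\<integral>\<sigma>. w \<sigma> * E \<sigma> \<partial>Pn n)"
    have "\<bar>IE\<bar> \<le> (\<integral>\<sigma>. M \<sigma> \<partial>Pn n)"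
      unfolding IE_def using integral_abs_bound[of "Pn n" "\<lambda>\<sigma>. w \<sigma> * E \<sigma>"] integral_mono[OF integrable_abs[OF iE] iM E_le]
      by linarith
    also have "\<dots> = (\<Sum>e\<in>Basis. \<Sum>f\<in>Basis. A * Z + (A + \<beta>) * (\<integral>\<sigma>. w \<sigma> * (cov_fluct e f n \<sigma>)\<^sup>2 \<partial>Pn n)
        + \<beta> * (\<integral>\<sigma>. w \<sigma> * S2 \<sigma> \<partial>Pn n))"
      unfolding M_def
      using iw iF iS by (subst Bochner_Integration.integral_sum, force, intro sum.cong refl, subst Bochner_Integration.integral_sum)
        (auto simp: Z_def partition_fun_def w_def[symmetric])
    also have "\<dots> \<le> (\<Sum>e\<in>(Basis :: (real ^ 'd) set). \<Sum>f\<in>(Basis :: (real ^ 'd) set). A * Z + (A + \<beta>) * (K * Z) + \<beta> * (K * Z))"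
    proof (intro sum_mono add_mono mult_left_mono order_refl)
      \<comment> \<open>Enlarging the bounds by \<open>Z\<close> makes the estimate homogeneous, so
        that \<open>Z\<close> cancels in the Gibbs averages.\<close>
      have KZ: "K \<le> K * Z"
        using K(1) Z by (simp add: mult_le_cancel_left1)
      show "(\<integral>\<sigma>. w \<sigma> * (cov_fluct e f n \<sigma>)\<^sup>2 \<partial>Pn n) \<le> K * Z" if "e \<in> Basis" "f \<in> Basis" for e f
        using K(3)[OF n that] KZ by (simp add: w_def)
      show "(\<integral>\<sigma>. w \<sigma> * S2 \<sigma> \<partial>Pn n) \<le> K * Z"
        using K(2)[OF n] KZ by (simp add: w_def S2_def)
    qed (use A \<beta> in auto)
    also have "\<dots> = L * Z"
      by (simp add: L_def N_def algebra_simps)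
    finally have IE: "\<bar>IE\<bar> \<le> L * Z" .
    have "(N - 1) * IG = (\<integral>\<sigma>. w \<sigma> * ((1 - 1 / N) * (real n * a * tr \<sigma> + \<beta> * (spin_sum n \<sigma> \<bullet> G (p \<sigma>))) - E \<sigma>) \<partial>Pn n)"
      using Pn_gibbs_ibp[OF n \<beta>(1) a(1), of y] unfolding IG_def w_def p_def tr_def E_def N_def .
    also have "\<dots> = (\<integral>\<sigma>. ((1 - 1 / N) * (real n * a)) * (w \<sigma> * tr \<sigma>) + ((1 - 1 / N) * \<beta>) * (w \<sigma> * (spin_sum n \<sigma> \<bullet> G (p \<sigma>))) - w \<sigma> * E \<sigma> \<partial>Pn n)"
      by (intro Bochner_Integration.integral_cong refl) (simp add: algebra_simps)
    also have "\<dots> = ((1 - 1 / N) * (real n * a)) * IT + ((1 - 1 / N) * \<beta>) * IG - IE"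
      unfolding IT_def IG_def IE_def using iG iT iE by simp
    finally have id: "(N - 1) * IG = ((1 - 1 / N) * (real n * a)) * IT + ((1 - 1 / N) * \<beta>) * IG - IE" .
    \<comment> \<open>Here the scale of \<open>Wn\<close> enters, through
      \<open>n s^2 = N - \<beta>\<close>.\<close>
    have sa: "real n * (s * a) = q * (N - \<beta>)"
      using n N2 by (simp add: a_def s_def)
    have eq: "((N - 1) * (N - \<beta>)) * (s * IG - q * IT) = - (s * N * IE)"
    proof -
      \<comment> \<open>The term with \<open>\<beta>\<close>, produced by differentiating the
        weight, goes to the left and turns \<open>N\<close> into \<open>N - \<beta>\<close>.\<close>
      have "N * ((N - 1) * IG) = (N - 1) * (real n * a) * IT + (N - 1) * \<beta> * IG - N * IE"
        using N2 by (subst id) (simp add: field_simps)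
      then have *: "(N - 1) * (N - \<beta>) * IG = (N - 1) * (real n * a) * IT - N * IE"
        by (simp add: algebra_simps)
      have "s * ((N - 1) * (N - \<beta>) * IG) = (N - 1) * (real n * (s * a)) * IT - s * N * IE"
        unfolding * by (simp add: algebra_simps)
      then show ?thesis
        unfolding sa by (simp add: algebra_simps)
    qed
    have "(N - 1) * (N - \<beta>) \<noteq> 0"
      using N2 by simp
    with eq have "s * IG - q * IT = - (s * N * IE) / ((N - 1) * (N - \<beta>))"
      by (metis nonzero_mult_div_cancel_left)
    then have "\<bar>s * IG - q * IT\<bar> = s * N / ((N - 1) * (N - \<beta>)) * \<bar>IE\<bar>"
      using N2 s(2) by (simp add: abs_mult)
    also have "s * N / ((N - 1) * (N - \<beta>)) = N / ((N - 1) * A) / sqrt (real n)"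
      unfolding A(2)[symmetric] s(1) using A(1) by (simp add: power2_eq_square)
    also have "N / ((N - 1) * A) / sqrt (real n) * \<bar>IE\<bar> \<le> N / ((N - 1) * A) / sqrt (real n) * (L * Z)"
      using N2 A by (intro mult_left_mono IE) auto
    finally have "\<bar>s * IG - q * IT\<bar> \<le> K' / sqrt (real n) * Z"
      by (simp add: K'_def)
    then have "\<bar>s * IG - q * IT\<bar> / Z \<le> K' / sqrt (real n)"
      using Z by (simp add: divide_le_eq)
    moreover have "(\<integral>\<sigma>. Wn \<beta> n \<sigma> \<bullet> G (q *\<^sub>R Wn \<beta> n \<sigma> + y) \<partial>gibbs \<beta> n) = s * IG / Z"
      unfolding WG by (simp add: integral_gibbs[OF \<beta>(1)] Z_def IG_def w_def)
    moreover have "(\<integral>\<sigma>. (\<Sum>e\<in>Basis. H (q *\<^sub>R Wn \<beta> n \<sigma> + y) e \<bullet> e) \<partial>gibbs \<beta> n) = IT / Z"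
      unfolding pW by (subst integral_gibbs[OF \<beta>(1)]) (auto simp: Z_def IT_def w_def tr_def)
    ultimately show "\<bar>(\<integral>\<sigma>. Wn \<beta> n \<sigma> \<bullet> G (q *\<^sub>R Wn \<beta> n \<sigma> + y) \<partial>gibbs \<beta> n)
      - q * (\<integral>\<sigma>. (\<Sum>e\<in>Basis. H (q *\<^sub>R Wn \<beta> n \<sigma> + y) e \<bullet> e) \<partial>(gibbs \<beta> n :: (nat \<Rightarrow> real ^ 'd) measure))\<bar>
    \<le> K' / sqrt (real n)"
      using Z by (simp add: abs_divide flip: diff_divide_distrib)
  qed
qed

section \<open>Gaussian interpolation\<close>

lemma test_fun_bounded_gradient:
  fixes g :: "real ^ 'd \<Rightarrow> real"
  assumes "test_fun g"
  obtains G H where "\<And>x. (g has_derivative (\<lambda>h. G x \<bullet> h)) (at x)" "bounded_gradient G H"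
proof -
  have lip: "\<bar>g x - g y\<bar> \<le> norm (x - y)" for x y
    using assms by (auto simp: test_fun_def dist_norm dest: lipschitz_onD[of _ _ _ x y])
  obtain G where G: "\<And>x. (g has_derivative (\<lambda>h. G x \<bullet> h)) (at x)"
    and GH: "\<forall>x. \<exists>H. (G has_derivative H) (at x) \<and> onorm H \<le> 1"
    using assms by (auto simp: test_fun_def)
  from GH obtain H where H: "\<And>x. (G has_derivative H x) (at x)" "\<And>x. onorm (H x) \<le> 1"
    by metis
  have "norm (G x) \<le> 1" for x
  proof -
    \<comment> \<open>In the direction of its own gradient \<open>g\<close> grows at rate
      \<open>|G x|^2\<close>, while the Lipschitz bound permits only \<open>|G x|\<close>.\<close>
    have "((\<lambda>t. g (x + t *\<^sub>R G x)) has_derivative (\<lambda>t. G x \<bullet> (t *\<^sub>R G x))) (at 0)"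
      by (rule has_derivative_compose[of "\<lambda>t. x + t *\<^sub>R G x" "\<lambda>t. t *\<^sub>R G x" 0 UNIV g, simplified])
        (auto intro!: derivative_eq_intros G)
    then have "((\<lambda>t. g (x + t *\<^sub>R G x)) has_real_derivative (norm (G x))\<^sup>2) (at 0)"
      by (simp add: has_field_derivative_def mult_commute_abs power2_norm_eq_inner)
    then have "((\<lambda>t. (g (x + t *\<^sub>R G x) - g x) / t) \<longlongrightarrow> (norm (G x))\<^sup>2) (at 0)"
      by (simp add: DERIV_def)
    moreover have "(g (x + t *\<^sub>R G x) - g x) / t \<le> norm (G x)" if "t \<noteq> 0" for t
    proof -
      have "\<bar>(g (x + t *\<^sub>R G x) - g x) / t\<bar> \<le> norm (G x)"
        using lip[of "x + t *\<^sub>R G x" x] that by (simp add: abs_divide divide_le_eq mult.commute)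
      then show ?thesis
        by linarith
    qed
    then have "\<forall>\<^sub>F t in at 0. (g (x + t *\<^sub>R G x) - g x) / t \<le> norm (G x)"
      by (auto simp: eventually_at_filter)
    ultimately have "(norm (G x))\<^sup>2 \<le> norm (G x)"
      by (rule tendsto_upperbound) simp
    then show ?thesis
      by (metis mult_le_cancel_left2 norm_ge_zero not_less order_le_less power2_eq_square zero_le_one)
  qed
  moreover have "norm (H x h) \<le> norm h" for x h
  proof -
    have "norm (H x h) \<le> onorm (H x) * norm h"
      by (intro onorm has_derivative_bounded_linear[OF H(1)])
    also have "\<dots> \<le> 1 * norm h"
      by (intro mult_right_mono H(2)) auto
    finally show ?thesis by simp
  qed
  ultimately have "bounded_gradient G H"
    using H(1) by unfold_locales auto
  with G show ?thesis
    by (rule that)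
qed

text \<open>Coordinatewise Gaussian integration by parts; the chain rule for \<open>x + c z\<close>
  supplies the factor \<open>c\<close>.\<close>

lemma (in bounded_gradient) std_gauss_trace_ibp:
  "(\<integral>z. z \<bullet> G (x + c *\<^sub>R z) \<partial>std_gauss) = c * (\<integral>z. (\<Sum>e\<in>Basis. H (x + c *\<^sub>R z) e \<bullet> e) \<partial>std_gauss)"
proof -
  have *: "(\<integral>z. (G (x + c *\<^sub>R z) \<bullet> e) * (z \<bullet> e) \<partial>std_gauss) = (\<integral>z. c * (H (x + c *\<^sub>R z) e \<bullet> e) \<partial>std_gauss)"
    if e: "e \<in> Basis" for e
  proof (rule std_gauss_ibp[where F' = "\<lambda>z h. c * (H (x + c *\<^sub>R z) h \<bullet> e)" and C = 1 and L = "\<bar>c\<bar>"])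
    fix z z' :: "real ^ 'd"
    have "((\<lambda>z. G (x + c *\<^sub>R z)) has_derivative (\<lambda>h. H (x + c *\<^sub>R z) (c *\<^sub>R h))) (at z)"
      by (rule has_derivative_compose[of "\<lambda>z. x + c *\<^sub>R z" "\<lambda>h. c *\<^sub>R h" z UNIV G, simplified])
        (auto intro!: derivative_eq_intros deriv)
    then show "((\<lambda>z. G (x + c *\<^sub>R z) \<bullet> e) has_derivative (\<lambda>h. c * (H (x + c *\<^sub>R z) h \<bullet> e))) (at z)"
      by (auto intro!: derivative_eq_intros simp: linear_scale[OF linear_H])
    show "\<bar>G (x + c *\<^sub>R z) \<bullet> e\<bar> \<le> 1"
      by (rule abs_inner_G_le[OF e])
    have "\<bar>G (x + c *\<^sub>R z) \<bullet> e - G (x + c *\<^sub>R z') \<bullet> e\<bar> \<le> norm (G (x + c *\<^sub>R z) - G (x + c *\<^sub>R z'))"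
      using Basis_le_norm[OF e] by (metis inner_diff_left)
    also have "\<dots> \<le> norm (c *\<^sub>R (z - z'))"
      using lipschitz_G[of "x + c *\<^sub>R z" "x + c *\<^sub>R z'"] by (simp add: scaleR_diff_right)
    finally show "\<bar>G (x + c *\<^sub>R z) \<bullet> e - G (x + c *\<^sub>R z') \<bullet> e\<bar> \<le> \<bar>c\<bar> * norm (z - z')"
      by simp
  qed (use e in auto)
  have [measurable]: "(\<lambda>z. H (x + c *\<^sub>R z) f \<bullet> e) \<in> borel_measurable borel" for e f
    by (rule measurable_compose[OF _ borel_measurable_H]) measurable
  have int1: "integrable std_gauss (\<lambda>z. (G (x + c *\<^sub>R z) \<bullet> e) * (z \<bullet> e))" if e: "e \<in> Basis" for e
  proof (rule Bochner_Integration.integrable_bound[OF integrable_std_gauss_norm])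
    have "\<bar>G (x + c *\<^sub>R z) \<bullet> e\<bar> * \<bar>z \<bullet> e\<bar> \<le> 1 * norm z" for z
      by (intro mult_mono abs_inner_G_le Basis_le_norm e) auto
    then show "AE z in std_gauss. norm ((G (x + c *\<^sub>R z) \<bullet> e) * (z \<bullet> e)) \<le> norm (norm z)"
      by (simp add: abs_mult)
  qed measurable
  have int2: "integrable std_gauss (\<lambda>z. H (x + c *\<^sub>R z) e \<bullet> e)" if e: "e \<in> Basis" for e
    by (rule gauss.integrable_const_bound[where B = "norm e"]) (use abs_inner_H_le[OF e] in auto)
  have "(\<integral>z. z \<bullet> G (x + c *\<^sub>R z) \<partial>std_gauss) = (\<integral>z. (\<Sum>e\<in>Basis. (G (x + c *\<^sub>R z) \<bullet> e) * (z \<bullet> e)) \<partial>std_gauss)"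
    by (subst euclidean_inner) (simp add: mult.commute)
  also have "\<dots> = (\<Sum>e\<in>Basis. c * (\<integral>z. H (x + c *\<^sub>R z) e \<bullet> e \<partial>std_gauss))"
    by (subst Bochner_Integration.integral_sum) (auto simp: int1 *)
  also have "\<dots> = c * (\<integral>z. (\<Sum>e\<in>Basis. H (x + c *\<^sub>R z) e \<bullet> e) \<partial>std_gauss)"
    by (subst Bochner_Integration.integral_sum) (auto simp: int2 sum_distrib_left)
  finally show ?thesis .
qed

lemma abs_sin_cos_diff_le:
  fixes s t :: real
  shows "\<bar>sin s - sin t\<bar> \<le> \<bar>s - t\<bar>" "\<bar>cos s - cos t\<bar> \<le> \<bar>s - t\<bar>"
proof -
  have "norm (sin s - sin t) \<le> 1 * norm (s - t)"
    by (rule field_differentiable_bound[of UNIV sin cos]) (auto intro!: derivative_eq_intros)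
  then show "\<bar>sin s - sin t\<bar> \<le> \<bar>s - t\<bar>"
    by simp
  have "norm (cos s - cos t) \<le> 1 * norm (s - t)"
    by (rule field_differentiable_bound[of UNIV cos "\<lambda>x. - sin x"]) (auto intro!: derivative_eq_intros)
  then show "\<bar>cos s - cos t\<bar> \<le> \<bar>s - t\<bar>"
    by simp
qed

text \<open>Along the interpolation \<open>E g (sin t W + cos t Z)\<close> the derivative is
  \<open>cos t (E W \<bullet> \<nabla>g - sin t E \<Delta>g)\<close> after integrating by parts in \<open>Z\<close>.\<close>
lemma gauss_interpolation_bound:
  fixes W :: "'a \<Rightarrow> real ^ 'd" and g :: "real ^ 'd \<Rightarrow> real"
  assumes \<mu>: "prob_space \<mu>" and W [measurable]: "W \<in> borel_measurable \<mu>" and intW: "integrable \<mu> (\<lambda>\<omega>. norm (W \<omega>))"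
    and g: "\<And>x. (g has_derivative (\<lambda>h. G x \<bullet> h)) (at x)" and bg: "bounded_gradient G H"
    and stein: "\<And>q y. 0 \<le> q \<Longrightarrow> q \<le> 1 \<Longrightarrow>
      \<bar>(\<integral>\<omega>. W \<omega> \<bullet> G (q *\<^sub>R W \<omega> + y) \<partial>\<mu>) - q * (\<integral>\<omega>. (\<Sum>e\<in>Basis. H (q *\<^sub>R W \<omega> + y) e \<bullet> e) \<partial>\<mu>)\<bar> \<le> \<epsilon>"
  shows "\<bar>(\<integral>\<omega>. g (W \<omega>) \<partial>\<mu>) - (\<integral>z. g z \<partial>std_gauss)\<bar> \<le> 2 * \<epsilon>"
proof -
  interpret \<mu>: prob_space \<mu>
    by (rule \<mu>)
  interpret bounded_gradient G H
    by (rule bg)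
  interpret PP: pair_prob_space \<mu> "std_gauss :: (real ^ 'd) measure"
    by unfold_locales
  let ?P = "\<mu> \<Otimes>\<^sub>M (std_gauss :: (real ^ 'd) measure)"
  have "continuous_on UNIV g"
    using g by (meson continuous_at_imp_continuous_on has_derivative_continuous)
  then have [measurable]: "g \<in> borel_measurable borel"
    by (rule borel_measurable_continuous_onI)
  have lip: "\<bar>g x - g y\<bar> \<le> norm (x - y)" for x y
  proof -
    have "norm (g x - g y) \<le> 1 * norm (x - y)"
    proof (rule differentiable_bound[of UNIV g "\<lambda>x h. G x \<bullet> h"])
      show "onorm (\<lambda>h. G z \<bullet> h) \<le> 1" for z
      proof (rule onorm_bound)
        show "norm (G z \<bullet> h) \<le> 1 * norm h" for h
          using Cauchy_Schwarz_ineq2[of "G z" h] mult_right_mono[OF norm_G[of z], of "norm h"] by simp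
      qed simp
    qed (use g in \<open>auto intro: has_derivative_at_withinI\<close>)
    then show ?thesis by simp
  qed
  define p where "p t x = sin t *\<^sub>R W (fst x) + cos t *\<^sub>R snd x" for t and x :: "'a \<times> (real ^ 'd)"
  have [measurable]: "p t \<in> borel_measurable ?P" for t
    unfolding p_def by measurable
  have norm_p: "norm (p t x) \<le> norm (W (fst x)) + norm (snd x)" for t x
    unfolding p_def
    by (intro order_trans[OF norm_triangle_ineq] add_mono) (auto simp: mult_left_le_one_le)
  \<comment> \<open>Dominates the path \<open>p t\<close> and its velocity uniformly in
    \<open>t\<close>.\<close>
  define K where "K x = norm (W (fst x)) + norm (snd x)" for x :: "'a \<times> (real ^ 'd)"
  have intK: "integrable ?P K"
  proof -
    have "integrable ?P (\<lambda>x. norm (W (fst x)))" "integrable ?P (\<lambda>x. norm (snd x))"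
      using PP.Fubini_integrable[of "\<lambda>x. norm (W (fst x))"] PP.Fubini_integrable[of "\<lambda>x. norm (snd x)"]
        intW integrable_std_gauss_norm[where 'd = 'd] by auto
    then show ?thesis
      unfolding K_def by (rule Bochner_Integration.integrable_add)
  qed
  have K0: "K x \<ge> 0" for x
    by (simp add: K_def)
  have int_g: "integrable ?P (\<lambda>x. g (h x))"
    if [measurable]: "h \<in> borel_measurable ?P" and h: "\<And>x. norm (h x) \<le> K x" for h
  proof (rule Bochner_Integration.integrable_bound)
    show "integrable ?P (\<lambda>x. \<bar>g 0\<bar> + K x)"
      using intK by simp
    have "\<bar>g (h x)\<bar> \<le> \<bar>g 0\<bar> + K x" for x
      using lip[of "h x" 0] h[of x] unfolding diff_zero by linarith
    then show "AE x in ?P. norm (g (h x)) \<le> norm (\<bar>g 0\<bar> + K x)"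
      unfolding real_norm_def by (intro AE_I2 order_trans[OF _ abs_ge_self])
  qed measurable
  define \<phi> where "\<phi> t = (\<integral>x. g (p t x) \<partial>?P)" for t
  define D where "D t x = G (p t x) \<bullet> (cos t *\<^sub>R W (fst x) - sin t *\<^sub>R snd x)" for t x
  have \<phi>': "(\<phi> has_real_derivative (\<integral>x. D t x \<partial>?P)) (at t)" for t
    unfolding \<phi>_def
  proof (rule dominated_derivative_has_derivative[where K = K])
    show "integrable ?P (\<lambda>x. g (p s x))" for s
      by (rule int_g) (simp_all add: K_def norm_p)
    show "((\<lambda>t. g (p t x)) has_real_derivative D t x) (at t)" for x
    proof -
      have "((\<lambda>t. p t x) has_derivative (\<lambda>h. h *\<^sub>R (cos t *\<^sub>R W (fst x) - sin t *\<^sub>R snd x))) (at t)"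
        unfolding p_def by (auto intro!: derivative_eq_intros simp: algebra_simps)
      from has_derivative_compose[OF this g] show ?thesis
        by (simp add: has_field_derivative_def D_def mult_commute_abs)
    qed
    show "AE x in ?P. \<forall>s. \<bar>s - t\<bar> \<le> 1 \<longrightarrow> \<bar>g (p s x) - g (p t x)\<bar> \<le> K x * \<bar>s - t\<bar>"
    proof (intro AE_I2 allI impI)
      fix x s
      have "p s x - p t x = (sin s - sin t) *\<^sub>R W (fst x) + (cos s - cos t) *\<^sub>R snd x"
        by (simp add: p_def algebra_simps)
      then have "norm (p s x - p t x) \<le> \<bar>sin s - sin t\<bar> * norm (W (fst x)) + \<bar>cos s - cos t\<bar> * norm (snd x)"
        by (metis norm_scaleR norm_triangle_ineq)
      also have "\<dots> \<le> \<bar>s - t\<bar> * norm (W (fst x)) + \<bar>s - t\<bar> * norm (snd x)"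
        by (intro add_mono mult_right_mono abs_sin_cos_diff_le) auto
      finally show "\<bar>g (p s x) - g (p t x)\<bar> \<le> K x * \<bar>s - t\<bar>"
        using lip[of "p s x" "p t x"] by (simp add: K_def algebra_simps)
    qed
  qed (rule intK)
  have bound: "\<bar>\<integral>x. D t x \<partial>?P\<bar> \<le> \<epsilon>" if t: "0 \<le> t" "t \<le> pi / 2" for t
  proof -
    have q: "0 \<le> sin t" "sin t \<le> 1" "0 \<le> cos t" "cos t \<le> 1"
      using t by (auto intro: sin_ge_zero cos_ge_zero)
    have [measurable]: "(\<lambda>x. H (p t x) f \<bullet> e) \<in> borel_measurable ?P" for e f
      by (rule measurable_compose[OF _ borel_measurable_H]) measurable
    define tr where "tr x = (\<Sum>e\<in>Basis. H (p t x) e \<bullet> e)" for x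
    have trm [measurable]: "tr \<in> borel_measurable ?P"
      unfolding tr_def by measurable
    have GK: "\<bar>G (p t x) \<bullet> W (fst x)\<bar> \<le> K x" "\<bar>G (p t x) \<bullet> snd x\<bar> \<le> K x" for x
    proof -
      have c: "\<bar>G (p t x) \<bullet> v\<bar> \<le> norm v" for v
        using Cauchy_Schwarz_ineq2[of "G (p t x)" v] mult_right_mono[OF norm_G[of "p t x"], of "norm v"] by simp
      show "\<bar>G (p t x) \<bullet> W (fst x)\<bar> \<le> K x" "\<bar>G (p t x) \<bullet> snd x\<bar> \<le> K x"
        using c[of "W (fst x)"] c[of "snd x"] by (auto simp: K_def add_increasing add_increasing2)
    qed
    have i1: "integrable ?P (\<lambda>x. G (p t x) \<bullet> W (fst x))"
      by (rule Bochner_Integration.integrable_bound[OF intK]) (use GK K0 in auto)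
    have i2: "integrable ?P (\<lambda>x. G (p t x) \<bullet> snd x)"
      by (rule Bochner_Integration.integrable_bound[OF intK]) (use GK K0 in auto)
    have "\<bar>tr x\<bar> \<le> (\<Sum>e\<in>(Basis :: (real ^ 'd) set). norm e)" for x
      unfolding tr_def by (intro order_trans[OF sum_abs] sum_mono abs_inner_H_le)
    then have i3: "integrable ?P tr"
      by (intro PP.P.integrable_const_bound[where B = "\<Sum>e\<in>(Basis :: (real ^ 'd) set). norm e"]) auto
    have D_eq: "(\<integral>x. D t x \<partial>?P) = cos t * (\<integral>x. G (p t x) \<bullet> W (fst x) \<partial>?P) - sin t * (\<integral>x. G (p t x) \<bullet> snd x \<partial>?P)"
      unfolding D_def inner_diff_right inner_scaleR_right using i1 i2 by simp
    \<comment> \<open>Gaussian integration by parts with \<open>W\<close> frozen: the inner integral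
      runs over \<open>z\<close>.\<close>
    have "(\<integral>x. G (p t x) \<bullet> snd x \<partial>?P) = (\<integral>\<omega>. \<integral>z. G (p t (\<omega>, z)) \<bullet> z \<partial>std_gauss \<partial>\<mu>)"
      using PP.integral_fst'[OF i2] by simp
    also have "\<dots> = (\<integral>\<omega>. cos t * (\<integral>z. tr (\<omega>, z) \<partial>std_gauss) \<partial>\<mu>)"
      using std_gauss_trace_ibp[of "sin t *\<^sub>R W _" "cos t"] by (simp add: p_def tr_def inner_commute)
    also have "\<dots> = cos t * (\<integral>x. tr x \<partial>?P)"
      using PP.integral_fst'[OF i3] by simp
    finally have e2: "(\<integral>x. G (p t x) \<bullet> snd x \<partial>?P) = cos t * (\<integral>x. tr x \<partial>?P)" .
    \<comment> \<open>The opposite order, with \<open>z\<close> frozen, so that \<open>stein\<close>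
      applies inside with \<open>q = sin t\<close> and \<open>y = cos t z\<close>.\<close>
    have j1: "(\<integral>x. G (p t x) \<bullet> W (fst x) \<partial>?P) = (\<integral>z. \<integral>\<omega>. G (p t (\<omega>, z)) \<bullet> W \<omega> \<partial>\<mu> \<partial>std_gauss)"
      using PP.integral_snd[of "\<lambda>\<omega> z. G (p t (\<omega>, z)) \<bullet> W \<omega>"] i1 by (simp add: case_prod_unfold)
    have j3: "(\<integral>x. tr x \<partial>?P) = (\<integral>z. \<integral>\<omega>. tr (\<omega>, z) \<partial>\<mu> \<partial>std_gauss)"
      using PP.integral_snd[of "\<lambda>\<omega> z. tr (\<omega>, z)"] i3 by (simp add: case_prod_unfold)
    have k1: "integrable std_gauss (\<lambda>z. \<integral>\<omega>. G (p t (\<omega>, z)) \<bullet> W \<omega> \<partial>\<mu>)"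
      using PP.integrable_snd[of "\<lambda>\<omega> z. G (p t (\<omega>, z)) \<bullet> W \<omega>"] i1 by (simp add: case_prod_unfold)
    have k3: "integrable std_gauss (\<lambda>z. \<integral>\<omega>. tr (\<omega>, z) \<partial>\<mu>)"
      using PP.integrable_snd[of "\<lambda>\<omega> z. tr (\<omega>, z)"] i3 by (simp add: case_prod_unfold)
    \<comment> \<open>The Gaussian side contributes the trace with coefficient
      \<open>sin t * cos t\<close>; taking out \<open>cos t\<close> leaves precisely the combination
      that \<open>stein\<close> bounds.\<close>
    have "(\<integral>x. D t x \<partial>?P) = cos t * ((\<integral>x. G (p t x) \<bullet> W (fst x) \<partial>?P) - sin t * (\<integral>x. tr x \<partial>?P))"
      unfolding D_eq e2 by (simp add: algebra_simps)
    also have "(\<integral>x. G (p t x) \<bullet> W (fst x) \<partial>?P) - sin t * (\<integral>x. tr x \<partial>?P)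
        = (\<integral>z. (\<integral>\<omega>. G (p t (\<omega>, z)) \<bullet> W \<omega> \<partial>\<mu>) - sin t * (\<integral>\<omega>. tr (\<omega>, z) \<partial>\<mu>) \<partial>std_gauss)"
      unfolding j1 j3 using k1 k3 by simp
    finally have eq: "(\<integral>x. D t x \<partial>?P) = cos t * (\<integral>z. (\<integral>\<omega>. G (p t (\<omega>, z)) \<bullet> W \<omega> \<partial>\<mu>) - sin t * (\<integral>\<omega>. tr (\<omega>, z) \<partial>\<mu>) \<partial>std_gauss)" .
    have pt: "\<bar>(\<integral>\<omega>. G (p t (\<omega>, z)) \<bullet> W \<omega> \<partial>\<mu>) - sin t * (\<integral>\<omega>. tr (\<omega>, z) \<partial>\<mu>)\<bar> \<le> \<epsilon>" for z
      using stein[OF q(1,2), of "cos t *\<^sub>R z"] by (simp add: p_def tr_def inner_commute)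
    have "\<bar>\<integral>z. (\<integral>\<omega>. G (p t (\<omega>, z)) \<bullet> W \<omega> \<partial>\<mu>) - sin t * (\<integral>\<omega>. tr (\<omega>, z) \<partial>\<mu>) \<partial>std_gauss\<bar>
        \<le> (\<integral>z. \<bar>(\<integral>\<omega>. G (p t (\<omega>, z)) \<bullet> W \<omega> \<partial>\<mu>) - sin t * (\<integral>\<omega>. tr (\<omega>, z) \<partial>\<mu>)\<bar> \<partial>std_gauss)"
      by (rule integral_abs_bound)
    also have "\<dots> \<le> (\<integral>z. \<epsilon> \<partial>(std_gauss :: (real ^ 'd) measure))"
      using k1 k3 pt by (intro integral_mono) auto
    also have "\<dots> = \<epsilon>"
      by simp
    finally have "\<bar>\<integral>x. D t x \<partial>?P\<bar> \<le> cos t * \<epsilon>"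
      unfolding eq abs_mult using q by (simp add: mult_left_mono)
    also have "\<dots> \<le> 1 * \<epsilon>"
      using q pt[of 0] by (intro mult_right_mono) linarith+
    finally show ?thesis
      by simp
  qed
  have eps0: "0 \<le> \<epsilon>"
    using bound[of 0] by simp
  \<comment> \<open>The mean value inequality on the quarter circle takes the place of integrating
    the derivative in \<open>t\<close>; \<open>pi / 2 \<le> 2\<close> is the source of the factor
    2.\<close>
  have "norm (\<phi> (pi / 2) - \<phi> 0) \<le> \<epsilon> * norm (pi / 2 - 0)"
    by (rule field_differentiable_bound[of "{0..pi / 2}" \<phi> "\<lambda>t. \<integral>x. D t x \<partial>?P"])
      (use bound in \<open>auto intro: DERIV_subset[OF \<phi>']\<close>)
  also have "\<dots> \<le> \<epsilon> * 2"
    using eps0 pi_less_4 by (intro mult_left_mono) auto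
  finally have "\<bar>\<phi> (pi / 2) - \<phi> 0\<bar> \<le> 2 * \<epsilon>"
    by simp
  moreover have "\<phi> (pi / 2) = (\<integral>\<omega>. g (W \<omega>) \<partial>\<mu>)"
  proof -
    have "integrable ?P (\<lambda>x. g (W (fst x)))"
      by (rule int_g) (simp_all add: K_def)
    from PP.integral_fst'[OF this] show ?thesis
      by (simp add: \<phi>_def p_def)
  qed
  moreover have "\<phi> 0 = (\<integral>z. g z \<partial>std_gauss)"
  proof -
    have "integrable ?P (\<lambda>x. g (snd x))"
      by (rule int_g) (simp_all add: K_def)
    from PP.integral_fst'[OF this] show ?thesis
      using \<mu>.prob_space by (simp add: \<phi>_def p_def)
  qed
  ultimately show ?thesis
    by simp
qed

theorem theorem3p1:
  fixes \<beta> :: real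
  assumes "CARD('d::finite) \<ge> 2" and "0 \<le> \<beta>" and "\<beta> < real CARD('d)"
  shows "\<exists>c::real. \<forall>n::nat. n \<ge> 1 \<longrightarrow>
           (\<forall>g :: real ^ 'd \<Rightarrow> real. test_fun g \<longrightarrow>
              \<bar>(\<integral>\<sigma>. g (Wn \<beta> n \<sigma>) \<partial>gibbs \<beta> n) - (\<integral>z. g z \<partial>std_gauss)\<bar>
                \<le> c / sqrt (real n))"
proof -
  obtain K where K: "\<And>n G H q y. n \<ge> 1 \<Longrightarrow> bounded_gradient G H \<Longrightarrow> 0 \<le> q \<Longrightarrow> q \<le> 1 \<Longrightarrow>
    \<bar>(\<integral>\<sigma>. Wn \<beta> n \<sigma> \<bullet> G (q *\<^sub>R Wn \<beta> n \<sigma> + y) \<partial>gibbs \<beta> n)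
      - q * (\<integral>\<sigma>. (\<Sum>e\<in>Basis. H (q *\<^sub>R Wn \<beta> n \<sigma> + y) e \<bullet> e) \<partial>(gibbs \<beta> n :: (nat \<Rightarrow> real ^ 'd) measure))\<bar>
    \<le> K / sqrt (real n)"
    using gibbs_stein_bound[OF assms] by blast
  show ?thesis
  proof (intro exI allI impI)
    fix n :: nat and g :: "real ^ 'd \<Rightarrow> real"
    assume n: "n \<ge> 1" and "test_fun g"
    then obtain G H where g: "\<And>x. (g has_derivative (\<lambda>h. G x \<bullet> h)) (at x)" "bounded_gradient G H"
      using test_fun_bounded_gradient by blast
    interpret prob_space "gibbs \<beta> n :: (nat \<Rightarrow> real ^ 'd) measure"
      by (rule prob_space_gibbs[OF assms(2)])
    have W: "(Wn \<beta> n :: (nat \<Rightarrow> real ^ 'd) \<Rightarrow> _) \<in> borel_measurable (gibbs \<beta> n)"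
      unfolding borel_measurable_gibbs_iff Wn_eq[abs_def] by measurable
    \<comment> \<open>For fixed \<open>n\<close> the vector is bounded, being a multiple of a sum of
      \<open>n\<close> unit spins; this supplies integrability, while the rate comes from
      \<open>K\<close> alone.\<close>
    have "AE \<sigma> in gibbs \<beta> n. norm (norm (Wn \<beta> n \<sigma> :: real ^ 'd)) \<le> sqrt ((real CARD('d) - \<beta>) / real n) * real n"
      using AE_gibbs_norm
    proof (rule eventually_mono)
      fix \<sigma> :: "nat \<Rightarrow> real ^ 'd" assume "\<forall>i<n. norm (\<sigma> i) = 1"
      then show "norm (norm (Wn \<beta> n \<sigma>)) \<le> sqrt ((real CARD('d) - \<beta>) / real n) * real n"
        using norm_spin_sum_le[of n \<sigma>] assms(3) unfolding Wn_eq by (simp add: mult_left_mono)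
    qed
    then have "integrable (gibbs \<beta> n) (\<lambda>\<sigma>. norm (Wn \<beta> n \<sigma> :: real ^ 'd))"
      using W by (intro integrable_const_bound) auto
    from gauss_interpolation_bound[OF prob_space_gibbs[OF assms(2)] W this g K[OF n g(2)]]
    show "\<bar>(\<integral>\<sigma>. g (Wn \<beta> n \<sigma>) \<partial>gibbs \<beta> n) - (\<integral>z. g z \<partial>std_gauss)\<bar> \<le> (2 * K) / sqrt (real n)"
      by simp
  qed
qed

end
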